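(* Let $\mathcal{A}$ be an AB3 abelian category, let $\mathcal{U}$ be a set of objects of $\mathcal{A}$ and denote $\mathcal{B}=\operatorname{Pres}(\mathcal{U})$. The following assertions are equivalent: (1) $\mathcal{B}$ is a coreflective subcategory that is abelian. (2) $\mathcal{B}$ is closed under taking cokernels and, for every morphism $f:B\to B'$ in $\mathcal{B}$, the induced morphism $\bar{f}:\frac{B}{\operatorname{tr}_{\mathcal{U}}(\operatorname{Ker} f)}\to\operatorname{Im} f$ satisfies that $\mathcal{A}(U,\bar{f})$ is an isomorphism for each $U\in\mathcal{U}$. (3) $\mathcal{B}$ is closed under taking cokernels and, for each morphism $f:B\to B'$ in $\mathcal{B}$, the induced morphism $\bar{f}:\frac{B}{\operatorname{tr}_{\mathcal{U}}(\operatorname{Ker} f)}\to\operatorname{Im} f$ is a $\mathcal{B}$-coreflection. (4) The following two conditions hold: (a) $\mathcal{A}\left(U,\frac{\operatorname{Ker}\varepsilon_A}{\operatorname{tr}_{\mathcal{U}}(\operatorname{Ker}\varepsilon_A)}\right)=0$ for all $A\in\mathcal{A}$ and $U\in\mathcal{U}$; (b) for every morphism $g:\tilde{U}\to B$, where $B\in\mathcal{B}$ and $\tilde{U}\in\operatorname{Sum}(\mathcal{U})$, the induced morphism $\bar{g}:\frac{\tilde{U}}{\operatorname{tr}_{\mathcal{U}}(\operatorname{Ker} g)}\to\operatorname{Im} g$ satisfies that $\mathcal{A}(U,\bar{g})$ is an isomorphism for each $U\in\mathcal{U}$. In this case, up to natural isomorphism, the right adjoint $q:\mathcal{A}\to\operatorname{Pres}(\mathcal{U})$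 of the inclusion functor acts on objects as $q(A)=\frac{\hat{U}_A}{\operatorname{tr}_{\mathcal{U}}(\operatorname{Ker}\varepsilon_A)}$.
   Context: AB3 means cocomplete. Subcategories are full and closed under isomorphisms; $\mathcal{B}$ is coreflective if its inclusion has a right adjoint; closed under cokernels means that the cokernel in $\mathcal{A}$ of every morphism between objects of $\mathcal{B}$ is in $\mathcal{B}$. Kernels and images are taken in $\mathcal{A}$. $\operatorname{Sum}(\mathcal{U})$ is the class of all (set-indexed) coproducts of objects from $\mathcal{U}$; an object is $\mathcal{U}$-generated if it is an epimorphic image of an object of $\operatorname{Sum}(\mathcal{U})$; $\operatorname{Pres}(\mathcal{U})$ is the class of objects isomorphic to cokernels of morphisms between objects of $\operatorname{Sum}(\mathcal{U})$. For $A\in\mathcal{A}$, $\hat{U}_A=\coprod_{U\in\mathcal{U}}U^{(\mathcal{A}(U,A))}$ and $\varepsilon_A:\hat{U}_A\to A$ is the canonical morphism whose component at $\alpha\in\mathcal{A}(U,A)$ is $\alpha$. The trace $\operatorname{tr}_{\mathcal{U}}(A)$ is the largest $\mathcal{U}$-generated subobject of $A$ (namely $\operatorname{Im}\varepsilon_A$). A $\mathcal{B}$-coreflection of $A$ is a morphism $p:B_A\to A$ with $B_A\in\mathcal{B}$ such that $\mathcal{A}(B,p)$ is bijective for every $B\in\mathcal{B}$. *)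

theory Defs
  imports "HOL-Algebra.Group"
begin

unbundle cardinal_syntax

section \<open>Categories, functors, adjunctions\<close>

text \<open>The composite \<open>g \<cdot>\<^bsub>C\<^esub> f\<close> is meaningful only for \<open>Cod C f = Dom C g\<close>.\<close>

record ('o, 'm) cat =
  Obj :: "'o set"
  Arr :: "'m set"
  Dom :: "'m \<Rightarrow> 'o"
  Cod :: "'m \<Rightarrow> 'o"
  Ident :: "'o \<Rightarrow> 'm"
  Comp :: "'m \<Rightarrow> 'm \<Rightarrow> 'm"  (infixr \<open>\<cdot>\<index>\<close> 70)

definition Hom :: "('o, 'm, 'z) cat_scheme \<Rightarrow> 'o \<Rightarrow> 'o \<Rightarrow> 'm set" where
  "Hom C a b = {f \<in> Arr C. Dom C f = a \<and> Cod C f = b}"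

locale category =
  fixes C :: "('o, 'm, 'z) cat_scheme" (structure)
  assumes Dom_Obj: "f \<in> Arr C \<Longrightarrow> Dom C f \<in> Obj C"
    and Cod_Obj: "f \<in> Arr C \<Longrightarrow> Cod C f \<in> Obj C"
    and Ident_Hom: "a \<in> Obj C \<Longrightarrow> Ident C a \<in> Hom C a a"
    and Comp_Hom: "f \<in> Hom C a b \<Longrightarrow> g \<in> Hom C b c \<Longrightarrow> g \<cdot> f \<in> Hom C a c"
    and Comp_Ident: "f \<in> Arr C \<Longrightarrow> f \<cdot> Ident C (Dom C f) = f"
    and Ident_Comp: "f \<in> Arr C \<Longrightarrow> Ident C (Cod C f) \<cdot> f = f"
    and Comp_assoc: "f \<in> Hom C a b \<Longrightarrow> g \<in> Hom C b c \<Longrightarrow> h \<in> Hom C c d \<Longrightarrow>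
      (h \<cdot> g) \<cdot> f = h \<cdot> (g \<cdot> f)"

definition iso_arr :: "('o, 'm, 'z) cat_scheme \<Rightarrow> 'm \<Rightarrow> bool" where
  "iso_arr C f \<longleftrightarrow> f \<in> Arr C \<and>
    (\<exists>g \<in> Hom C (Cod C f) (Dom C f).
       g \<cdot>\<^bsub>C\<^esub> f = Ident C (Dom C f) \<and> f \<cdot>\<^bsub>C\<^esub> g = Ident C (Cod C f))"

definition isomorphic :: "('o, 'm, 'z) cat_scheme \<Rightarrow> 'o \<Rightarrow> 'o \<Rightarrow> bool" where
  "isomorphic C a b \<longleftrightarrow> (\<exists>f \<in> Hom C a b. iso_arr C f)"

definition mono_arr :: "('o, 'm, 'z) cat_scheme \<Rightarrow> 'm \<Rightarrow> bool" where
  "mono_arr C f \<longleftrightarrow> f \<in> Arr C \<and>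
    (\<forall>x \<in> Obj C. \<forall>g \<in> Hom C x (Dom C f). \<forall>h \<in> Hom C x (Dom C f).
       f \<cdot>\<^bsub>C\<^esub> g = f \<cdot>\<^bsub>C\<^esub> h \<longrightarrow> g = h)"

definition epi_arr :: "('o, 'm, 'z) cat_scheme \<Rightarrow> 'm \<Rightarrow> bool" where
  "epi_arr C f \<longleftrightarrow> f \<in> Arr C \<and>
    (\<forall>x \<in> Obj C. \<forall>g \<in> Hom C (Cod C f) x. \<forall>h \<in> Hom C (Cod C f) x.
       g \<cdot>\<^bsub>C\<^esub> f = h \<cdot>\<^bsub>C\<^esub> f \<longrightarrow> g = h)"

definition full_sub :: "('o, 'm, 'z) cat_scheme \<Rightarrow> 'o set \<Rightarrow> ('o, 'm, 'z) cat_scheme" where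
  "full_sub C B = C\<lparr>Obj := Obj C \<inter> B, Arr := {f \<in> Arr C. Dom C f \<in> B \<and> Cod C f \<in> B}\<rparr>"

record ('o, 'm, 'p, 'n) functr =
  FObj :: "'o \<Rightarrow> 'p"
  FArr :: "'m \<Rightarrow> 'n"

definition cat_functor :: "('o, 'm, 'y) cat_scheme \<Rightarrow> ('p, 'n, 'z) cat_scheme \<Rightarrow>
    ('o, 'm, 'p, 'n) functr \<Rightarrow> bool" where
  "cat_functor C D F \<longleftrightarrow>
    (\<forall>a \<in> Obj C. FObj F a \<in> Obj D \<and> FArr F (Ident C a) = Ident D (FObj F a)) \<and>
    (\<forall>f \<in> Arr C. FArr F f \<in> Hom D (FObj F (Dom C f)) (FObj F (Cod C f))) \<and>
    (\<forall>f \<in> Arr C. \<forall>g \<in> Arr C. Cod C f = Dom C g \<longrightarrow>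
       FArr F (g \<cdot>\<^bsub>C\<^esub> f) = FArr F g \<cdot>\<^bsub>D\<^esub> FArr F f)"

definition naturally_isomorphic :: "('o, 'm, 'y) cat_scheme \<Rightarrow> ('p, 'n, 'z) cat_scheme \<Rightarrow>
    ('o, 'm, 'p, 'n) functr \<Rightarrow> ('o, 'm, 'p, 'n) functr \<Rightarrow> bool" where
  "naturally_isomorphic C D F G \<longleftrightarrow> (\<exists>\<eta>.
    (\<forall>a \<in> Obj C. \<eta> a \<in> Hom D (FObj F a) (FObj G a) \<and> iso_arr D (\<eta> a)) \<and>
    (\<forall>f \<in> Arr C. \<eta> (Cod C f) \<cdot>\<^bsub>D\<^esub> FArr F f = FArr G f \<cdot>\<^bsub>D\<^esub> \<eta> (Dom C f)))"

text \<open>\<open>right_adjoint D C L R\<close>: the functor \<open>R : C \<rightarrow> D\<close> is right adjoint to \<open>L : D \<rightarrow> C\<close>.\<close>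

definition right_adjoint :: "('p, 'n, 'y) cat_scheme \<Rightarrow> ('o, 'm, 'z) cat_scheme \<Rightarrow>
    ('p, 'n, 'o, 'm) functr \<Rightarrow> ('o, 'm, 'p, 'n) functr \<Rightarrow> bool" where
  "right_adjoint D C L R \<longleftrightarrow> cat_functor D C L \<and> cat_functor C D R \<and>
    (\<exists>\<phi>. (\<forall>b \<in> Obj D. \<forall>a \<in> Obj C.
            bij_betw (\<phi> b a) (Hom C (FObj L b) a) (Hom D b (FObj R a))) \<and>
         (\<forall>b \<in> Obj D. \<forall>b' \<in> Obj D. \<forall>a \<in> Obj C. \<forall>a' \<in> Obj C.
            \<forall>g \<in> Hom D b' b. \<forall>h \<in> Hom C (FObj L b) a. \<forall>f \<in> Hom C a a'.
              \<phi> b' a' (f \<cdot>\<^bsub>C\<^esub> (h \<cdot>\<^bsub>C\<^esub> FArr L g)) = FArr R f \<cdot>\<^bsub>D\<^esub> (\<phi> b a h \<cdot>\<^bsub>D\<^esub> g)))"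

definition inclusion :: "('o, 'm, 'o, 'm) functr" where
  "inclusion = \<lparr>FObj = (\<lambda>a. a), FArr = (\<lambda>f. f)\<rparr>"

definition coreflective :: "('o, 'm, 'z) cat_scheme \<Rightarrow> 'o set \<Rightarrow> bool" where
  "coreflective C B \<longleftrightarrow> (\<exists>R. right_adjoint (full_sub C B) C inclusion R)"

definition is_coreflection :: "('o, 'm, 'z) cat_scheme \<Rightarrow> 'o set \<Rightarrow> 'o \<Rightarrow> 'm \<Rightarrow> bool" where
  "is_coreflection C B a p \<longleftrightarrow> p \<in> Arr C \<and> Cod C p = a \<and> Dom C p \<in> B \<and>
    (\<forall>b \<in> B. bij_betw (\<lambda>g. p \<cdot>\<^bsub>C\<^esub> g) (Hom C b (Dom C p)) (Hom C b a))"

section \<open>Smallness, colimits, coproducts\<close>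

text \<open>
  HOL has no sets-versus-classes distinction, so ``set'' is read relative to a regular infinite
  cardinal \<open>\<kappa>\<close>: small means of cardinality less than \<open>\<kappa>\<close>. The sets of a Grothendieck universe
  are the case of an inaccessible \<open>\<kappa>\<close>. Every small set, of whatever type, is in bijection with a
  subset of the type \<open>'k\<close> underlying \<open>\<kappa>\<close>, so index sets and index categories may be
  taken in that type.
\<close>

definition small :: "'k rel \<Rightarrow> 'a set \<Rightarrow> bool" where
  "small \<kappa> X \<longleftrightarrow> |X| <o \<kappa>"

definition is_cocone :: "('j, 'i, 'y) cat_scheme \<Rightarrow> ('o, 'm, 'z) cat_scheme \<Rightarrow>
    ('j, 'i, 'o, 'm) functr \<Rightarrow> 'o \<Rightarrow> ('j \<Rightarrow> 'm) \<Rightarrow> bool" where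
  "is_cocone J C F x \<iota> \<longleftrightarrow> x \<in> Obj C \<and>
    (\<forall>j \<in> Obj J. \<iota> j \<in> Hom C (FObj F j) x) \<and>
    (\<forall>u \<in> Arr J. \<iota> (Cod J u) \<cdot>\<^bsub>C\<^esub> FArr F u = \<iota> (Dom J u))"

definition is_colimit :: "('j, 'i, 'y) cat_scheme \<Rightarrow> ('o, 'm, 'z) cat_scheme \<Rightarrow>
    ('j, 'i, 'o, 'm) functr \<Rightarrow> 'o \<Rightarrow> ('j \<Rightarrow> 'm) \<Rightarrow> bool" where
  "is_colimit J C F x \<iota> \<longleftrightarrow> is_cocone J C F x \<iota> \<and>
    (\<forall>y \<tau>. is_cocone J C F y \<tau> \<longrightarrow>
       (\<exists>!h. h \<in> Hom C x y \<and> (\<forall>j \<in> Obj J. h \<cdot>\<^bsub>C\<^esub> \<iota> j = \<tau> j)))"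

definition cocomplete :: "'k rel \<Rightarrow> ('o, 'm, 'z) cat_scheme \<Rightarrow> bool" where
  "cocomplete \<kappa> C \<longleftrightarrow> (\<forall>(J :: ('k, 'k) cat) F.
     category J \<and> small \<kappa> (Obj J) \<and> small \<kappa> (Arr J) \<and> cat_functor J C F \<longrightarrow>
     (\<exists>x \<iota>. is_colimit J C F x \<iota>))"

definition is_coproduct :: "('o, 'm, 'z) cat_scheme \<Rightarrow> 'i set \<Rightarrow> ('i \<Rightarrow> 'o) \<Rightarrow> 'o \<Rightarrow>
    ('i \<Rightarrow> 'm) \<Rightarrow> bool" where
  "is_coproduct C I F x \<iota> \<longleftrightarrow> x \<in> Obj C \<and> (\<forall>i \<in> I. \<iota> i \<in> Hom C (F i) x) \<and>
    (\<forall>y \<in> Obj C. \<forall>\<tau>. (\<forall>i \<in> I. \<tau> i \<in> Hom C (F i) y) \<longrightarrow>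
       (\<exists>!h. h \<in> Hom C x y \<and> (\<forall>i \<in> I. h \<cdot>\<^bsub>C\<^esub> \<iota> i = \<tau> i)))"

section \<open>Abelian categories\<close>

record ('o, 'm) preadd_cat = "('o, 'm) cat" +
  Add :: "'m \<Rightarrow> 'm \<Rightarrow> 'm"
  Zero :: "'o \<Rightarrow> 'o \<Rightarrow> 'm"

definition hom_group :: "('o, 'm, 'z) preadd_cat_scheme \<Rightarrow> 'o \<Rightarrow> 'o \<Rightarrow> 'm monoid" where
  "hom_group C a b = \<lparr>carrier = Hom C a b, mult = Add C, one = Zero C a b\<rparr>"

locale preadditive_category = category C
  for C :: "('o, 'm, 'z) preadd_cat_scheme" (structure) +
  assumes hom_comm_group: "a \<in> Obj C \<Longrightarrow> b \<in> Obj C \<Longrightarrow> comm_group (hom_group C a b)"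
    and Comp_Add: "f \<in> Hom C a b \<Longrightarrow> f' \<in> Hom C a b \<Longrightarrow> g \<in> Hom C b c \<Longrightarrow>
      g \<cdot> Add C f f' = Add C (g \<cdot> f) (g \<cdot> f')"
    and Add_Comp: "f \<in> Hom C a b \<Longrightarrow> g \<in> Hom C b c \<Longrightarrow> g' \<in> Hom C b c \<Longrightarrow>
      Add C g g' \<cdot> f = Add C (g \<cdot> f) (g' \<cdot> f)"

locale additive_category = preadditive_category +
  assumes ex_zero_object: "\<exists>z \<in> Obj C. \<forall>a \<in> Obj C.
      (\<exists>!f. f \<in> Hom C z a) \<and> (\<exists>!f. f \<in> Hom C a z)"
    and ex_biproduct: "a \<in> Obj C \<Longrightarrow> b \<in> Obj C \<Longrightarrow>
      \<exists>x \<in> Obj C. \<exists>i \<in> Hom C a x. \<exists>j \<in> Hom C b x. \<exists>p \<in> Hom C x a. \<exists>q \<in> Hom C x b.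
        p \<cdot> i = Ident C a \<and> q \<cdot> j = Ident C b \<and>
        q \<cdot> i = Zero C a b \<and> p \<cdot> j = Zero C b a \<and>
        Add C (i \<cdot> p) (j \<cdot> q) = Ident C x"

definition is_kernel :: "('o, 'm, 'z) preadd_cat_scheme \<Rightarrow> 'm \<Rightarrow> 'm \<Rightarrow> bool" where
  "is_kernel C f k \<longleftrightarrow> k \<in> Arr C \<and> Cod C k = Dom C f \<and>
    f \<cdot>\<^bsub>C\<^esub> k = Zero C (Dom C k) (Cod C f) \<and>
    (\<forall>g \<in> Arr C. Cod C g = Dom C f \<and> f \<cdot>\<^bsub>C\<^esub> g = Zero C (Dom C g) (Cod C f) \<longrightarrow>
       (\<exists>!h. h \<in> Hom C (Dom C g) (Dom C k) \<and> k \<cdot>\<^bsub>C\<^esub> h = g))"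

definition is_cokernel :: "('o, 'm, 'z) preadd_cat_scheme \<Rightarrow> 'm \<Rightarrow> 'm \<Rightarrow> bool" where
  "is_cokernel C f c \<longleftrightarrow> c \<in> Arr C \<and> Dom C c = Cod C f \<and>
    c \<cdot>\<^bsub>C\<^esub> f = Zero C (Dom C f) (Cod C c) \<and>
    (\<forall>g \<in> Arr C. Dom C g = Cod C f \<and> g \<cdot>\<^bsub>C\<^esub> f = Zero C (Dom C f) (Cod C g) \<longrightarrow>
       (\<exists>!h. h \<in> Hom C (Cod C c) (Cod C g) \<and> h \<cdot>\<^bsub>C\<^esub> c = g))"

text \<open>
  Chosen representatives, as arrows: \<open>Ker C f\<close> and \<open>Img C f\<close> are the inclusions of the kernel
  and the image, \<open>Coker C f\<close> is the projection onto the cokernel. The objects are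
  \<open>Dom C (Ker C f)\<close>, \<open>Dom C (Img C f)\<close> and \<open>Cod C (Coker C f)\<close>. In particular, the quotient by
  a subobject with inclusion \<open>s\<close> is \<open>Cod C (Coker C s)\<close>.
\<close>

definition Ker :: "('o, 'm, 'z) preadd_cat_scheme \<Rightarrow> 'm \<Rightarrow> 'm" where
  "Ker C f = (SOME k. is_kernel C f k)"

definition Coker :: "('o, 'm, 'z) preadd_cat_scheme \<Rightarrow> 'm \<Rightarrow> 'm" where
  "Coker C f = (SOME c. is_cokernel C f c)"

definition Img :: "('o, 'm, 'z) preadd_cat_scheme \<Rightarrow> 'm \<Rightarrow> 'm" where
  "Img C f = Ker C (Coker C f)"

definition Coimg :: "('o, 'm, 'z) preadd_cat_scheme \<Rightarrow> 'm \<Rightarrow> 'm" where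
  "Coimg C f = Coker C (Ker C f)"

locale abelian_category = additive_category +
  assumes ex_kernel: "f \<in> Arr C \<Longrightarrow> \<exists>k. is_kernel C f k"
    and ex_cokernel: "f \<in> Arr C \<Longrightarrow> \<exists>c. is_cokernel C f c"
    and coimage_iso_image: "f \<in> Arr C \<Longrightarrow>
      \<exists>h \<in> Hom C (Cod C (Coimg C f)) (Dom C (Img C f)).
        iso_arr C h \<and> Img C f \<cdot> (h \<cdot> Coimg C f) = f"

definition closed_under_cokernels :: "('o, 'm, 'z) preadd_cat_scheme \<Rightarrow> 'o set \<Rightarrow> bool" where
  "closed_under_cokernels C B \<longleftrightarrow>
    (\<forall>f \<in> Arr C. Dom C f \<in> B \<and> Cod C f \<in> B \<longrightarrow> (\<forall>c. is_cokernel C f c \<longrightarrow> Cod C c \<in> B))"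

section \<open>Objects presented by a set of objects, and the trace\<close>

definition Sum_of :: "'k rel \<Rightarrow> ('o, 'm, 'z) cat_scheme \<Rightarrow> 'o set \<Rightarrow> 'o set" where
  "Sum_of \<kappa> C U = {x. \<exists>(I :: 'k set) F \<iota>. small \<kappa> I \<and> F \<in> I \<rightarrow> U \<and> is_coproduct C I F x \<iota>}"

definition generated :: "'k rel \<Rightarrow> ('o, 'm, 'z) cat_scheme \<Rightarrow> 'o set \<Rightarrow> 'o \<Rightarrow> bool" where
  "generated \<kappa> C U x \<longleftrightarrow> (\<exists>e. epi_arr C e \<and> Dom C e \<in> Sum_of \<kappa> C U \<and> Cod C e = x)"

definition Pres :: "'k rel \<Rightarrow> ('o, 'm, 'z) preadd_cat_scheme \<Rightarrow> 'o set \<Rightarrow> 'o set" where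
  "Pres \<kappa> C U = {x. \<exists>f \<in> Arr C. Dom C f \<in> Sum_of \<kappa> C U \<and> Cod C f \<in> Sum_of \<kappa> C U \<and>
     (\<exists>c. is_cokernel C f c \<and> isomorphic C x (Cod C c))}"

definition is_trace :: "'k rel \<Rightarrow> ('o, 'm, 'z) cat_scheme \<Rightarrow> 'o set \<Rightarrow> 'o \<Rightarrow> 'm \<Rightarrow> bool" where
  "is_trace \<kappa> C U a t \<longleftrightarrow> mono_arr C t \<and> Cod C t = a \<and> generated \<kappa> C U (Dom C t) \<and>
    (\<forall>s. mono_arr C s \<and> Cod C s = a \<and> generated \<kappa> C U (Dom C s) \<longrightarrow>
       (\<exists>h \<in> Hom C (Dom C s) (Dom C t). t \<cdot>\<^bsub>C\<^esub> h = s))"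

text \<open>\<open>tr \<kappa> C U a\<close> is the inclusion of the trace into \<open>a\<close>.\<close>

definition tr :: "'k rel \<Rightarrow> ('o, 'm, 'z) cat_scheme \<Rightarrow> 'o set \<Rightarrow> 'o \<Rightarrow> 'm" where
  "tr \<kappa> C U a = (SOME t. is_trace \<kappa> C U a t)"

text \<open>The projection \<open>B \<rightarrow> B / tr (Ker f)\<close>, where \<open>B = Dom C f\<close>.\<close>

definition quot_tr_ker :: "'k rel \<Rightarrow> ('o, 'm, 'z) preadd_cat_scheme \<Rightarrow> 'o set \<Rightarrow> 'm \<Rightarrow> 'm" where
  "quot_tr_ker \<kappa> C U f = Coker C (Ker C f \<cdot>\<^bsub>C\<^esub> tr \<kappa> C U (Dom C (Ker C f)))"

text \<open>The induced morphism \<open>B / tr (Ker f) \<rightarrow> Im f\<close>.\<close>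

definition fbar :: "'k rel \<Rightarrow> ('o, 'm, 'z) preadd_cat_scheme \<Rightarrow> 'o set \<Rightarrow> 'm \<Rightarrow> 'm" where
  "fbar \<kappa> C U f = (THE h. h \<in> Hom C (Cod C (quot_tr_ker \<kappa> C U f)) (Dom C (Img C f)) \<and>
     Img C f \<cdot>\<^bsub>C\<^esub> (h \<cdot>\<^bsub>C\<^esub> quot_tr_ker \<kappa> C U f) = f)"

text \<open>
  The iterated coproduct of copowers \<open>\<Coprod>\<^bsub>u \<in> U\<^esub> u\<^bsup>(C(u,a))\<^esup>\<close> is one coproduct over the pairs
  \<open>(u, \<alpha>)\<close> with \<open>u \<in> U\<close> and \<open>\<alpha> : u \<rightarrow> a\<close>. Its object is \<open>Dom C (can_mor C U a)\<close>.
\<close>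

definition is_can_mor :: "('o, 'm, 'z) cat_scheme \<Rightarrow> 'o set \<Rightarrow> 'o \<Rightarrow> 'm \<Rightarrow> bool" where
  "is_can_mor C U a e \<longleftrightarrow> e \<in> Arr C \<and> Cod C e = a \<and>
    (\<exists>\<iota>. is_coproduct C (SIGMA u:U. Hom C u a) fst (Dom C e) \<iota> \<and>
         (\<forall>u \<in> U. \<forall>\<alpha> \<in> Hom C u a. e \<cdot>\<^bsub>C\<^esub> \<iota> (u, \<alpha>) = \<alpha>))"

definition can_mor :: "('o, 'm, 'z) cat_scheme \<Rightarrow> 'o set \<Rightarrow> 'o \<Rightarrow> 'm" where
  "can_mor C U a = (SOME e. is_can_mor C U a e)"

end

theory Submission
  imports Defs
begin

text \<open>
  Write \<open>Q\<^sub>f = B / tr (Ker f)\<close> for \<open>f : B \<rightarrow> B'\<close>, and \<open>f' : Q\<^sub>f \<rightarrow> B'\<close> for the map induced by \<open>f\<close>. The map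
  \<open>\<A>(U, Q\<^sub>f) \<rightarrow> \<A>(U, Im f)\<close> is bijective iff \<open>\<A>(U, -)\<close> sees \<open>f'\<close> as a kernel of \<open>Coker f\<close>, and by left
  exactness this passes from all \<open>U \<in> \<U>\<close> to all objects of \<open>Pres(\<U>)\<close>; hence (2) iff (3).

  (2) implies (4a): let \<open>p : Q \<rightarrow> A\<close> be induced by \<open>\<epsilon>\<^sub>A\<close>, let \<open>\<alpha> : U \<rightarrow> Q\<close> satisfy \<open>p \<alpha> = 0\<close>, and let
  \<open>c = Coker \<alpha>\<close>. Then \<open>p\<close> factors through \<open>c\<close>, so the composite \<open>dom \<epsilon>\<^sub>A \<rightarrow> Q \<rightarrow> Cod c\<close> has the same trace
  quotient \<open>Q\<close> as \<open>\<epsilon>\<^sub>A\<close>; by (2) \<open>\<A>(U, c)\<close> is injective, and \<open>c \<alpha> = 0\<close> gives \<open>\<alpha> = 0\<close>.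

  (4) implies (1) and (2): (4a) says that \<open>p\<close> is a coreflection, (4b) extends from sources \<open>S \<in> Sum(\<U>)\<close> to sources \<open>B\<close> along a
  presentation \<open>S \<rightarrow> B\<close>, and in \<open>Pres(\<U>)\<close> the map \<open>f = f' \<circ> (B \<rightarrow> Q\<^sub>f)\<close> is the factorization of \<open>f\<close>
  into a cokernel of its kernel and a kernel of its cokernel. Conversely, if \<open>Pres(\<U>)\<close> is abelian, this
  factorization must be the coimage factorization, which is (2).
\<close>

section \<open>Categories\<close>

text \<open>The image of \<open>f\<close>, formed in \<open>\<A>\<close>, need not lie in
  \<open>Pres(\<U>)\<close>, but \<open>B'\<close> does, and so does the cokernel of
  \<open>f\<close> once closure is known. Trading the map onto \<open>Im f\<close> for the map into
  \<open>B'\<close> together with \<open>Coker f\<close> thus gives a condition that makes sense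
  inside \<open>Pres(\<U>)\<close>. The trace appears because kernels in a coreflective subcategory
  are coreflections of kernels in \<open>\<A>\<close>, and the coreflection of \<open>Ker f\<close>
  has image \<open>tr (Ker f)\<close>; so \<open>Q\<^sub>f\<close> is what a coimage has to be
  there. It can be presented because the trace is covered by some \<open>S \<in> Sum(\<U>)\<close>,
  and dividing by the trace is dividing by the image of \<open>S\<close>. If the source of
  \<open>f\<close> is itself in \<open>Sum(\<U>)\<close>, this puts \<open>Q\<^sub>f\<close> into
  \<open>Pres(\<U>)\<close> before any closure property is known. This is how (4), which does not
  mention cokernels, recovers closure: (4a) yields coreflectivity, a cokernel of objects of
  \<open>Pres(\<U>)\<close> then splits off its coreflection, and a coreflection with a section is
  invertible.\<close>

context category
begin

lemma HomD:
  assumes "f \<in> Hom C a b"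
  shows "f \<in> Arr C" "Dom C f = a" "Cod C f = b" "a \<in> Obj C" "b \<in> Obj C"
  using assms Dom_Obj Cod_Obj by (auto simp: Hom_def)

lemma Arr_Hom: "f \<in> Arr C \<Longrightarrow> f \<in> Hom C (Dom C f) (Cod C f)"
  by (simp add: Hom_def)

lemma Comp_Ident_Hom: "f \<in> Hom C a b \<Longrightarrow> f \<cdot> Ident C a = f"
  using Comp_Ident by (auto simp: Hom_def)

lemma Ident_Comp_Hom: "f \<in> Hom C a b \<Longrightarrow> Ident C b \<cdot> f = f"
  using Ident_Comp by (auto simp: Hom_def)

lemma mono_arrD:
  assumes "mono_arr C m" "m \<in> Hom C a b" "f \<in> Hom C x a" "g \<in> Hom C x a" "m \<cdot> f = m \<cdot> g"
  shows "f = g"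
  using assms unfolding mono_arr_def by (metis HomD(2,4))

lemma epi_arrD:
  assumes "epi_arr C e" "e \<in> Hom C a b" "f \<in> Hom C b x" "g \<in> Hom C b x" "f \<cdot> e = g \<cdot> e"
  shows "f = g"
  using assms unfolding epi_arr_def by (metis HomD(3,5))

lemma iso_arrI:
  assumes "f \<in> Hom C a b" "g \<in> Hom C b a" "g \<cdot> f = Ident C a" "f \<cdot> g = Ident C b"
  shows "iso_arr C f"
  using assms HomD[OF assms(1)] unfolding iso_arr_def by auto

lemma iso_arrE:
  assumes "iso_arr C f" "f \<in> Hom C a b"
  obtains g where "g \<in> Hom C b a" "g \<cdot> f = Ident C a" "f \<cdot> g = Ident C b" "iso_arr C g"
proof -
  obtain g where g: "g \<in> Hom C b a" "g \<cdot> f = Ident C a" "f \<cdot> g = Ident C b"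
    using assms HomD[OF assms(2)] unfolding iso_arr_def by auto
  then show ?thesis using that iso_arrI[OF g(1) assms(2)] by blast
qed

lemma cancel_left_inverse:
  assumes "f \<in> Hom C a b" "g \<in> Hom C b a" "g \<cdot> f = Ident C a" "h \<in> Hom C x a"
  shows "g \<cdot> (f \<cdot> h) = h"
  by (metis Comp_assoc[OF assms(4,1,2)] assms(3) Ident_Comp_Hom[OF assms(4)])

lemma cancel_right_inverse:
  assumes "f \<in> Hom C a b" "g \<in> Hom C b a" "g \<cdot> f = Ident C a" "h \<in> Hom C a x"
  shows "(h \<cdot> g) \<cdot> f = h"
  by (metis Comp_assoc[OF assms(1,2,4)] assms(3) Comp_Ident_Hom[OF assms(4)])

lemma iso_arr_Ident: "a \<in> Obj C \<Longrightarrow> iso_arr C (Ident C a)"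
  using iso_arrI[OF Ident_Hom Ident_Hom] Comp_Ident_Hom[OF Ident_Hom] by blast

lemma iso_arr_Comp:
  assumes "iso_arr C f" "f \<in> Hom C a b" "iso_arr C g" "g \<in> Hom C b c"
  shows "iso_arr C (g \<cdot> f)"
proof -
  obtain f' where f': "f' \<in> Hom C b a" "f' \<cdot> f = Ident C a" "f \<cdot> f' = Ident C b"
    using iso_arrE assms by metis
  obtain g' where g': "g' \<in> Hom C c b" "g' \<cdot> g = Ident C b" "g \<cdot> g' = Ident C c"
    using iso_arrE assms by metis
  show ?thesis
  proof (rule iso_arrI)
    show "g \<cdot> f \<in> Hom C a c" using assms Comp_Hom by blast
    show "f' \<cdot> g' \<in> Hom C c a" using f' g' Comp_Hom by blast
    show "(f' \<cdot> g') \<cdot> (g \<cdot> f) = Ident C a"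
      using Comp_assoc[OF Comp_Hom[OF assms(2,4)] g'(1) f'(1)]
        cancel_left_inverse[OF assms(4) g'(1,2) assms(2)] f'(2) by simp
    show "(g \<cdot> f) \<cdot> (f' \<cdot> g') = Ident C c"
      using Comp_assoc[OF Comp_Hom[OF g'(1) f'(1)] assms(2,4)]
        cancel_left_inverse[OF f'(1) assms(2) f'(3) g'(1)] g'(3) by simp
  qed
qed

lemma iso_arr_mono:
  assumes "iso_arr C f" shows "mono_arr C f"
proof -
  have f: "f \<in> Hom C (Dom C f) (Cod C f)" using assms Arr_Hom unfolding iso_arr_def by blast
  obtain g where g: "g \<in> Hom C (Cod C f) (Dom C f)" "g \<cdot> f = Ident C (Dom C f)"
    using iso_arrE[OF assms f] by metis
  show ?thesis
    unfolding mono_arr_def using HomD(1)[OF f] cancel_left_inverse[OF f g] by metis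
qed

lemma coproduct_hom_eq:
  assumes "is_coproduct C I F x \<iota>" "f \<in> Hom C x y" "g \<in> Hom C x y"
    and "\<And>i. i \<in> I \<Longrightarrow> f \<cdot> \<iota> i = g \<cdot> \<iota> i"
  shows "f = g"
proof -
  have \<iota>: "\<forall>i\<in>I. \<iota> i \<in> Hom C (F i) x"
    and *: "\<And>\<tau>. \<forall>i\<in>I. \<tau> i \<in> Hom C (F i) y \<Longrightarrow> \<exists>!h. h \<in> Hom C x y \<and> (\<forall>i\<in>I. h \<cdot> \<iota> i = \<tau> i)"
    using assms(1) HomD(5)[OF assms(2)] unfolding is_coproduct_def by simp_all
  have "\<forall>i\<in>I. f \<cdot> \<iota> i \<in> Hom C (F i) y" using \<iota> Comp_Hom[OF _ assms(2)] by simp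
  from *[OF this] show ?thesis using assms(2-4) by (metis (mono_tags, lifting))
qed

lemma coproduct_hom_ex:
  assumes "is_coproduct C I F x \<iota>" "y \<in> Obj C" "\<And>i. i \<in> I \<Longrightarrow> \<tau> i \<in> Hom C (F i) y"
  obtains h where "h \<in> Hom C x y" "\<And>i. i \<in> I \<Longrightarrow> h \<cdot> \<iota> i = \<tau> i"
  using assms unfolding is_coproduct_def by metis

lemma Hom_full_sub:
  "Hom (full_sub C B) a b = (if a \<in> B \<and> b \<in> B then Hom C a b else {})"
  by (auto simp: Hom_def full_sub_def)

lemma full_sub_simps [simp]:
  "Dom (full_sub C B) = Dom C" "Cod (full_sub C B) = Cod C" "Ident (full_sub C B) = Ident C"
  "Comp (full_sub C B) = Comp C" "Obj (full_sub C B) = Obj C \<inter> B"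
  "f \<in> Arr (full_sub C B) \<longleftrightarrow> f \<in> Arr C \<and> Dom C f \<in> B \<and> Cod C f \<in> B"
  by (auto simp: full_sub_def)

lemma category_full_sub: "category (full_sub C B)"
proof
  fix f g a b c
  assume "f \<in> Hom (full_sub C B) a b" "g \<in> Hom (full_sub C B) b c"
  then have "f \<in> Hom C a b" "g \<in> Hom C b c" "a \<in> B" "b \<in> B" "c \<in> B"
    by (auto simp: Hom_full_sub split: if_splits)
  then show "g \<cdot>\<^bsub>full_sub C B\<^esub> f \<in> Hom (full_sub C B) a c"
    using Comp_Hom by (simp add: Hom_full_sub)
next
  fix f g h a b c d
  assume "f \<in> Hom (full_sub C B) a b" "g \<in> Hom (full_sub C B) b c" "h \<in> Hom (full_sub C B) c d"
  then have "f \<in> Hom C a b" "g \<in> Hom C b c" "h \<in> Hom C c d"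
    by (auto simp: Hom_full_sub split: if_splits)
  then show "(h \<cdot>\<^bsub>full_sub C B\<^esub> g) \<cdot>\<^bsub>full_sub C B\<^esub> f = h \<cdot>\<^bsub>full_sub C B\<^esub> (g \<cdot>\<^bsub>full_sub C B\<^esub> f)"
    using Comp_assoc by simp
qed (auto simp: Hom_full_sub Dom_Obj Cod_Obj Ident_Hom Comp_Ident Ident_Comp)

end

section \<open>Coreflections\<close>

text \<open>The family \<open>p\<close> of coreflections is a parameter, so that inserting the
  explicit coreflections of the theorem yields a right adjoint with the stated values on objects by
  construction.\<close>

definition coreflection_functor :: "('o, 'm, 'z) cat_scheme \<Rightarrow> ('o \<Rightarrow> 'm) \<Rightarrow> ('o, 'm, 'o, 'm) functr" where
  "coreflection_functor C p =
    \<lparr>FObj = (\<lambda>a. Dom C (p a)),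
     FArr = (\<lambda>f. THE g. g \<in> Hom C (Dom C (p (Dom C f))) (Dom C (p (Cod C f))) \<and>
                p (Cod C f) \<cdot>\<^bsub>C\<^esub> g = f \<cdot>\<^bsub>C\<^esub> p (Dom C f))\<rparr>"

context category
begin

lemma coreflectionD:
  assumes "is_coreflection C B a p"
  shows "p \<in> Hom C (Dom C p) a" "Dom C p \<in> B"
    "b \<in> B \<Longrightarrow> f \<in> Hom C b a \<Longrightarrow> \<exists>g \<in> Hom C b (Dom C p). p \<cdot> g = f"
    "b \<in> B \<Longrightarrow> f \<in> Hom C b (Dom C p) \<Longrightarrow> g \<in> Hom C b (Dom C p) \<Longrightarrow> p \<cdot> f = p \<cdot> g \<Longrightarrow> f = g"
proof -
  show "p \<in> Hom C (Dom C p) a" "Dom C p \<in> B" using assms by (auto simp: is_coreflection_def Hom_def)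
  {
    assume "b \<in> B"
    then have "bij_betw (\<lambda>g. p \<cdot> g) (Hom C b (Dom C p)) (Hom C b a)"
      using assms unfolding is_coreflection_def by blast
    then have "inj_on (\<lambda>g. p \<cdot> g) (Hom C b (Dom C p))" "Hom C b a = (\<lambda>g. p \<cdot> g) ` Hom C b (Dom C p)"
      by (auto simp: bij_betw_def)
    then show "f \<in> Hom C b a \<Longrightarrow> \<exists>g \<in> Hom C b (Dom C p). p \<cdot> g = f"
      "f \<in> Hom C b (Dom C p) \<Longrightarrow> g \<in> Hom C b (Dom C p) \<Longrightarrow> p \<cdot> f = p \<cdot> g \<Longrightarrow> f = g"
      by (auto dest: inj_onD)
  }
qed

lemma coreflection_ex1:
  assumes "is_coreflection C B a p" "b \<in> B" "f \<in> Hom C b a"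
  shows "\<exists>!g. g \<in> Hom C b (Dom C p) \<and> p \<cdot> g = f"
  using coreflectionD(3)[OF assms] coreflectionD(4)[OF assms(1,2)] by metis

text \<open>Both \<open>s \<cdot> p\<close> and the identity are endomorphisms of an object of
  \<open>B\<close> with the same composite with \<open>p\<close>, so uniqueness of lifts identifies
  them.\<close>

lemma coreflection_section_iso:
  assumes p: "is_coreflection C B a p" and s: "s \<in> Hom C a (Dom C p)" "p \<cdot> s = Ident C a"
  shows "iso_arr C p"
proof (rule iso_arrI[OF coreflectionD(1)[OF p] s(1) _ s(2)])
  note ph = coreflectionD(1)[OF p]
  have "p \<cdot> (s \<cdot> p) = p \<cdot> Ident C (Dom C p)"
    using cancel_left_inverse[OF s(1) ph s(2) ph] Comp_Ident_Hom[OF ph] by simp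
  then show "s \<cdot> p = Ident C (Dom C p)"
    using coreflectionD(4)[OF p coreflectionD(2)[OF p] Comp_Hom[OF ph s(1)] Ident_Hom] HomD[OF ph]
    by blast
qed

context
  fixes B :: "'o set" and p :: "'o \<Rightarrow> 'm"
  assumes p: "\<And>a. a \<in> Obj C \<Longrightarrow> is_coreflection C B a (p a)"
begin

lemma coreflection_functor_arr:
  assumes "f \<in> Hom C a a'"
  shows "FArr (coreflection_functor C p) f \<in> Hom C (Dom C (p a)) (Dom C (p a'))"
    "p a' \<cdot> FArr (coreflection_functor C p) f = f \<cdot> p a"
proof -
  have o: "a \<in> Obj C" "a' \<in> Obj C" "Dom C f = a" "Cod C f = a'" using HomD[OF assms] by auto
  have "f \<cdot> p a \<in> Hom C (Dom C (p a)) a'"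
    using Comp_Hom[OF coreflectionD(1)[OF p[OF o(1)]] assms] .
  from theI'[OF coreflection_ex1[OF p[OF o(2)] coreflectionD(2)[OF p[OF o(1)]] this]]
  show "FArr (coreflection_functor C p) f \<in> Hom C (Dom C (p a)) (Dom C (p a'))"
    "p a' \<cdot> FArr (coreflection_functor C p) f = f \<cdot> p a"
    by (auto simp: coreflection_functor_def o)
qed

lemma coreflection_functor_unique:
  assumes "f \<in> Hom C a a'" "g \<in> Hom C (Dom C (p a)) (Dom C (p a'))" "p a' \<cdot> g = f \<cdot> p a"
  shows "FArr (coreflection_functor C p) f = g"
  using coreflectionD(4)[OF p coreflectionD(2)[OF p] coreflection_functor_arr(1)[OF assms(1)] assms(2)]
    coreflection_functor_arr(2)[OF assms(1)] assms(3) HomD[OF assms(1)] by simp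

lemma coreflection_functor: "cat_functor C (full_sub C B) (coreflection_functor C p)"
  unfolding cat_functor_def
proof (intro conjI ballI impI)
  fix a assume a: "a \<in> Obj C"
  note pa = coreflectionD(1,2)[OF p[OF a]]
  show "FObj (coreflection_functor C p) a \<in> Obj (full_sub C B)"
    using pa HomD(4)[OF pa(1)] by (simp add: coreflection_functor_def)
  show "FArr (coreflection_functor C p) (Ident C a) = Ident (full_sub C B) (FObj (coreflection_functor C p) a)"
    using coreflection_functor_unique[OF Ident_Hom[OF a] Ident_Hom[OF HomD(4)[OF pa(1)]]]
      Comp_Ident_Hom[OF pa(1)] Ident_Comp_Hom[OF pa(1)]
    by (simp add: coreflection_functor_def)
next
  fix f assume "f \<in> Arr C"
  then have f: "f \<in> Hom C (Dom C f) (Cod C f)" by (rule Arr_Hom)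
  show "FArr (coreflection_functor C p) f \<in> Hom (full_sub C B)
      (FObj (coreflection_functor C p) (Dom C f)) (FObj (coreflection_functor C p) (Cod C f))"
    using coreflection_functor_arr(1)[OF f] coreflectionD(2)[OF p] HomD[OF f]
    by (simp add: Hom_full_sub coreflection_functor_def)
next
  fix f g assume fg: "f \<in> Arr C" "g \<in> Arr C" "Cod C f = Dom C g"
  then have f: "f \<in> Hom C (Dom C f) (Dom C g)" and g: "g \<in> Hom C (Dom C g) (Cod C g)"
    by (auto simp: Hom_def)
  let ?F = "FArr (coreflection_functor C p)"
  note Ff = coreflection_functor_arr[OF f] and Fg = coreflection_functor_arr[OF g]
  note pa = coreflectionD(1)[OF p]
  have "p (Cod C g) \<cdot> (?F g \<cdot> ?F f) = (g \<cdot> p (Dom C g)) \<cdot> ?F f"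
    using Comp_assoc[OF Ff(1) Fg(1) pa] Fg(2) HomD[OF g] by simp
  also have "\<dots> = g \<cdot> (f \<cdot> p (Dom C f))"
    using Comp_assoc[OF Ff(1) pa g] Ff(2) HomD[OF g] by simp
  also have "\<dots> = (g \<cdot> f) \<cdot> p (Dom C f)"
    using Comp_assoc[OF pa f g] HomD[OF f] by simp
  finally have "?F (g \<cdot> f) = ?F g \<cdot> ?F f"
    by (rule coreflection_functor_unique[OF Comp_Hom[OF f g] Comp_Hom[OF Ff(1) Fg(1)]])
  then show "?F (g \<cdot> f) = ?F g \<cdot>\<^bsub>full_sub C B\<^esub> ?F f" by simp
qed

lemma inclusion_functor: "cat_functor (full_sub C B) C inclusion"
  using Arr_Hom by (auto simp: cat_functor_def inclusion_def)

lemma coreflection_functor_right_adjoint: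
  "right_adjoint (full_sub C B) C inclusion (coreflection_functor C p)"
proof -
  \<comment> \<open>The adjunction bijection is lifting through \<open>p a\<close>, the inverse of
    composition with \<open>p a\<close>; naturality reduces to uniqueness of lifts.\<close>
  define \<phi> where "\<phi> b a h = (THE g. g \<in> Hom C b (Dom C (p a)) \<and> p a \<cdot> g = h)" for b a h
  have \<phi>: "\<phi> b a h \<in> Hom C b (Dom C (p a))" "p a \<cdot> \<phi> b a h = h"
    if "b \<in> B" "h \<in> Hom C b a" for b a h
    using theI'[OF coreflection_ex1[OF p[OF HomD(5)[OF that(2)]] that]] unfolding \<phi>_def by auto
  have uniq: "\<phi> b a h = g"
    if "b \<in> B" "h \<in> Hom C b a" "g \<in> Hom C b (Dom C (p a))" "p a \<cdot> g = h" for b a h g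
    using coreflectionD(4)[OF p[OF HomD(5)[OF that(2)]] that(1) \<phi>(1)[OF that(1,2)] that(3)]
      \<phi>(2)[OF that(1,2)] that(4) by simp
  have "bij_betw (\<phi> b a) (Hom C b a) (Hom C b (Dom C (p a)))" if "b \<in> B" "a \<in> Obj C" for b a
  proof (rule bij_betwI[where g = "\<lambda>g. p a \<cdot> g"])
    have *: "p a \<cdot> g \<in> Hom C b a" if "g \<in> Hom C b (Dom C (p a))" for g
      using Comp_Hom[OF that coreflectionD(1)[OF p[OF \<open>a \<in> Obj C\<close>]]] .
    then show "(\<lambda>g. p a \<cdot> g) \<in> Hom C b (Dom C (p a)) \<rightarrow> Hom C b a" by blast
    show "\<phi> b a (p a \<cdot> g) = g" if "g \<in> Hom C b (Dom C (p a))" for g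
      using uniq[OF \<open>b \<in> B\<close> *[OF that] that] by simp
  qed (use that \<phi> in auto)
  moreover have "\<phi> b' a' (f \<cdot> (h \<cdot> g)) = FArr (coreflection_functor C p) f \<cdot> (\<phi> b a h \<cdot> g)"
    if b: "b \<in> B" "b' \<in> B" and g: "g \<in> Hom C b' b" and h: "h \<in> Hom C b a" and f: "f \<in> Hom C a a'"
    for b b' a a' g h f
  proof (rule uniq[OF b(2) Comp_Hom[OF Comp_Hom[OF g h] f]])
    note F = coreflection_functor_arr[OF f]
    note pg = Comp_Hom[OF g \<phi>(1)[OF b(1) h]]
    have pa: "p a \<in> Hom C (Dom C (p a)) a" "p a' \<in> Hom C (Dom C (p a')) a'"
      using coreflectionD(1)[OF p] HomD[OF f] by auto
    show "FArr (coreflection_functor C p) f \<cdot> (\<phi> b a h \<cdot> g) \<in> Hom C b' (Dom C (p a'))"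
      using Comp_Hom[OF pg F(1)] .
    show "p a' \<cdot> (FArr (coreflection_functor C p) f \<cdot> (\<phi> b a h \<cdot> g)) = f \<cdot> (h \<cdot> g)"
      using Comp_assoc[OF pg F(1) pa(2)] F(2) Comp_assoc[OF pg pa(1) f]
        Comp_assoc[OF g \<phi>(1)[OF b(1) h] pa(1)] \<phi>(2)[OF b(1) h] by simp
  qed
  ultimately show ?thesis
    unfolding right_adjoint_def using inclusion_functor coreflection_functor
    by (intro conjI exI[of _ \<phi>])
      (auto simp: Hom_full_sub inclusion_def coreflection_functor_def dest: coreflectionD(2)[OF p] split: if_splits)
qed

end

text \<open>The counit \<open>e a\<close> is the preimage of the identity of \<open>FObj R a\<close>
  under the adjunction bijection, and naturality makes composition with \<open>e a\<close> inverse
  to that bijection. \<open>B \<subseteq> Obj C\<close> bridges two quantifiers: the adjunction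
  ranges over \<open>Obj C \<inter> B\<close>, coreflections over all of \<open>B\<close>.\<close>

lemma right_adjoint_counit:
  assumes R: "right_adjoint (full_sub C B) C inclusion R" and B: "B \<subseteq> Obj C"
  obtains e where "\<And>a. a \<in> Obj C \<Longrightarrow> is_coreflection C B a (e a)"
    "\<And>a. a \<in> Obj C \<Longrightarrow> Dom C (e a) = FObj R a"
    "\<And>f a a'. f \<in> Hom C a a' \<Longrightarrow> e a' \<cdot> FArr R f = f \<cdot> e a"
proof -
  obtain \<phi> where
    bij: "\<And>b a. b \<in> B \<Longrightarrow> a \<in> Obj C \<Longrightarrow>
        bij_betw (\<phi> b a) (Hom C b a) (Hom (full_sub C B) b (FObj R a))"
    and nat: "\<And>b b' a a' g h f. b \<in> B \<Longrightarrow> b' \<in> B \<Longrightarrow> g \<in> Hom C b' b \<Longrightarrow> h \<in> Hom C b a \<Longrightarrow> f \<in> Hom C a a' \<Longrightarrow>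
        \<phi> b' a' (f \<cdot> (h \<cdot> g)) = FArr R f \<cdot> (\<phi> b a h \<cdot> g)"
  proof -
    from R obtain \<phi> where
      "\<forall>b \<in> Obj C \<inter> B. \<forall>a \<in> Obj C. bij_betw (\<phi> b a) (Hom C b a) (Hom (full_sub C B) b (FObj R a))"
      "\<forall>b \<in> Obj C \<inter> B. \<forall>b' \<in> Obj C \<inter> B. \<forall>a \<in> Obj C. \<forall>a' \<in> Obj C. \<forall>g \<in> Hom (full_sub C B) b' b.
        \<forall>h \<in> Hom C b a. \<forall>f \<in> Hom C a a'. \<phi> b' a' (f \<cdot> (h \<cdot> g)) = FArr R f \<cdot> (\<phi> b a h \<cdot> g)"
      unfolding right_adjoint_def inclusion_def by auto
    note * = this
    show ?thesis
    proof (rule that[of \<phi>])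
      fix b a assume "b \<in> B" "a \<in> Obj C"
      with *(1) B show "bij_betw (\<phi> b a) (Hom C b a) (Hom (full_sub C B) b (FObj R a))" by blast
    next
      fix b b' a a' g h f
      assume asm: "b \<in> B" "b' \<in> B" "g \<in> Hom C b' b" "h \<in> Hom C b a" "f \<in> Hom C a a'"
      then have "b \<in> Obj C \<inter> B" "b' \<in> Obj C \<inter> B" "a \<in> Obj C" "a' \<in> Obj C" "g \<in> Hom (full_sub C B) b' b"
        using B HomD(4,5)[OF asm(5)] by (auto simp: Hom_full_sub)
      with *(2) asm show "\<phi> b' a' (f \<cdot> (h \<cdot> g)) = FArr R f \<cdot> (\<phi> b a h \<cdot> g)" by blast
    qed
  qed
  have RB: "FObj R a \<in> B" "FObj R a \<in> Obj C" if "a \<in> Obj C" for a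
    using R that unfolding right_adjoint_def cat_functor_def by auto
  have RF: "FArr R f \<in> Hom C (FObj R a) (FObj R a')" if "f \<in> Hom C a a'" for f a a'
    using R HomD[OF that] RB unfolding right_adjoint_def cat_functor_def by (auto simp: Hom_full_sub)
  have Rid: "FArr R (Ident C a) = Ident C (FObj R a)" if "a \<in> Obj C" for a
    using R that unfolding right_adjoint_def cat_functor_def by auto
  have bij': "bij_betw (\<phi> b a) (Hom C b a) (Hom C b (FObj R a))" if "b \<in> B" "a \<in> Obj C" for b a
    using bij[OF that] RB that by (simp add: Hom_full_sub)
  define e where "e a = inv_into (Hom C (FObj R a) a) (\<phi> (FObj R a) a) (Ident C (FObj R a))" for a
  have e: "e a \<in> Hom C (FObj R a) a" "\<phi> (FObj R a) a (e a) = Ident C (FObj R a)" if "a \<in> Obj C" for a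
    using bij'[OF RB(1)[OF that] that] Ident_Hom[OF RB(2)[OF that]] unfolding e_def
    by (auto simp: bij_betw_def intro: inv_into_into f_inv_into_f)
  have counit: "\<phi> b a (e a \<cdot> g) = g" if "b \<in> B" "a \<in> Obj C" "g \<in> Hom C b (FObj R a)" for b a g
  proof -
    have "\<phi> b a (Ident C a \<cdot> (e a \<cdot> g)) = Ident C (FObj R a) \<cdot> (Ident C (FObj R a) \<cdot> g)"
      using nat[OF RB(1)[OF that(2)] that(1,3) e(1)[OF that(2)] Ident_Hom[OF that(2)]] e(2)[OF that(2)]
        Rid[OF that(2)] by simp
    then show ?thesis
      using Ident_Comp_Hom[OF that(3)] Ident_Comp_Hom[OF Comp_Hom[OF that(3) e(1)[OF that(2)]]] by simp
  qed
  have inj: "f = g" if "b \<in> B" "a \<in> Obj C" "f \<in> Hom C b a" "g \<in> Hom C b a" "\<phi> b a f = \<phi> b a g" for b a f g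
    using bij'[OF that(1,2)] that(3-5) by (auto simp: bij_betw_def inj_on_def)
  show ?thesis
  proof (rule that[of e])
    fix a assume a: "a \<in> Obj C"
    show d: "Dom C (e a) = FObj R a" using HomD[OF e(1)[OF a]] by simp
    have "bij_betw (\<lambda>g. e a \<cdot> g) (Hom C b (FObj R a)) (Hom C b a)" if b: "b \<in> B" for b
    proof (rule bij_betwI[where g = "\<phi> b a"])
      have *: "e a \<cdot> g \<in> Hom C b a" if "g \<in> Hom C b (FObj R a)" for g
        using Comp_Hom[OF that e(1)[OF a]] .
      then show "(\<lambda>g. e a \<cdot> g) \<in> Hom C b (FObj R a) \<rightarrow> Hom C b a" by blast
      show mem: "\<phi> b a \<in> Hom C b a \<rightarrow> Hom C b (FObj R a)"
        using bij'[OF b a] by (auto simp: bij_betw_def)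
      show "\<phi> b a (e a \<cdot> g) = g" if "g \<in> Hom C b (FObj R a)" for g using counit[OF b a that] .
      show "e a \<cdot> \<phi> b a f = f" if f: "f \<in> Hom C b a" for f
        using inj[OF b a *[OF funcset_mem[OF mem f]] f] counit[OF b a funcset_mem[OF mem f]] by simp
    qed
    then show "is_coreflection C B a (e a)"
      using d HomD[OF e(1)[OF a]] RB[OF a] unfolding is_coreflection_def by simp
  next
    fix f a a' assume f: "f \<in> Hom C a a'"
    have a: "a \<in> Obj C" "a' \<in> Obj C" using HomD[OF f] by auto
    note RfH = RF[OF f] and ea = e[OF a(1)]
    have "\<phi> (FObj R a) a' (f \<cdot> (e a \<cdot> Ident C (FObj R a))) = FArr R f \<cdot> (Ident C (FObj R a) \<cdot> Ident C (FObj R a))"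
      using nat[OF RB(1)[OF a(1)] RB(1)[OF a(1)] Ident_Hom[OF RB(2)[OF a(1)]] ea(1) f] ea(2) by simp
    then have "\<phi> (FObj R a) a' (f \<cdot> e a) = FArr R f"
      using Comp_Ident_Hom[OF ea(1)] Comp_Ident_Hom[OF RfH] Comp_Ident_Hom[OF Ident_Hom[OF RB(2)[OF a(1)]]]
      by simp
    with counit[OF RB(1)[OF a(1)] a(2) RfH] show "e a' \<cdot> FArr R f = f \<cdot> e a"
      using inj[OF RB(1)[OF a(1)] a(2) Comp_Hom[OF RfH e(1)[OF a(2)]] Comp_Hom[OF ea(1) f]] by simp
  qed
qed

text \<open>Allows coreflectivity to be used one object at a time, without mentioning
  functors.\<close>

lemma coreflective_iff:
  assumes "B \<subseteq> Obj C"
  shows "coreflective C B \<longleftrightarrow> (\<forall>a \<in> Obj C. \<exists>p. is_coreflection C B a p)"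
proof
  assume "coreflective C B"
  then show "\<forall>a \<in> Obj C. \<exists>p. is_coreflection C B a p"
    unfolding coreflective_def using right_adjoint_counit[OF _ assms] by metis
next
  assume "\<forall>a \<in> Obj C. \<exists>p. is_coreflection C B a p"
  then obtain p where "\<And>a. a \<in> Obj C \<Longrightarrow> is_coreflection C B a (p a)" by metis
  then show "coreflective C B"
    using coreflection_functor_right_adjoint unfolding coreflective_def by blast
qed

text \<open>The counit of \<open>R\<close> and the given \<open>p a\<close> are two coreflections of
  the same object. Lifting each through the other gives mutually inverse maps, and uniqueness of
  lifts makes them natural.\<close>

lemma right_adjoint_naturally_isomorphic:
  assumes R: "right_adjoint (full_sub C B) C inclusion R" and B: "B \<subseteq> Obj C"
    and p: "\<And>a. a \<in> Obj C \<Longrightarrow> is_coreflection C B a (p a)"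
  shows "naturally_isomorphic C (full_sub C B) R (coreflection_functor C p)"
proof -
  obtain e where e: "\<And>a. a \<in> Obj C \<Longrightarrow> is_coreflection C B a (e a)"
    and dom_e: "\<And>a. a \<in> Obj C \<Longrightarrow> Dom C (e a) = FObj R a"
    and nat: "\<And>f a a'. f \<in> Hom C a a' \<Longrightarrow> e a' \<cdot> FArr R f = f \<cdot> e a"
    using right_adjoint_counit[OF R B] by metis
  note eH = coreflectionD(1,2)[OF e] and pH = coreflectionD(1,2)[OF p]
  have "\<exists>h \<in> Hom C (Dom C (e a)) (Dom C (p a)). p a \<cdot> h = e a" if "a \<in> Obj C" for a
    using coreflectionD(3)[OF p eH(2) eH(1)] that by blast
  then obtain \<eta> where \<eta>: "\<And>a. a \<in> Obj C \<Longrightarrow> \<eta> a \<in> Hom C (Dom C (e a)) (Dom C (p a))"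
    and p_\<eta>: "\<And>a. a \<in> Obj C \<Longrightarrow> p a \<cdot> \<eta> a = e a" by metis
  interpret S: category "full_sub C B" by (rule category_full_sub)
  have iso: "iso_arr (full_sub C B) (\<eta> a)" if a: "a \<in> Obj C" for a
  proof -
    obtain h where h: "h \<in> Hom C (Dom C (p a)) (Dom C (e a))" "e a \<cdot> h = p a"
      using coreflectionD(3)[OF e[OF a] pH(2)[OF a] pH(1)[OF a]] by blast
    note ma = \<eta>[OF a]
    note o = HomD(4,5)[OF ma]
    have "e a \<cdot> (h \<cdot> \<eta> a) = e a \<cdot> Ident C (Dom C (e a))"
      using Comp_assoc[OF ma h(1) eH(1)[OF a]] h(2) p_\<eta>[OF a] Comp_Ident_Hom[OF eH(1)[OF a]] by simp
    then have 1: "h \<cdot> \<eta> a = Ident C (Dom C (e a))"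
      using coreflectionD(4)[OF e[OF a] eH(2)[OF a] Comp_Hom[OF ma h(1)] Ident_Hom[OF o(1)]] by blast
    have "p a \<cdot> (\<eta> a \<cdot> h) = p a \<cdot> Ident C (Dom C (p a))"
      using Comp_assoc[OF h(1) ma pH(1)[OF a]] h(2) p_\<eta>[OF a] Comp_Ident_Hom[OF pH(1)[OF a]] by simp
    then have 2: "\<eta> a \<cdot> h = Ident C (Dom C (p a))"
      using coreflectionD(4)[OF p[OF a] pH(2)[OF a] Comp_Hom[OF h(1) ma] Ident_Hom[OF o(2)]] by blast
    show ?thesis
      by (rule S.iso_arrI[where a = "Dom C (e a)" and b = "Dom C (p a)" and g = h])
        (use ma h 1 2 eH(2)[OF a] pH(2)[OF a] in \<open>auto simp: Hom_full_sub\<close>)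
  qed
  have "\<eta> a' \<cdot> FArr R f = FArr (coreflection_functor C p) f \<cdot> \<eta> a" if f: "f \<in> Hom C a a'" for f a a'
  proof -
    have a: "a \<in> Obj C" "a' \<in> Obj C" using HomD[OF f] by auto
    have RF: "FArr R f \<in> Hom C (Dom C (e a)) (Dom C (e a'))"
      using R HomD[OF f] dom_e unfolding right_adjoint_def cat_functor_def
      by (auto simp: Hom_full_sub split: if_splits)
    note F = coreflection_functor_arr[OF p f]
    have "p a' \<cdot> (\<eta> a' \<cdot> FArr R f) = f \<cdot> e a"
      using Comp_assoc[OF RF \<eta>[OF a(2)] pH(1)[OF a(2)]] p_\<eta>[OF a(2)] nat[OF f] by simp
    also have "\<dots> = p a' \<cdot> (FArr (coreflection_functor C p) f \<cdot> \<eta> a)"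
      using Comp_assoc[OF \<eta>[OF a(1)] F(1) pH(1)[OF a(2)]] F(2) Comp_assoc[OF \<eta>[OF a(1)] pH(1)[OF a(1)] f]
        p_\<eta>[OF a(1)] by simp
    finally show ?thesis
      using coreflectionD(4)[OF p[OF a(2)] eH(2)[OF a(1)] Comp_Hom[OF RF \<eta>[OF a(2)]] Comp_Hom[OF \<eta>[OF a(1)] F(1)]]
      by blast
  qed
  then have "\<forall>f \<in> Arr C. \<eta> (Cod C f) \<cdot> FArr R f = FArr (coreflection_functor C p) f \<cdot> \<eta> (Dom C f)"
    using Arr_Hom by blast
  moreover have "\<eta> a \<in> Hom (full_sub C B) (FObj R a) (FObj (coreflection_functor C p) a)" if "a \<in> Obj C" for a
    using \<eta>[OF that] dom_e[OF that] eH(2)[OF that] pH(2)[OF that]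
    by (simp add: Hom_full_sub coreflection_functor_def)
  ultimately show ?thesis
    unfolding naturally_isomorphic_def using iso by (intro exI[of _ \<eta>]) simp
qed

end

section \<open>Preadditive and abelian categories\<close>

context preadditive_category
begin

lemma Zero_Hom: "a \<in> Obj C \<Longrightarrow> b \<in> Obj C \<Longrightarrow> Zero C a b \<in> Hom C a b"
  using monoid.one_closed[OF group.is_monoid[OF comm_group.axioms(2)[OF hom_comm_group]]]
  by (simp add: hom_group_def)

lemma Add_Hom:
  assumes "f \<in> Hom C a b" "g \<in> Hom C a b"
  shows "Add C f g \<in> Hom C a b"
proof -
  interpret H: comm_group "hom_group C a b" using hom_comm_group HomD[OF assms(1)] by blast
  show ?thesis using H.m_closed assms by (simp add: hom_group_def)
qed

lemma Add_Zero_left: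
  assumes "f \<in> Hom C a b"
  shows "Add C (Zero C a b) f = f"
proof -
  interpret H: comm_group "hom_group C a b" using hom_comm_group HomD[OF assms(1)] by blast
  show ?thesis using H.l_one assms by (simp add: hom_group_def)
qed

lemma Add_eq_right:
  assumes "d \<in> Hom C a b" "g \<in> Hom C a b" "Add C d g = g"
  shows "d = Zero C a b"
proof -
  interpret H: comm_group "hom_group C a b" using hom_comm_group HomD[OF assms(1)] by blast
  show ?thesis using H.r_cancel_one[of g d] assms by (simp add: hom_group_def)
qed

lemma ex_difference:
  assumes "f \<in> Hom C a b" "g \<in> Hom C a b"
  obtains d where "d \<in> Hom C a b" "Add C d g = f"
proof -
  interpret H: comm_group "hom_group C a b" using hom_comm_group HomD[OF assms(1)] by blast
  let ?d = "f \<otimes>\<^bsub>hom_group C a b\<^esub> inv\<^bsub>hom_group C a b\<^esub> g"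
  have fg: "f \<in> carrier (hom_group C a b)" "g \<in> carrier (hom_group C a b)"
    using assms by (auto simp: hom_group_def)
  then have "?d \<in> carrier (hom_group C a b)" by simp
  moreover have "?d \<otimes>\<^bsub>hom_group C a b\<^esub> g = f"
    using fg by (simp add: H.m_assoc)
  ultimately show ?thesis using that by (simp add: hom_group_def)
qed

lemma Comp_Zero:
  assumes g: "g \<in> Hom C b c" and a: "a \<in> Obj C"
  shows "g \<cdot> Zero C a b = Zero C a c"
proof -
  note z = Zero_Hom[OF a HomD(4)[OF g]]
  show ?thesis
    using Add_eq_right[OF Comp_Hom[OF z g] Comp_Hom[OF z g]] Comp_Add[OF z z g] Add_Zero_left[OF z] by simp
qed

lemma Zero_Comp:
  assumes f: "f \<in> Hom C a b" and c: "c \<in> Obj C"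
  shows "Zero C b c \<cdot> f = Zero C a c"
proof -
  note z = Zero_Hom[OF HomD(5)[OF f] c]
  show ?thesis
    using Add_eq_right[OF Comp_Hom[OF f z] Comp_Hom[OF f z]] Add_Comp[OF f z z] Add_Zero_left[OF z] by simp
qed

lemma Comp_eq_ZeroI:
  assumes "f \<in> Hom C a b" "g \<in> Hom C b c" "h \<in> Hom C c d" "g \<cdot> f = Zero C a c"
  shows "(h \<cdot> g) \<cdot> f = Zero C a d"
  using Comp_assoc[OF assms(1-3)] assms(4) Comp_Zero[OF assms(3)] HomD[OF assms(1)] by simp

text \<open>Additivity reduces cancellation to a test for zero. The source \<open>x\<close> stays
  fixed because later \<open>m\<close> can be cancelled only for certain sources.\<close>

lemma eq_by_Comp_left:
  assumes m: "m \<in> Hom C a b" and fg: "f \<in> Hom C x a" "g \<in> Hom C x a" "m \<cdot> f = m \<cdot> g"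
    and z: "\<And>d. d \<in> Hom C x a \<Longrightarrow> m \<cdot> d = Zero C x b \<Longrightarrow> d = Zero C x a"
  shows "f = g"
proof -
  obtain d where d: "d \<in> Hom C x a" "Add C d g = f" using ex_difference[OF fg(1,2)] .
  have "Add C (m \<cdot> d) (m \<cdot> g) = m \<cdot> g" using Comp_Add[OF d(1) fg(2) m] d(2) fg(3) by simp
  then have "m \<cdot> d = Zero C x b"
    using Add_eq_right[OF Comp_Hom[OF d(1) m] Comp_Hom[OF fg(2) m]] by simp
  then show ?thesis using z[OF d(1)] Add_Zero_left[OF fg(2)] d(2) by simp
qed

lemma eq_by_Comp_right:
  assumes e: "e \<in> Hom C a b" and fg: "f \<in> Hom C b x" "g \<in> Hom C b x" "f \<cdot> e = g \<cdot> e"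
    and z: "\<And>d. d \<in> Hom C b x \<Longrightarrow> d \<cdot> e = Zero C a x \<Longrightarrow> d = Zero C b x"
  shows "f = g"
proof -
  obtain d where d: "d \<in> Hom C b x" "Add C d g = f" using ex_difference[OF fg(1,2)] .
  have "Add C (d \<cdot> e) (g \<cdot> e) = g \<cdot> e" using Add_Comp[OF e d(1) fg(2)] d(2) fg(3) by simp
  then have "d \<cdot> e = Zero C a x"
    using Add_eq_right[OF Comp_Hom[OF e d(1)] Comp_Hom[OF e fg(2)]] by simp
  then show ?thesis using z[OF d(1)] Add_Zero_left[OF fg(2)] d(2) by simp
qed

lemma mono_arrI_Zero:
  assumes m: "m \<in> Hom C a b"
    and "\<And>x d. d \<in> Hom C x a \<Longrightarrow> m \<cdot> d = Zero C x b \<Longrightarrow> d = Zero C x a"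
  shows "mono_arr C m"
  unfolding mono_arr_def using eq_by_Comp_left[OF m _ _ _ assms(2)] HomD[OF m] by auto

lemma epi_arrI_Zero:
  assumes e: "e \<in> Hom C a b"
    and "\<And>x d. d \<in> Hom C b x \<Longrightarrow> d \<cdot> e = Zero C a x \<Longrightarrow> d = Zero C b x"
  shows "epi_arr C e"
  unfolding epi_arr_def using eq_by_Comp_right[OF e _ _ _ assms(2)] HomD[OF e] by auto

lemma mono_arr_ZeroD:
  assumes "mono_arr C m" "m \<in> Hom C a b" "d \<in> Hom C x a" "m \<cdot> d = Zero C x b"
  shows "d = Zero C x a"
  using mono_arrD[OF assms(1-3) Zero_Hom] assms(4) Comp_Zero[OF assms(2)] HomD[OF assms(2)] HomD[OF assms(3)]
  by simp

lemma epi_arr_ZeroD: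
  assumes "epi_arr C e" "e \<in> Hom C a b" "d \<in> Hom C b x" "d \<cdot> e = Zero C a x"
  shows "d = Zero C b x"
  using epi_arrD[OF assms(1-3) Zero_Hom] assms(4) Zero_Comp[OF assms(2)] HomD[OF assms(2)] HomD[OF assms(3)]
  by simp

section \<open>Kernels and cokernels, and the comparison of their representatives\<close>

lemma kernelI:
  assumes f: "f \<in> Hom C a b" and k: "k \<in> Hom C x a" "mono_arr C k" "f \<cdot> k = Zero C x b"
    and lift: "\<And>y g. g \<in> Hom C y a \<Longrightarrow> f \<cdot> g = Zero C y b \<Longrightarrow> \<exists>h \<in> Hom C y x. k \<cdot> h = g"
  shows "is_kernel C f k"
proof -
  have "\<exists>!h. h \<in> Hom C (Dom C g) x \<and> k \<cdot> h = g"
    if "g \<in> Arr C" "Cod C g = a" "f \<cdot> g = Zero C (Dom C g) b" for g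
  proof -
    have "g \<in> Hom C (Dom C g) a" using Arr_Hom[OF that(1)] that(2) by simp
    with lift[OF this that(3)] show ?thesis
      by (intro ex_ex1I) (auto intro: mono_arrD[OF k(2,1)])
  qed
  then show ?thesis
    unfolding is_kernel_def using HomD[OF f] HomD[OF k(1)] k(3) by auto
qed

lemma kernelD:
  assumes k: "is_kernel C f k" and f: "f \<in> Hom C a b"
  shows "k \<in> Hom C (Dom C k) a" "f \<cdot> k = Zero C (Dom C k) b" "mono_arr C k"
    "g \<in> Hom C y a \<Longrightarrow> f \<cdot> g = Zero C y b \<Longrightarrow> \<exists>h \<in> Hom C y (Dom C k). k \<cdot> h = g"
proof -
  note fD = HomD[OF f]
  show kH: "k \<in> Hom C (Dom C k) a" and fk: "f \<cdot> k = Zero C (Dom C k) b"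
    using k fD by (auto simp: is_kernel_def Hom_def)
  have lift: "\<exists>!h. h \<in> Hom C y (Dom C k) \<and> k \<cdot> h = g"
    if "g \<in> Hom C y a" "f \<cdot> g = Zero C y b" for g y
    using k[unfolded is_kernel_def, THEN conjunct2, THEN conjunct2, THEN conjunct2, THEN bspec[of _ _ g]]
      HomD[OF that(1)] fD that(2) by simp
  then show "g \<in> Hom C y a \<Longrightarrow> f \<cdot> g = Zero C y b \<Longrightarrow> \<exists>h \<in> Hom C y (Dom C k). k \<cdot> h = g"
    by blast
  show "mono_arr C k"
  proof (rule mono_arrI_Zero[OF kH])
    fix x d assume d: "d \<in> Hom C x (Dom C k)" "k \<cdot> d = Zero C x a"
    have z: "Zero C x (Dom C k) \<in> Hom C x (Dom C k)" "k \<cdot> Zero C x (Dom C k) = Zero C x a"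
      using Zero_Hom Comp_Zero[OF kH] HomD[OF d(1)] by auto
    have "Zero C x a \<in> Hom C x a" "f \<cdot> Zero C x a = Zero C x b"
      using Zero_Hom Comp_Zero[OF f] HomD[OF d(1)] fD by auto
    from lift[OF this] d z show "d = Zero C x (Dom C k)" by blast
  qed
qed

lemma cokernelI:
  assumes f: "f \<in> Hom C a b" and c: "c \<in> Hom C b x" "epi_arr C c" "c \<cdot> f = Zero C a x"
    and ext: "\<And>y g. g \<in> Hom C b y \<Longrightarrow> g \<cdot> f = Zero C a y \<Longrightarrow> \<exists>h \<in> Hom C x y. h \<cdot> c = g"
  shows "is_cokernel C f c"
proof -
  have "\<exists>!h. h \<in> Hom C x (Cod C g) \<and> h \<cdot> c = g"
    if "g \<in> Arr C" "Dom C g = b" "g \<cdot> f = Zero C a (Cod C g)" for g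
  proof -
    have "g \<in> Hom C b (Cod C g)" using Arr_Hom[OF that(1)] that(2) by simp
    with ext[OF this that(3)] show ?thesis
      by (intro ex_ex1I) (auto intro: epi_arrD[OF c(2,1)])
  qed
  then show ?thesis
    unfolding is_cokernel_def using HomD[OF f] HomD[OF c(1)] c(3) by auto
qed

lemma cokernelD:
  assumes c: "is_cokernel C f c" and f: "f \<in> Hom C a b"
  shows "c \<in> Hom C b (Cod C c)" "c \<cdot> f = Zero C a (Cod C c)" "epi_arr C c"
    "g \<in> Hom C b y \<Longrightarrow> g \<cdot> f = Zero C a y \<Longrightarrow> \<exists>h \<in> Hom C (Cod C c) y. h \<cdot> c = g"
proof -
  note fD = HomD[OF f]
  show cH: "c \<in> Hom C b (Cod C c)" and cf: "c \<cdot> f = Zero C a (Cod C c)"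
    using c fD by (auto simp: is_cokernel_def Hom_def)
  have ext: "\<exists>!h. h \<in> Hom C (Cod C c) y \<and> h \<cdot> c = g"
    if "g \<in> Hom C b y" "g \<cdot> f = Zero C a y" for g y
    using c[unfolded is_cokernel_def, THEN conjunct2, THEN conjunct2, THEN conjunct2, THEN bspec[of _ _ g]]
      HomD[OF that(1)] fD that(2) by simp
  then show "g \<in> Hom C b y \<Longrightarrow> g \<cdot> f = Zero C a y \<Longrightarrow> \<exists>h \<in> Hom C (Cod C c) y. h \<cdot> c = g"
    by blast
  show "epi_arr C c"
  proof (rule epi_arrI_Zero[OF cH])
    fix x d assume d: "d \<in> Hom C (Cod C c) x" "d \<cdot> c = Zero C b x"
    have z: "Zero C (Cod C c) x \<in> Hom C (Cod C c) x" "Zero C (Cod C c) x \<cdot> c = Zero C b x"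
      using Zero_Hom Zero_Comp[OF cH] HomD[OF d(1)] by auto
    have "Zero C b x \<in> Hom C b x" "Zero C b x \<cdot> f = Zero C a x"
      using Zero_Hom Zero_Comp[OF f] HomD[OF d(1)] fD by auto
    from ext[OF this] d z show "d = Zero C (Cod C c) x" by blast
  qed
qed

lemma kernel_unique:
  assumes f: "f \<in> Hom C a b" and k: "is_kernel C f k" and l: "is_kernel C f l"
  obtains h where "h \<in> Hom C (Dom C l) (Dom C k)" "iso_arr C h" "k \<cdot> h = l"
proof -
  note kD = kernelD[OF k f] and lD = kernelD[OF l f]
  obtain h where h: "h \<in> Hom C (Dom C l) (Dom C k)" "k \<cdot> h = l" using kD(4)[OF lD(1,2)] by blast
  obtain g where g: "g \<in> Hom C (Dom C k) (Dom C l)" "l \<cdot> g = k" using lD(4)[OF kD(1,2)] by blast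
  have "k \<cdot> (h \<cdot> g) = k \<cdot> Ident C (Dom C k)"
    using Comp_assoc[OF g(1) h(1) kD(1)] h g Comp_Ident_Hom[OF kD(1)] by simp
  then have "h \<cdot> g = Ident C (Dom C k)"
    using mono_arrD[OF kD(3,1) Comp_Hom[OF g(1) h(1)] Ident_Hom] HomD[OF h(1)] by blast
  moreover have "l \<cdot> (g \<cdot> h) = l \<cdot> Ident C (Dom C l)"
    using Comp_assoc[OF h(1) g(1) lD(1)] h g Comp_Ident_Hom[OF lD(1)] by simp
  then have "g \<cdot> h = Ident C (Dom C l)"
    using mono_arrD[OF lD(3,1) Comp_Hom[OF h(1) g(1)] Ident_Hom] HomD[OF h(1)] by blast
  ultimately show ?thesis using that h iso_arrI[OF h(1) g(1)] by blast
qed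

lemma cokernel_unique:
  assumes f: "f \<in> Hom C a b" and c: "is_cokernel C f c" and d: "is_cokernel C f d"
  obtains h where "h \<in> Hom C (Cod C c) (Cod C d)" "iso_arr C h" "h \<cdot> c = d"
proof -
  note cD = cokernelD[OF c f] and dD = cokernelD[OF d f]
  obtain h where h: "h \<in> Hom C (Cod C c) (Cod C d)" "h \<cdot> c = d" using cD(4)[OF dD(1,2)] by blast
  obtain g where g: "g \<in> Hom C (Cod C d) (Cod C c)" "g \<cdot> d = c" using dD(4)[OF cD(1,2)] by blast
  have "(g \<cdot> h) \<cdot> c = Ident C (Cod C c) \<cdot> c"
    using Comp_assoc[OF cD(1) h(1) g(1)] h g Ident_Comp_Hom[OF cD(1)] by simp
  then have "g \<cdot> h = Ident C (Cod C c)"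
    using epi_arrD[OF cD(3,1) Comp_Hom[OF h(1) g(1)] Ident_Hom] HomD[OF h(1)] by blast
  moreover have "(h \<cdot> g) \<cdot> d = Ident C (Cod C d) \<cdot> d"
    using Comp_assoc[OF dD(1) g(1) h(1)] h g Ident_Comp_Hom[OF dD(1)] by simp
  then have "h \<cdot> g = Ident C (Cod C d)"
    using epi_arrD[OF dD(3,1) Comp_Hom[OF g(1) h(1)] Ident_Hom] HomD[OF h(1)] by blast
  ultimately show ?thesis using that h iso_arrI[OF h(1) g(1)] by blast
qed

text \<open>Whatever kills \<open>g\<close> kills \<open>f = g \<cdot> h\<close>, hence extends
  along the cokernel of \<open>f\<close>. In this way the cokernel of a map out of
  \<open>Sum(\<U>)\<close> is recognized as the cokernel of a kernel through which that map
  factors.\<close>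

lemma cokernel_cong:
  assumes f: "f \<in> Hom C a b" and g: "g \<in> Hom C a' b" and c: "is_cokernel C f c"
    and fg: "h \<in> Hom C a a'" "g \<cdot> h = f" and gf: "c \<cdot> g = Zero C a' (Cod C c)"
  shows "is_cokernel C g c"
proof (rule cokernelI[OF g cokernelD(1,3)[OF c f] gf])
  fix y x assume x: "x \<in> Hom C b y" "x \<cdot> g = Zero C a' y"
  have "x \<cdot> f = Zero C a y"
    using Comp_assoc[OF fg(1) g x(1)] fg(2) x(2) Zero_Comp[OF fg(1)] HomD[OF x(1)] by simp
  then show "\<exists>h \<in> Hom C (Cod C c) y. h \<cdot> c = x" using cokernelD(4)[OF c f x(1)] by blast
qed

lemma kernel_cong:
  assumes f: "f \<in> Hom C b a" and g: "g \<in> Hom C b a'" and k: "is_kernel C f k"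
    and fg: "h \<in> Hom C a' a" "h \<cdot> g = f" and gf: "g \<cdot> k = Zero C (Dom C k) a'"
  shows "is_kernel C g k"
proof (rule kernelI[OF g kernelD(1,3)[OF k f] gf])
  fix y x assume x: "x \<in> Hom C y b" "g \<cdot> x = Zero C y a'"
  have "f \<cdot> x = Zero C y a"
    using Comp_eq_ZeroI[OF x(1) g fg(1) x(2)] fg(2) by simp
  then show "\<exists>h \<in> Hom C y (Dom C k). k \<cdot> h = x" using kernelD(4)[OF k f x(1)] by blast
qed

text \<open>The abelian axiom speaks of representatives picked by \<open>SOME\<close>, which are out
  of control in a subcategory. Comparing them with given ones by isomorphisms allows the axiom to be
  checked on any convenient factorization.\<close>

lemma coimage_iso_imageI:
  assumes f: "f \<in> Hom C a b" and k: "is_kernel C f k" and c: "is_cokernel C k c"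
    and d: "is_cokernel C f d" and m: "is_kernel C d m" "Dom C m = Cod C c" and mc: "m \<cdot> c = f"
  shows "\<exists>h \<in> Hom C (Cod C (Coimg C f)) (Dom C (Img C f)). iso_arr C h \<and> Img C f \<cdot> (h \<cdot> Coimg C f) = f"
proof -
  note kD = kernelD[OF k f] and dD = cokernelD[OF d f]
  note cD = cokernelD[OF c kD(1)] and mD = kernelD[OF m(1) dD(1)]
  have K: "is_kernel C f (Ker C f)" unfolding Ker_def by (rule someI[of "is_kernel C f", OF k])
  have Ck: "is_cokernel C f (Coker C f)" unfolding Coker_def by (rule someI[of "is_cokernel C f", OF d])
  note KD = kernelD[OF K f] and CD = cokernelD[OF Ck f]
  obtain i where i: "i \<in> Hom C (Dom C (Ker C f)) (Dom C k)" "iso_arr C i" "k \<cdot> i = Ker C f"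
    using kernel_unique[OF f k K] .
  obtain i' where i': "i' \<in> Hom C (Dom C k) (Dom C (Ker C f))" "Ker C f \<cdot> i' = k"
    using KD(4)[OF kD(1,2)] by blast
  have "c \<cdot> Ker C f = Zero C (Dom C (Ker C f)) (Cod C c)"
    using Comp_assoc[OF i(1) kD(1) cD(1)] i(3) cD(2) Zero_Comp[OF i(1)] HomD[OF cD(1)] by simp
  then have cK: "is_cokernel C (Ker C f) c" by (rule cokernel_cong[OF kD(1) KD(1) c i'])
  have Co: "is_cokernel C (Ker C f) (Coimg C f)"
    unfolding Coimg_def Coker_def[of C "Ker C f"] by (rule someI[of "is_cokernel C (Ker C f)", OF cK])
  obtain j where j: "j \<in> Hom C (Cod C (Coimg C f)) (Cod C c)" "iso_arr C j" "j \<cdot> Coimg C f = c"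
    using cokernel_unique[OF KD(1) Co cK] .
  obtain r where r: "r \<in> Hom C (Cod C d) (Cod C (Coker C f))" "r \<cdot> d = Coker C f"
    using dD(4)[OF CD(1,2)] by blast
  obtain r' where r': "r' \<in> Hom C (Cod C (Coker C f)) (Cod C d)" "r' \<cdot> Coker C f = d"
    using CD(4)[OF dD(1,2)] by blast
  have "Coker C f \<cdot> m = Zero C (Dom C m) (Cod C (Coker C f))"
    using Comp_eq_ZeroI[OF mD(1) dD(1) r(1) mD(2)] r(2) by simp
  then have mK: "is_kernel C (Coker C f) m" by (rule kernel_cong[OF dD(1) CD(1) m(1) r'])
  have Im: "is_kernel C (Coker C f) (Img C f)"
    unfolding Img_def Ker_def[of C "Coker C f"] by (rule someI[of "is_kernel C (Coker C f)", OF mK])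
  obtain l where l: "l \<in> Hom C (Dom C m) (Dom C (Img C f))" "iso_arr C l" "Img C f \<cdot> l = m"
    using kernel_unique[OF CD(1) Im mK] .
  note CoD = cokernelD[OF Co KD(1)] and ImD = kernelD[OF Im CD(1)]
  have l1: "l \<in> Hom C (Cod C c) (Dom C (Img C f))" using l(1) m(2) by simp
  show ?thesis
  proof (intro bexI[of _ "l \<cdot> j"] conjI)
    show "l \<cdot> j \<in> Hom C (Cod C (Coimg C f)) (Dom C (Img C f))" using Comp_Hom[OF j(1) l1] .
    show "iso_arr C (l \<cdot> j)" using iso_arr_Comp[OF j(2,1) l(2) l1] .
    show "Img C f \<cdot> ((l \<cdot> j) \<cdot> Coimg C f) = f"
      using Comp_assoc[OF CoD(1) j(1) l1] Comp_assoc[OF cD(1) l1 ImD(1)] j(3) l(3) mc by simp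
  qed
qed

text \<open>Bilinearity makes composition with \<open>h\<close> a homomorphism in any case, so the
  group isomorphisms of the theorem amount to bijections.\<close>

lemma hom_group_iso_iff:
  assumes h: "h \<in> Hom C x y" and u: "u \<in> Obj C"
  shows "(\<lambda>\<alpha>. h \<cdot> \<alpha>) \<in> iso (hom_group C u x) (hom_group C u y) \<longleftrightarrow>
    bij_betw (\<lambda>\<alpha>. h \<cdot> \<alpha>) (Hom C u x) (Hom C u y)"
  using Comp_Hom[OF _ h] Comp_Add[OF _ _ h]
  by (auto simp: iso_def hom_def hom_group_def)

lemma preadditive_full_sub: "preadditive_category (full_sub C B)"
proof -
  interpret S: category "full_sub C B" by (rule category_full_sub)
  have A: "Add (full_sub C B) = Add C" "Zero (full_sub C B) = Zero C" by (simp_all add: full_sub_def)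
  show ?thesis
  proof (intro preadditive_category.intro preadditive_category_axioms.intro S.category_axioms)
    fix a b assume "a \<in> Obj (full_sub C B)" "b \<in> Obj (full_sub C B)"
    then have "hom_group (full_sub C B) a b = hom_group C a b" "a \<in> Obj C" "b \<in> Obj C"
      by (auto simp: hom_group_def Hom_full_sub A)
    then show "comm_group (hom_group (full_sub C B) a b)" using hom_comm_group by simp
  qed (auto simp: A Hom_full_sub Comp_Add Add_Comp split: if_splits)
qed

lemma Zero_full_sub [simp]: "Zero (full_sub C B) = Zero C" "Add (full_sub C B) = Add C"
  by (simp_all add: full_sub_def)

end

section \<open>Images, monos as kernels, epis as cokernels, and a third isomorphism theorem\<close>

context abelian_category
begin

lemma Ker_kernel: "f \<in> Hom C a b \<Longrightarrow> is_kernel C f (Ker C f)"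
  unfolding Ker_def using someI_ex[OF ex_kernel] HomD(1) by blast

lemma Coker_cokernel: "f \<in> Hom C a b \<Longrightarrow> is_cokernel C f (Coker C f)"
  unfolding Coker_def using someI_ex[OF ex_cokernel] HomD(1) by blast

lemma Img_kernel: "f \<in> Hom C a b \<Longrightarrow> is_kernel C (Coker C f) (Img C f)"
  unfolding Img_def using Ker_kernel cokernelD(1)[OF Coker_cokernel] by blast

lemma Img_arr:
  assumes "f \<in> Hom C a b"
  shows "Img C f \<in> Hom C (Dom C (Img C f)) b" "mono_arr C (Img C f)"
  using kernelD[OF Img_kernel[OF assms] cokernelD(1)[OF Coker_cokernel[OF assms] assms]] by auto

text \<open>The isomorphism from coimage to image is absorbed into the epi, so that later arguments
  see only \<open>Img C f\<close> and a cokernel of \<open>Ker C f\<close>.\<close>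

lemma image_factorization:
  assumes f: "f \<in> Hom C a b"
  obtains e where "e \<in> Hom C a (Dom C (Img C f))" "is_cokernel C (Ker C f) e" "epi_arr C e" "Img C f \<cdot> e = f"
proof -
  note KD = kernelD[OF Ker_kernel[OF f] f]
  have Co: "is_cokernel C (Ker C f) (Coimg C f)"
    unfolding Coimg_def using Coker_cokernel[OF KD(1)] .
  note CoD = cokernelD[OF Co KD(1)]
  obtain h where h: "h \<in> Hom C (Cod C (Coimg C f)) (Dom C (Img C f))" "iso_arr C h"
    "Img C f \<cdot> (h \<cdot> Coimg C f) = f"
    using coimage_iso_image HomD(1)[OF f] by blast
  obtain g where g: "g \<in> Hom C (Dom C (Img C f)) (Cod C (Coimg C f))" "g \<cdot> h = Ident C (Cod C (Coimg C f))"
    "h \<cdot> g = Ident C (Dom C (Img C f))"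
    using iso_arrE[OF h(2,1)] by metis
  let ?e = "h \<cdot> Coimg C f"
  have e: "?e \<in> Hom C a (Dom C (Img C f))" using Comp_Hom[OF CoD(1) h(1)] .
  have epi: "epi_arr C ?e"
  proof (rule epi_arrI_Zero[OF e])
    fix x d assume d: "d \<in> Hom C (Dom C (Img C f)) x" "d \<cdot> ?e = Zero C a x"
    have "d \<cdot> h = Zero C (Cod C (Coimg C f)) x"
      using epi_arr_ZeroD[OF CoD(3,1) Comp_Hom[OF h(1) d(1)]] Comp_assoc[OF CoD(1) h(1) d(1)] d(2) by simp
    then show "d = Zero C (Dom C (Img C f)) x"
      using cancel_right_inverse[OF g(1) h(1) g(3) d(1)] Zero_Comp[OF g(1)] HomD[OF d(1)] by simp
  qed
  have "is_cokernel C (Ker C f) ?e"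
  proof (rule cokernelI[OF KD(1) e epi])
    show "?e \<cdot> Ker C f = Zero C (Dom C (Ker C f)) (Dom C (Img C f))"
      using Comp_eq_ZeroI[OF KD(1) CoD(1) h(1) CoD(2)] .
    fix y x assume x: "x \<in> Hom C a y" "x \<cdot> Ker C f = Zero C (Dom C (Ker C f)) y"
    obtain z where z: "z \<in> Hom C (Cod C (Coimg C f)) y" "z \<cdot> Coimg C f = x" using CoD(4)[OF x] by blast
    have "(z \<cdot> g) \<cdot> ?e = x"
      using Comp_assoc[OF CoD(1) h(1) Comp_Hom[OF g(1) z(1)]] cancel_right_inverse[OF h(1) g(1,2) z(1)] z(2) by simp
    then show "\<exists>h \<in> Hom C (Dom C (Img C f)) y. h \<cdot> ?e = x" using Comp_Hom[OF g(1) z(1)] by blast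
  qed
  then show ?thesis using that e epi h(3) by blast
qed

text \<open>The kernel of a mono is zero, so the identity extends along the epi part
  \<open>e\<close> of the image factorization. Thus \<open>e\<close> is invertible and
  \<open>m\<close> inherits the kernel property of \<open>Img C m\<close>.\<close>

lemma mono_kernel_of_cokernel:
  assumes m: "mono_arr C m" "m \<in> Hom C a b" and c: "is_cokernel C m c"
  shows "is_kernel C c m"
proof -
  note cD = cokernelD[OF c m(2)] and CD = cokernelD[OF Coker_cokernel[OF m(2)] m(2)]
  note KD = kernelD[OF Ker_kernel[OF m(2)] m(2)]
  note ID = kernelD[OF Img_kernel[OF m(2)] CD(1)]
  obtain e where e: "e \<in> Hom C a (Dom C (Img C m))" "is_cokernel C (Ker C m) e" "epi_arr C e" "Img C m \<cdot> e = m"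
    using image_factorization[OF m(2)] .
  have "Ident C a \<cdot> Ker C m = Zero C (Dom C (Ker C m)) a"
    using mono_arr_ZeroD[OF m KD(1,2)] Ident_Comp_Hom[OF KD(1)] by simp
  then obtain s where s: "s \<in> Hom C (Dom C (Img C m)) a" "s \<cdot> e = Ident C a"
    using cokernelD(4)[OF e(2) KD(1) Ident_Hom] HomD[OF m(2)] HomD[OF e(1)] by auto
  have "(e \<cdot> s) \<cdot> e = Ident C (Dom C (Img C m)) \<cdot> e"
    using cancel_right_inverse[OF e(1) s(1,2) e(1)] Ident_Comp_Hom[OF e(1)] by simp
  then have es: "e \<cdot> s = Ident C (Dom C (Img C m))"
    using epi_arrD[OF e(3,1) Comp_Hom[OF s(1) e(1)] Ident_Hom] HomD[OF s(1)] by blast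
  show ?thesis
  proof (rule kernelI[OF cD(1) m(2,1) cD(2)])
    fix y g assume g: "g \<in> Hom C y b" "c \<cdot> g = Zero C y (Cod C c)"
    obtain r where r: "r \<in> Hom C (Cod C c) (Cod C (Coker C m))" "r \<cdot> c = Coker C m"
      using cD(4)[OF CD(1,2)] by blast
    have "Coker C m \<cdot> g = Zero C y (Cod C (Coker C m))"
      using Comp_eq_ZeroI[OF g(1) cD(1) r(1) g(2)] r(2) by simp
    then obtain h where h: "h \<in> Hom C y (Dom C (Img C m))" "Img C m \<cdot> h = g" using ID(4)[OF g(1)] by blast
    have "m \<cdot> (s \<cdot> h) = g"
      using Comp_assoc[OF Comp_Hom[OF h(1) s(1)] e(1) ID(1)] cancel_left_inverse[OF s(1) e(1) es h(1)] e(4) h(2) by simp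
    then show "\<exists>h \<in> Hom C y a. m \<cdot> h = g" using Comp_Hom[OF h(1) s(1)] by blast
  qed
qed

text \<open>Dual argument: the cokernel of an epi is zero, so the identity lifts through
  \<open>Img C e\<close>, which is therefore invertible.\<close>

lemma epi_cokernel_of_kernel:
  assumes e: "epi_arr C e" "e \<in> Hom C a b" and k: "is_kernel C e k"
  shows "is_cokernel C k e"
proof -
  note kD = kernelD[OF k e(2)] and KD = kernelD[OF Ker_kernel[OF e(2)] e(2)]
  note CD = cokernelD[OF Coker_cokernel[OF e(2)] e(2)]
  note ID = kernelD[OF Img_kernel[OF e(2)] CD(1)]
  obtain p where p: "p \<in> Hom C a (Dom C (Img C e))" "is_cokernel C (Ker C e) p" "epi_arr C p" "Img C e \<cdot> p = e"
    using image_factorization[OF e(2)] .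
  have b: "b \<in> Obj C" using HomD[OF e(2)] by simp
  have "Coker C e \<cdot> Ident C b = Zero C b (Cod C (Coker C e))"
    using epi_arr_ZeroD[OF e CD(1,2)] Comp_Ident_Hom[OF CD(1)] by simp
  then obtain s where s: "s \<in> Hom C b (Dom C (Img C e))" "Img C e \<cdot> s = Ident C b"
    using ID(4)[OF Ident_Hom[OF b]] by blast
  have "Img C e \<cdot> (s \<cdot> Img C e) = Img C e \<cdot> Ident C (Dom C (Img C e))"
    using cancel_left_inverse[OF s(1) ID(1) s(2) ID(1)] Comp_Ident_Hom[OF ID(1)] by simp
  then have sI: "s \<cdot> Img C e = Ident C (Dom C (Img C e))"
    using mono_arrD[OF ID(3,1) Comp_Hom[OF ID(1) s(1)] Ident_Hom] HomD[OF ID(1)] by blast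
  show ?thesis
  proof (rule cokernelI[OF kD(1) e(2,1) kD(2)])
    fix y g assume g: "g \<in> Hom C a y" "g \<cdot> k = Zero C (Dom C k) y"
    obtain r where r: "r \<in> Hom C (Dom C (Ker C e)) (Dom C k)" "k \<cdot> r = Ker C e" using kD(4)[OF KD(1,2)] by blast
    have "g \<cdot> Ker C e = Zero C (Dom C (Ker C e)) y"
      using Comp_assoc[OF r(1) kD(1) g(1)] r(2) g(2) Zero_Comp[OF r(1)] HomD[OF g(1)] by simp
    then obtain h where h: "h \<in> Hom C (Dom C (Img C e)) y" "h \<cdot> p = g"
      using cokernelD(4)[OF p(2) KD(1) g(1)] HomD[OF p(1)] by auto
    have "(h \<cdot> s) \<cdot> e = g"
      using Comp_assoc[OF p(1) ID(1) Comp_Hom[OF s(1) h(1)]] cancel_right_inverse[OF ID(1) s(1) sI h(1)] p(4) h(2) by simp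
    then show "\<exists>h \<in> Hom C b y. h \<cdot> e = g" using Comp_Hom[OF s(1) h(1)] by blast
  qed
qed

text \<open>
  That \<open>w\<close> is epi is shown without pullbacks: the cokernel \<open>d\<close> of \<open>q \<cdot> k\<close> factors through the coimage of
  \<open>e\<close>, hence kills \<open>n\<close>, so \<open>n\<close> factors through the image of \<open>q \<cdot> k\<close>.
\<close>

lemma third_isomorphism:
  assumes e: "e \<in> Hom C a b" and k: "is_kernel C e k" and t: "t \<in> Hom C x (Dom C k)" "mono_arr C t"
    and q: "is_cokernel C (k \<cdot> t) q" and p: "p \<in> Hom C (Cod C q) b" "p \<cdot> q = e" and n: "is_kernel C p n"
  obtains w where "w \<in> Hom C (Dom C k) (Dom C n)" "n \<cdot> w = q \<cdot> k" "is_cokernel C t w"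
proof -
  note kD = kernelD[OF k e] and nD = kernelD[OF n p(1)]
  note kt = Comp_Hom[OF t(1) kD(1)]
  note qD = cokernelD[OF q kt]
  note qk = Comp_Hom[OF kD(1) qD(1)]
  have "p \<cdot> (q \<cdot> k) = Zero C (Dom C k) b" using Comp_assoc[OF kD(1) qD(1) p(1)] p(2) kD(2) by simp
  then obtain w where w: "w \<in> Hom C (Dom C k) (Dom C n)" "n \<cdot> w = q \<cdot> k" using nD(4)[OF qk] by blast
  obtain e' where e': "e' \<in> Hom C a (Dom C (Img C e))" "is_cokernel C (Ker C e) e'" "epi_arr C e'" "Img C e \<cdot> e' = e"
    using image_factorization[OF e] .
  note IH = Img_arr[OF e]
  have e'0: "e' \<cdot> z = Zero C y (Dom C (Img C e))" if "z \<in> Hom C y a" "e \<cdot> z = Zero C y b" for z y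
    using mono_arr_ZeroD[OF IH(2,1) Comp_Hom[OF that(1) e'(1)]] Comp_assoc[OF that(1) e'(1) IH(1)] e'(4) that(2) by simp
  have "e \<cdot> (k \<cdot> t) = Zero C x b"
    using Comp_assoc[OF t(1) kD(1) e] kD(2) Zero_Comp[OF t(1)] HomD[OF e] by simp
  \<comment> \<open>\<open>p'\<close> is \<open>p\<close> corestricted to the image of
    \<open>e\<close>; as the image inclusion is mono, \<open>p'\<close> still kills the kernel
    \<open>n\<close> of \<open>p\<close>.\<close>
  then obtain p' where p': "p' \<in> Hom C (Cod C q) (Dom C (Img C e))" "p' \<cdot> q = e'"
    using qD(4)[OF e'(1) e'0[OF kt]] by blast
  have pp': "Img C e \<cdot> p' = p"
    using epi_arrD[OF qD(3,1) Comp_Hom[OF p'(1) IH(1)] p(1)] Comp_assoc[OF qD(1) p'(1) IH(1)] p'(2) e'(4) p(2) by simp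
  have p'n: "p' \<cdot> n = Zero C (Dom C n) (Dom C (Img C e))"
    using mono_arr_ZeroD[OF IH(2,1) Comp_Hom[OF nD(1) p'(1)]] Comp_assoc[OF nD(1) p'(1) IH(1)] pp' nD(2) by simp
  have "epi_arr C w"
  proof -
    note mH = Img_arr[OF w(1)]
    obtain v where v: "v \<in> Hom C (Dom C k) (Dom C (Img C w))" "is_cokernel C (Ker C w) v" "epi_arr C v" "Img C w \<cdot> v = w"
      using image_factorization[OF w(1)] .
    \<comment> \<open>Since \<open>n\<close> is mono, \<open>?m\<close> after \<open>v\<close> is
      the image factorization of \<open>q \<cdot> k\<close>.\<close>
    let ?m = "n \<cdot> Img C w"
    have m: "?m \<in> Hom C (Dom C (Img C w)) (Cod C q)" using Comp_Hom[OF mH(1) nD(1)] .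
    have mono: "mono_arr C ?m"
      by (rule mono_arrI_Zero[OF m])
        (metis mono_arr_ZeroD[OF mH(2,1)] mono_arr_ZeroD[OF nD(3,1)] Comp_assoc[OF _ mH(1) nD(1)] Comp_Hom[OF _ mH(1)])
    have mv: "?m \<cdot> v = q \<cdot> k" using Comp_assoc[OF v(1) mH(1) nD(1)] v(4) w(2) by simp
    define d where "d = Coker C ?m"
    have dc: "is_cokernel C ?m d" unfolding d_def using Coker_cokernel[OF m] .
    note dD = cokernelD[OF dc m]
    have "(d \<cdot> q) \<cdot> k = Zero C (Dom C k) (Cod C d)"
      using Comp_assoc[OF kD(1) qD(1) dD(1)] mv Comp_eq_ZeroI[OF v(1) m dD(1)] Comp_assoc[OF v(1) m dD(1)] dD(2)
        Zero_Comp[OF v(1)] HomD[OF dD(1)] by simp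
    then have "(d \<cdot> q) \<cdot> Ker C e = Zero C (Dom C (Ker C e)) (Cod C d)"
    proof -
      assume *: "(d \<cdot> q) \<cdot> k = Zero C (Dom C k) (Cod C d)"
      note KD = kernelD[OF Ker_kernel[OF e] e]
      obtain r where r: "r \<in> Hom C (Dom C (Ker C e)) (Dom C k)" "k \<cdot> r = Ker C e" using kD(4)[OF KD(1,2)] by blast
      show ?thesis
        using Comp_assoc[OF r(1) kD(1) Comp_Hom[OF qD(1) dD(1)]] r(2) * Zero_Comp[OF r(1)] HomD[OF dD(1)] by simp
    qed
    then obtain y where y: "y \<in> Hom C (Dom C (Img C e)) (Cod C d)" "y \<cdot> e' = d \<cdot> q"
      using cokernelD(4)[OF e'(2) kernelD(1)[OF Ker_kernel[OF e] e] Comp_Hom[OF qD(1) dD(1)]] HomD[OF e'(1)] by auto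
    have "y \<cdot> p' = d"
      using epi_arrD[OF qD(3,1) Comp_Hom[OF p'(1) y(1)] dD(1)] Comp_assoc[OF qD(1) p'(1) y(1)] p'(2) y(2) by simp
    then have "d \<cdot> n = Zero C (Dom C n) (Cod C d)"
      using Comp_eq_ZeroI[OF nD(1) p'(1) y(1) p'n] by simp
    then obtain s where s: "s \<in> Hom C (Dom C n) (Dom C (Img C w))" "?m \<cdot> s = n"
      using kernelD(4)[OF mono_kernel_of_cokernel[OF mono m dc] dD(1) nD(1)] HomD[OF m] by auto
    have "n \<cdot> (Img C w \<cdot> s) = n \<cdot> Ident C (Dom C n)"
      using Comp_assoc[OF s(1) mH(1) nD(1)] s(2) Comp_Ident_Hom[OF nD(1)] by simp
    then have ms: "Img C w \<cdot> s = Ident C (Dom C n)"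
      using mono_arrD[OF nD(3,1) Comp_Hom[OF s(1) mH(1)] Ident_Hom] HomD[OF nD(1)] by blast
    show ?thesis
    proof (rule epi_arrI_Zero[OF w(1)])
      fix z f assume f: "f \<in> Hom C (Dom C n) z" "f \<cdot> w = Zero C (Dom C k) z"
      have "f \<cdot> Img C w = Zero C (Dom C (Img C w)) z"
        using epi_arr_ZeroD[OF v(3,1) Comp_Hom[OF mH(1) f(1)]] Comp_assoc[OF v(1) mH(1) f(1)] v(4) f(2) by simp
      then show "f = Zero C (Dom C n) z"
        using cancel_right_inverse[OF s(1) mH(1) ms f(1)] Zero_Comp[OF s(1)] HomD[OF f(1)] by simp
    qed
  qed
  have ktm: "mono_arr C (k \<cdot> t)"
    by (rule mono_arrI_Zero[OF kt])
      (metis mono_arr_ZeroD[OF t(2,1)] mono_arr_ZeroD[OF kD(3,1)] Comp_assoc[OF _ t(1) kD(1)] Comp_Hom[OF _ t(1)])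
  note qker = mono_kernel_of_cokernel[OF ktm kt q]
  \<comment> \<open>With \<open>w\<close> epi it remains to see \<open>t\<close> as its kernel. This
    is read off after composing with the mono \<open>n\<close>: \<open>k \<cdot> t\<close> is mono,
    hence a kernel of its own cokernel \<open>q\<close>.\<close>
  have "is_kernel C w t"
  proof (rule kernelI[OF w(1) t(1,2)])
    have "n \<cdot> (w \<cdot> t) = Zero C x (Cod C q)"
      using Comp_assoc[OF t(1) w(1) nD(1)] w(2) Comp_assoc[OF t(1) kD(1) qD(1)] qD(2) by simp
    then show "w \<cdot> t = Zero C x (Dom C n)" using mono_arr_ZeroD[OF nD(3,1) Comp_Hom[OF t(1) w(1)]] by simp
    fix y g assume g: "g \<in> Hom C y (Dom C k)" "w \<cdot> g = Zero C y (Dom C n)"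
    have "q \<cdot> (k \<cdot> g) = Zero C y (Cod C q)"
      using Comp_assoc[OF g(1) kD(1) qD(1)] Comp_eq_ZeroI[OF g(1) w(1) nD(1) g(2)] w(2) by simp
    then obtain h where h: "h \<in> Hom C y x" "(k \<cdot> t) \<cdot> h = k \<cdot> g"
      using kernelD(4)[OF qker qD(1) Comp_Hom[OF g(1) kD(1)]] HomD[OF kt] by auto
    then have "t \<cdot> h = g"
      using mono_arrD[OF kD(3,1) Comp_Hom[OF h(1) t(1)] g(1)] Comp_assoc[OF h(1) t(1) kD(1)] by simp
    then show "\<exists>h \<in> Hom C y x. t \<cdot> h = g" using h(1) by blast
  qed
  then have "is_cokernel C t w" by (rule epi_cokernel_of_kernel[OF \<open>epi_arr C w\<close> w(1)])
  then show ?thesis using that w by blast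
qed

end

section \<open>Coproducts of small families\<close>

context category
begin

lemma coproduct_reindex:
  assumes x: "is_coproduct C I F x \<iota>" and h: "bij_betw h J I"
    and G: "\<And>j. j \<in> J \<Longrightarrow> G j = F (h j)"
  shows "is_coproduct C J G x (\<lambda>j. \<iota> (h j))"
  unfolding is_coproduct_def
proof (intro conjI ballI allI impI)
  have hI: "h j \<in> I" if "j \<in> J" for j using h that by (auto simp: bij_betw_def)
  show "x \<in> Obj C" using x by (simp add: is_coproduct_def)
  show "\<iota> (h j) \<in> Hom C (G j) x" if "j \<in> J" for j
    using x hI[OF that] G[OF that] by (simp add: is_coproduct_def)
  fix y \<tau> assume y: "y \<in> Obj C" and \<tau>: "\<forall>j\<in>J. \<tau> j \<in> Hom C (G j) y"
  let ?g = "inv_into J h"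
  have g: "?g i \<in> J" "h (?g i) = i" if "i \<in> I" for i
    using h that by (auto simp: bij_betw_def inv_into_into f_inv_into_f)
  have gh: "?g (h j) = j" if "j \<in> J" for j using h that by (auto simp: bij_betw_def)
  have "\<tau> (?g i) \<in> Hom C (F i) y" if "i \<in> I" for i using \<tau> g[OF that] G by fastforce
  then obtain f where f: "f \<in> Hom C x y" "\<And>i. i \<in> I \<Longrightarrow> f \<cdot> \<iota> i = \<tau> (?g i)"
    using coproduct_hom_ex[OF x y, of "\<lambda>i. \<tau> (?g i)"] by blast
  show "\<exists>!f. f \<in> Hom C x y \<and> (\<forall>j\<in>J. f \<cdot> \<iota> (h j) = \<tau> j)"
  proof (rule ex1I[of _ f])
    show "f \<in> Hom C x y \<and> (\<forall>j\<in>J. f \<cdot> \<iota> (h j) = \<tau> j)" using f hI gh by simp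
    fix f' assume f': "f' \<in> Hom C x y \<and> (\<forall>j\<in>J. f' \<cdot> \<iota> (h j) = \<tau> j)"
    show "f' = f"
    proof (rule coproduct_hom_eq[OF x _ f(1)])
      show "f' \<cdot> \<iota> i = f \<cdot> \<iota> i" if "i \<in> I" for i
        using f' g[OF that] f(2)[OF that] by metis
    qed (use f' in blast)
  qed
qed

text \<open>\<open>Sum_of\<close> and \<open>cocomplete\<close> take index sets in
  \<open>'k\<close>, while the canonical coproduct is indexed by pairs of an object and an arrow. A
  set smaller than \<open>\<kappa>\<close> injects into \<open>Field \<kappa>\<close>, so its index
  set can be moved there.\<close>

lemma small_reindex:
  assumes I: "small (\<kappa> :: 'k rel) I" and \<kappa>: "Card_order \<kappa>"
  obtains J :: "'k set" and h where "bij_betw h J I" "small \<kappa> J"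
proof -
  have "|I| \<le>o |Field \<kappa>|"
    using I \<kappa> unfolding small_def
    by (meson card_of_Field_ordIso ordIso_symmetric ordLess_imp_ordLeq ordLeq_ordIso_trans)
  then obtain g :: "_ \<Rightarrow> 'k" where g: "inj_on g I" by (auto simp: card_of_ordLeq[symmetric])
  have "|g ` I| \<le>o |I|" by (rule card_of_image)
  then have "small \<kappa> (g ` I)" using I unfolding small_def by (rule ordLeq_ordLess_trans)
  moreover have "bij_betw (inv_into I g) (g ` I) I"
    using bij_betw_inv_into[OF inj_on_imp_bij_betw[OF g]] .
  ultimately show ?thesis using that by blast
qed

lemma cocomplete_coproduct:
  assumes cc: "cocomplete (\<kappa> :: 'k rel) C" and J: "small \<kappa> (J :: 'k set)"
    and F: "\<And>j. j \<in> J \<Longrightarrow> F j \<in> Obj C"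
  shows "\<exists>x \<iota>. is_coproduct C J F x \<iota>"
proof -
  \<comment> \<open>The discrete category on \<open>J\<close>; each arrow is an identity and is
    named by its object, so cocones over it are bare families of arrows.\<close>
  define D :: "('k, 'k) cat" where
    "D = \<lparr>Obj = J, Arr = J, Dom = (\<lambda>j. j), Cod = (\<lambda>j. j), Ident = (\<lambda>j. j), Comp = (\<lambda>_ j. j)\<rparr>"
  define G where "G = \<lparr>FObj = F, FArr = (\<lambda>j. Ident C (F j))\<rparr>"
  have "category D" by unfold_locales (auto simp: D_def Hom_def)
  moreover have "cat_functor D C G"
    using F Ident_Hom Comp_Ident_Hom[OF Ident_Hom] by (simp add: cat_functor_def D_def G_def Hom_def)
  moreover have "small \<kappa> (Obj D)" "small \<kappa> (Arr D)" using J by (auto simp: D_def)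
  ultimately obtain x \<iota> where x: "is_colimit D C G x \<iota>"
    using cc unfolding cocomplete_def by blast
  have *: "is_cocone D C G y \<tau> \<longleftrightarrow> y \<in> Obj C \<and> (\<forall>j\<in>J. \<tau> j \<in> Hom C (F j) y)" for y \<tau>
    using Comp_Ident_Hom by (auto simp: is_cocone_def D_def G_def)
  have "Obj D = J" by (simp add: D_def)
  then have "is_coproduct C J F x \<iota>"
    using x unfolding is_colimit_def is_coproduct_def * by simp
  then show ?thesis by blast
qed

end

text \<open>Here regularity enters: a union of fewer than \<open>\<kappa>\<close> small sets is
  small. It bounds the index set of the coproduct behind \<open>can_mor\<close>.\<close>

lemma small_Sigma:
  assumes \<kappa>: "Card_order \<kappa>" "infinite (Field \<kappa>)" "regularCard \<kappa>"
    and I: "small \<kappa> I" and A: "\<And>i. i \<in> I \<Longrightarrow> small \<kappa> (A i)"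
  shows "small \<kappa> (SIGMA i:I. A i)"
proof -
  have "small \<kappa> ({i} \<times> A i)" if "i \<in> I" for i
  proof -
    have "{i} \<times> A i = Pair i ` A i" by auto
    then show ?thesis using A[OF that] card_of_image[of "Pair i" "A i"]
      unfolding small_def using ordLeq_ordLess_trans by metis
  qed
  then have *: "\<forall>i\<in>I. |{i} \<times> A i| <o \<kappa>" by (simp add: small_def)
  have "cinfinite \<kappa> \<and> Card_order \<kappa>" using \<kappa>(1,2) by (simp add: cinfinite_def)
  then have "|\<Union>i\<in>I. {i} \<times> A i| <o \<kappa>"
    using card_of_UNION_ordLess_infinite_Field_regularCard[OF \<kappa>(3) _ I[unfolded small_def] *] by blast
  moreover have "(\<Union>i\<in>I. {i} \<times> A i) = (SIGMA i:I. A i)" by auto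
  ultimately show ?thesis by (simp add: small_def)
qed

text \<open>\<open>C(x, -)\<close> sees \<open>g\<close> as a kernel of \<open>d\<close>.\<close>

definition kernel_at :: "('o, 'm, 'z) preadd_cat_scheme \<Rightarrow> 'o \<Rightarrow> 'm \<Rightarrow> 'm \<Rightarrow> bool" where
  "kernel_at C x d g \<longleftrightarrow>
    (\<forall>\<alpha> \<in> Hom C x (Dom C g). g \<cdot>\<^bsub>C\<^esub> \<alpha> = Zero C x (Cod C g) \<longrightarrow> \<alpha> = Zero C x (Dom C g)) \<and>
    (\<forall>\<beta> \<in> Hom C x (Cod C g). d \<cdot>\<^bsub>C\<^esub> \<beta> = Zero C x (Cod C d) \<longrightarrow>
       (\<exists>\<alpha> \<in> Hom C x (Dom C g). g \<cdot>\<^bsub>C\<^esub> \<alpha> = \<beta>))"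

context preadditive_category
begin

lemma kernel_atD:
  assumes "kernel_at C x d g" "g \<in> Hom C a b" "d \<in> Hom C b c"
  shows "\<alpha> \<in> Hom C x a \<Longrightarrow> g \<cdot> \<alpha> = Zero C x b \<Longrightarrow> \<alpha> = Zero C x a"
    "\<beta> \<in> Hom C x b \<Longrightarrow> d \<cdot> \<beta> = Zero C x c \<Longrightarrow> \<exists>\<alpha> \<in> Hom C x a. g \<cdot> \<alpha> = \<beta>"
  using assms HomD[OF assms(2)] HomD[OF assms(3)] unfolding kernel_at_def by auto

lemma kernel_atI:
  assumes "g \<in> Hom C a b" "d \<in> Hom C b c"
    "\<And>\<alpha>. \<alpha> \<in> Hom C x a \<Longrightarrow> g \<cdot> \<alpha> = Zero C x b \<Longrightarrow> \<alpha> = Zero C x a"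
    "\<And>\<beta>. \<beta> \<in> Hom C x b \<Longrightarrow> d \<cdot> \<beta> = Zero C x c \<Longrightarrow> \<exists>\<alpha> \<in> Hom C x a. g \<cdot> \<alpha> = \<beta>"
  shows "kernel_at C x d g"
  using assms(3,4) HomD[OF assms(1)] HomD[OF assms(2)] unfolding kernel_at_def by auto

text \<open>Every arrow into \<open>b\<close> is killed by \<open>Zero C b b\<close>, so
  \<open>kernel_at\<close> becomes injectivity plus surjectivity. Coreflections are thereby covered
  by the same transfer from \<open>U\<close> to presented objects as kernels.\<close>

lemma kernel_at_Zero_iff:
  assumes g: "g \<in> Hom C a b" and x: "x \<in> Obj C"
  shows "kernel_at C x (Zero C b b) g \<longleftrightarrow> bij_betw (\<lambda>\<alpha>. g \<cdot> \<alpha>) (Hom C x a) (Hom C x b)"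
proof
  note o = HomD(4,5)[OF g]
  note z = Zero_Hom[OF o(2) o(2)]
  {
    assume k: "kernel_at C x (Zero C b b) g"
    note kD = kernel_atD[OF k g z]
    have "inj_on (\<lambda>\<alpha>. g \<cdot> \<alpha>) (Hom C x a)"
      by (rule inj_onI) (rule eq_by_Comp_left[OF g _ _ _ kD(1)])
    moreover have "(\<lambda>\<alpha>. g \<cdot> \<alpha>) ` Hom C x a = Hom C x b"
      using kD(2) Zero_Comp[OF _ o(2)] Comp_Hom[OF _ g] by (auto simp: image_iff)
    ultimately show "bij_betw (\<lambda>\<alpha>. g \<cdot> \<alpha>) (Hom C x a) (Hom C x b)" by (simp add: bij_betw_def)
  next
    assume bij: "bij_betw (\<lambda>\<alpha>. g \<cdot> \<alpha>) (Hom C x a) (Hom C x b)"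
    show "kernel_at C x (Zero C b b) g"
    proof (rule kernel_atI[OF g z])
      fix \<alpha> assume "\<alpha> \<in> Hom C x a" "g \<cdot> \<alpha> = Zero C x b"
      then show "\<alpha> = Zero C x a"
        using inj_onD[OF bij_betw_imp_inj_on[OF bij]] Zero_Hom[OF x o(1)] Comp_Zero[OF g x] by simp
    next
      fix \<beta> assume "\<beta> \<in> Hom C x b"
      then show "\<exists>\<alpha> \<in> Hom C x a. g \<cdot> \<alpha> = \<beta>"
        using bij_betw_imp_surj_on[OF bij] by (metis imageE)
    qed
  }
qed

end

section \<open>Objects presented by a small family\<close>

locale small_family = abelian_category C for C :: "('o, 'm, 'z) preadd_cat_scheme" (structure) +
  fixes \<kappa> :: "'k rel" and U :: "'o set"
  assumes \<kappa>: "Card_order \<kappa>" "infinite (Field \<kappa>)" "regularCard \<kappa>"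
    and cocomplete: "cocomplete \<kappa> C"
    and U_Obj: "U \<subseteq> Obj C" and small_U: "small \<kappa> U"
    and small_Hom: "u \<in> U \<Longrightarrow> a \<in> Obj C \<Longrightarrow> small \<kappa> (Hom C u a)"
begin

lemma small_finite: "finite I \<Longrightarrow> small \<kappa> I"
  unfolding small_def
  by (rule finite_ordLess_infinite[OF card_of_Well_order card_order_on_well_order_on[OF \<kappa>(1)]])
    (simp_all add: Field_card_of \<kappa>)

lemma Sum_ofI:
  assumes "is_coproduct C I F x \<iota>" "small \<kappa> I" "F \<in> I \<rightarrow> U"
  shows "x \<in> Sum_of \<kappa> C U"
proof -
  obtain J :: "'k set" and h where h: "bij_betw h J I" "small \<kappa> J"
    using small_reindex[OF assms(2) \<kappa>(1)] .
  have "is_coproduct C J (\<lambda>j. F (h j)) x (\<lambda>j. \<iota> (h j))"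
    using coproduct_reindex[OF assms(1) h(1)] by simp
  moreover have "(\<lambda>j. F (h j)) \<in> J \<rightarrow> U" using assms(3) h(1) by (auto simp: bij_betw_def)
  ultimately show ?thesis using h(2) unfolding Sum_of_def by blast
qed

lemma Sum_of_Obj: "x \<in> Sum_of \<kappa> C U \<Longrightarrow> x \<in> Obj C"
  by (auto simp: Sum_of_def is_coproduct_def)

lemma U_Sum_of:
  assumes u: "u \<in> U"
  shows "u \<in> Sum_of \<kappa> C U"
proof (rule Sum_ofI[of "{()}" "\<lambda>_. u" u "\<lambda>_. Ident C u"])
  have o: "u \<in> Obj C" using u U_Obj by blast
  show "is_coproduct C {()} (\<lambda>_. u) u (\<lambda>_. Ident C u)"
    unfolding is_coproduct_def
  proof (intro conjI ballI allI impI)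
    fix y \<tau> assume "\<forall>i\<in>{()}. \<tau> i \<in> Hom C u y"
    then have \<tau>: "\<tau> () \<in> Hom C u y" by simp
    show "\<exists>!h. h \<in> Hom C u y \<and> (\<forall>i\<in>{()}. h \<cdot> Ident C u = \<tau> i)"
    proof (rule ex1I[of _ "\<tau> ()"])
      show "\<tau> () \<in> Hom C u y \<and> (\<forall>i\<in>{()}. \<tau> () \<cdot> Ident C u = \<tau> i)"
        using \<tau> Comp_Ident_Hom[OF \<tau>] by simp
      show "h = \<tau> ()" if "h \<in> Hom C u y \<and> (\<forall>i\<in>{()}. h \<cdot> Ident C u = \<tau> i)" for h
        using that Comp_Ident_Hom[of h u y] by simp
    qed
  qed (simp_all add: o Ident_Hom)
qed (simp_all add: u small_finite)

lemma small_coproduct: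
  assumes I: "small \<kappa> I" and F: "F \<in> I \<rightarrow> U"
  obtains x \<iota> where "is_coproduct C I F x \<iota>"
proof -
  obtain J :: "'k set" and h where h: "bij_betw h J I" "small \<kappa> J"
    using small_reindex[OF I \<kappa>(1)] .
  have "F (h j) \<in> Obj C" if "j \<in> J" for j using that F h U_Obj by (auto simp: bij_betw_def)
  then obtain x \<iota> where x: "is_coproduct C J (\<lambda>j. F (h j)) x \<iota>"
    using cocomplete_coproduct[OF cocomplete h(2), of "\<lambda>j. F (h j)"] by blast
  have "is_coproduct C I F x (\<lambda>i. \<iota> (inv_into J h i))"
    using h(1) by (intro coproduct_reindex[OF x bij_betw_inv_into[OF h(1)]])
      (auto simp: bij_betw_def f_inv_into_f)
  then show ?thesis using that by blast
qed

lemma Sum_of_Zero_test: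
  assumes S: "S \<in> Sum_of \<kappa> C U" and g: "g \<in> Hom C S y"
    and z: "\<And>u \<alpha>. u \<in> U \<Longrightarrow> \<alpha> \<in> Hom C u S \<Longrightarrow> g \<cdot> \<alpha> = Zero C u y"
  shows "g = Zero C S y"
proof -
  obtain I :: "'k set" and F \<iota> where I: "F \<in> I \<rightarrow> U" "is_coproduct C I F S \<iota>"
    using S by (auto simp: Sum_of_def)
  have o: "S \<in> Obj C" "y \<in> Obj C" using HomD[OF g] by auto
  have \<iota>: "\<iota> i \<in> Hom C (F i) S" if "i \<in> I" for i using I that by (simp add: is_coproduct_def)
  show ?thesis
  proof (rule coproduct_hom_eq[OF I(2) g Zero_Hom[OF o]])
    fix i assume i: "i \<in> I"
    show "g \<cdot> \<iota> i = Zero C S y \<cdot> \<iota> i"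
      using z[OF funcset_mem[OF I(1) i] \<iota>[OF i]] Zero_Comp[OF \<iota>[OF i] o(2)] by simp
  qed
qed

text \<open>Lifts on the summands may be chosen independently, since a coproduct imposes no
  compatibility between them.\<close>

lemma Sum_of_lift:
  assumes S: "S \<in> Sum_of \<kappa> C U" and g: "g \<in> Hom C a b" and \<beta>: "\<beta> \<in> Hom C S b"
    and lift: "\<And>u \<alpha>. u \<in> U \<Longrightarrow> \<alpha> \<in> Hom C u S \<Longrightarrow> \<exists>h \<in> Hom C u a. g \<cdot> h = \<beta> \<cdot> \<alpha>"
  shows "\<exists>h \<in> Hom C S a. g \<cdot> h = \<beta>"
proof -
  obtain I :: "'k set" and F \<iota> where I: "F \<in> I \<rightarrow> U" "is_coproduct C I F S \<iota>"
    using S by (auto simp: Sum_of_def)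
  have \<iota>: "\<iota> i \<in> Hom C (F i) S" if "i \<in> I" for i using I that by (simp add: is_coproduct_def)
  have "\<forall>i\<in>I. \<exists>h. h \<in> Hom C (F i) a \<and> g \<cdot> h = \<beta> \<cdot> \<iota> i"
    using lift[OF funcset_mem[OF I(1)] \<iota>] by blast
  then obtain \<tau> where \<tau>: "\<And>i. i \<in> I \<Longrightarrow> \<tau> i \<in> Hom C (F i) a" "\<And>i. i \<in> I \<Longrightarrow> g \<cdot> \<tau> i = \<beta> \<cdot> \<iota> i"
    by metis
  obtain h where h: "h \<in> Hom C S a" "\<And>i. i \<in> I \<Longrightarrow> h \<cdot> \<iota> i = \<tau> i"
    using coproduct_hom_ex[OF I(2) HomD(4)[OF g] \<tau>(1)] by metis
  have "g \<cdot> h = \<beta>"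
  proof (rule coproduct_hom_eq[OF I(2) Comp_Hom[OF h(1) g] \<beta>])
    fix i assume i: "i \<in> I"
    show "(g \<cdot> h) \<cdot> \<iota> i = \<beta> \<cdot> \<iota> i" using Comp_assoc[OF \<iota>[OF i] h(1) g] h(2)[OF i] \<tau>(2)[OF i] by simp
  qed
  then show ?thesis using h(1) by blast
qed

section \<open>Presentations, and tests on objects of \<open>Pres\<close>\<close>

lemma Pres_Obj: "Pres \<kappa> C U \<subseteq> Obj C"
  unfolding Pres_def isomorphic_def using HomD(4) by blast

lemma Pres_cokernel:
  assumes "S \<in> Sum_of \<kappa> C U" "S' \<in> Sum_of \<kappa> C U" "f \<in> Hom C S S'" "is_cokernel C f c"
  shows "Cod C c \<in> Pres \<kappa> C U"
proof -
  have o: "Cod C c \<in> Obj C" using HomD(5)[OF cokernelD(1)[OF assms(4,3)]] .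
  then have "isomorphic C (Cod C c) (Cod C c)"
    unfolding isomorphic_def using Ident_Hom iso_arr_Ident by blast
  then show ?thesis using assms HomD(1-3)[OF assms(3)] unfolding Pres_def by blast
qed

text \<open>The isomorphism permitted by \<open>Pres\<close> is absorbed into the cokernel, which
  then ends in \<open>b\<close> itself.\<close>

lemma Pres_presentation:
  assumes "b \<in> Pres \<kappa> C U"
  obtains S S' f e where "S \<in> Sum_of \<kappa> C U" "S' \<in> Sum_of \<kappa> C U" "f \<in> Hom C S S'"
    "e \<in> Hom C S' b" "is_cokernel C f e"
proof -
  obtain f c i where f: "f \<in> Arr C" "Dom C f \<in> Sum_of \<kappa> C U" "Cod C f \<in> Sum_of \<kappa> C U"
    and c: "is_cokernel C f c" and i: "i \<in> Hom C b (Cod C c)" "iso_arr C i"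
    using assms unfolding Pres_def isomorphic_def by blast
  have fH: "f \<in> Hom C (Dom C f) (Cod C f)" using f Arr_Hom by blast
  note cD = cokernelD[OF c fH]
  obtain j where j: "j \<in> Hom C (Cod C c) b" "j \<cdot> i = Ident C b" "i \<cdot> j = Ident C (Cod C c)"
    using iso_arrE[OF i(2,1)] by metis
  have e: "j \<cdot> c \<in> Hom C (Cod C f) b" using Comp_Hom[OF cD(1) j(1)] .
  have "is_cokernel C f (j \<cdot> c)"
  proof (rule cokernelI[OF fH e])
    show "epi_arr C (j \<cdot> c)"
    proof (rule epi_arrI_Zero[OF e])
      fix x d assume d: "d \<in> Hom C b x" "d \<cdot> (j \<cdot> c) = Zero C (Cod C f) x"
      have "d \<cdot> j = Zero C (Cod C c) x"
        using epi_arr_ZeroD[OF cD(3,1) Comp_Hom[OF j(1) d(1)]] Comp_assoc[OF cD(1) j(1) d(1)] d(2) by simp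
      then show "d = Zero C b x"
        using cancel_right_inverse[OF i(1) j(1,2) d(1)] Zero_Comp[OF i(1)] HomD[OF d(1)] by simp
    qed
    show "(j \<cdot> c) \<cdot> f = Zero C (Dom C f) b" using Comp_eq_ZeroI[OF fH cD(1) j(1) cD(2)] .
    fix y g assume g: "g \<in> Hom C (Cod C f) y" "g \<cdot> f = Zero C (Dom C f) y"
    obtain h where h: "h \<in> Hom C (Cod C c) y" "h \<cdot> c = g" using cD(4)[OF g] by blast
    have "(h \<cdot> i) \<cdot> (j \<cdot> c) = g"
      using Comp_assoc[OF e i(1) h(1)] cancel_left_inverse[OF j(1) i(1) j(3) cD(1)] h(2) by simp
    then show "\<exists>h \<in> Hom C b y. h \<cdot> (j \<cdot> c) = g" using Comp_Hom[OF i(1) h(1)] by blast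
  qed
  then show ?thesis using that f fH e by blast
qed

lemma Pres_isomorphic:
  assumes "b \<in> Pres \<kappa> C U" "i \<in> Hom C a b" "iso_arr C i"
  shows "a \<in> Pres \<kappa> C U"
proof -
  obtain f c j where f: "f \<in> Arr C" "Dom C f \<in> Sum_of \<kappa> C U" "Cod C f \<in> Sum_of \<kappa> C U"
    and c: "is_cokernel C f c" and j: "j \<in> Hom C b (Cod C c)" "iso_arr C j"
    using assms(1) unfolding Pres_def isomorphic_def by blast
  have "isomorphic C a (Cod C c)"
    unfolding isomorphic_def using Comp_Hom[OF assms(2) j(1)] iso_arr_Comp[OF assms(3,2) j(2,1)] by blast
  then show ?thesis using f c unfolding Pres_def by blast
qed

text \<open>A presented object is a quotient of a coproduct of members of \<open>U\<close>, and a
  map out of a coproduct vanishes if it does on each summand. This detection by \<open>U\<close>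
  replaces arguments with elements.\<close>

lemma Pres_Zero_test:
  assumes b: "b \<in> Pres \<kappa> C U" and g: "g \<in> Hom C b y"
    and z: "\<And>u \<alpha>. u \<in> U \<Longrightarrow> \<alpha> \<in> Hom C u b \<Longrightarrow> g \<cdot> \<alpha> = Zero C u y"
  shows "g = Zero C b y"
proof -
  obtain S S' f e where S: "S' \<in> Sum_of \<kappa> C U" "f \<in> Hom C S S'" "e \<in> Hom C S' b" "is_cokernel C f e"
    using Pres_presentation[OF b] .
  have "g \<cdot> e = Zero C S' y"
  proof (rule Sum_of_Zero_test[OF S(1) Comp_Hom[OF S(3) g]])
    fix u \<alpha> assume u: "u \<in> U" "\<alpha> \<in> Hom C u S'"
    show "(g \<cdot> e) \<cdot> \<alpha> = Zero C u y"
      using Comp_assoc[OF u(2) S(3) g] z[OF u(1) Comp_Hom[OF u(2) S(3)]] by simp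
  qed
  then show ?thesis using epi_arr_ZeroD[OF cokernelD(3)[OF S(4,2)] S(3) g] by blast
qed

text \<open>The zero object is the empty coproduct. It serves as the relations in the trivial
  presentation of a coproduct and as the zero object of the subcategory.\<close>

lemma zero_object_Sum_of:
  obtains z where "z \<in> Sum_of \<kappa> C U"
    "\<forall>a \<in> Obj C. (\<exists>!f. f \<in> Hom C z a) \<and> (\<exists>!f. f \<in> Hom C a z)"
proof -
  obtain z where z: "z \<in> Obj C" "\<forall>a \<in> Obj C. (\<exists>!f. f \<in> Hom C z a) \<and> (\<exists>!f. f \<in> Hom C a z)"
    using ex_zero_object by blast
  have "is_coproduct C ({} :: 'k set) (\<lambda>_. z) z (\<lambda>_. Ident C z)"
    unfolding is_coproduct_def using z by simp
  then have "z \<in> Sum_of \<kappa> C U" by (rule Sum_ofI) (simp_all add: small_finite)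
  then show ?thesis using z(2) by (intro that) simp_all
qed

lemma Sum_of_Pres: "Sum_of \<kappa> C U \<subseteq> Pres \<kappa> C U"
proof
  fix x assume x: "x \<in> Sum_of \<kappa> C U"
  then have o: "x \<in> Obj C" by (rule Sum_of_Obj)
  obtain z where z: "z \<in> Sum_of \<kappa> C U" by (rule zero_object_Sum_of)
  note zo = Sum_of_Obj[OF z]
  have "is_cokernel C (Zero C z x) (Ident C x)"
  proof (rule cokernelI[OF Zero_Hom[OF zo o] Ident_Hom[OF o]])
    show "epi_arr C (Ident C x)"
      by (rule epi_arrI_Zero[OF Ident_Hom[OF o]]) (simp add: Comp_Ident_Hom)
    show "Ident C x \<cdot> Zero C z x = Zero C z x" using Ident_Comp_Hom[OF Zero_Hom[OF zo o]] .
    show "\<exists>h \<in> Hom C x y. h \<cdot> Ident C x = g" if "g \<in> Hom C x y" for y g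
      by (rule bexI[of _ g]) (rule Comp_Ident_Hom[OF that], rule that)
  qed
  from Pres_cokernel[OF z x Zero_Hom[OF zo o] this] show "x \<in> Pres \<kappa> C U"
    using HomD[OF Ident_Hom[OF o]] by simp
qed

lemma U_Pres: "u \<in> U \<Longrightarrow> u \<in> Pres \<kappa> C U"
  using U_Sum_of Sum_of_Pres by blast

text \<open>Take a presentation of \<open>b\<close> with relations \<open>S\<close> and generators
  \<open>S'\<close>. The lift is built summand by summand on \<open>S'\<close>; it descends to
  \<open>b\<close> because the injectivity half, proved beforehand for all presented objects, forces
  it to vanish on \<open>S\<close>.\<close>

lemma kernel_at_Pres:
  assumes g: "g \<in> Hom C a y" and d: "d \<in> Hom C y c"
    and at: "\<And>u. u \<in> U \<Longrightarrow> kernel_at C u d g" and b: "b \<in> Pres \<kappa> C U"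
  shows "kernel_at C b d g"
proof (rule kernel_atI[OF g d])
  note atD = kernel_atD[OF at g d]
  have inj: "\<alpha> = Zero C x a" if "x \<in> Pres \<kappa> C U" "\<alpha> \<in> Hom C x a" "g \<cdot> \<alpha> = Zero C x y" for x \<alpha>
  proof (rule Pres_Zero_test[OF that(1,2)])
    fix u \<beta> assume u: "u \<in> U" "\<beta> \<in> Hom C u x"
    have "g \<cdot> (\<alpha> \<cdot> \<beta>) = Zero C u y"
      using Comp_assoc[OF u(2) that(2) g] that(3) Zero_Comp[OF u(2)] HomD[OF g] by simp
    then show "\<alpha> \<cdot> \<beta> = Zero C u a" using atD(1)[OF u(1) Comp_Hom[OF u(2) that(2)]] by blast
  qed
  then show "\<alpha> = Zero C b a" if "\<alpha> \<in> Hom C b a" "g \<cdot> \<alpha> = Zero C b y" for \<alpha> using b that by blast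
  fix \<beta> assume \<beta>: "\<beta> \<in> Hom C b y" "d \<cdot> \<beta> = Zero C b c"
  obtain S S' f e where S: "S \<in> Sum_of \<kappa> C U" "S' \<in> Sum_of \<kappa> C U" "f \<in> Hom C S S'" "e \<in> Hom C S' b" "is_cokernel C f e"
    using Pres_presentation[OF b] .
  note eD = cokernelD[OF S(5,3)]
  have cod: "Cod C e = b" using HomD[OF S(4)] by simp
  have "\<exists>h \<in> Hom C S' a. g \<cdot> h = \<beta> \<cdot> e"
  proof (rule Sum_of_lift[OF S(2) g Comp_Hom[OF S(4) \<beta>(1)]])
    fix u \<alpha> assume u: "u \<in> U" "\<alpha> \<in> Hom C u S'"
    note ue = Comp_Hom[OF u(2) S(4)]
    have "d \<cdot> (\<beta> \<cdot> (e \<cdot> \<alpha>)) = Zero C u c"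
      using Comp_assoc[OF ue \<beta>(1) d] \<beta>(2) Zero_Comp[OF ue] HomD[OF d] by simp
    then show "\<exists>h \<in> Hom C u a. g \<cdot> h = (\<beta> \<cdot> e) \<cdot> \<alpha>"
      using atD(2)[OF u(1) Comp_Hom[OF ue \<beta>(1)]] Comp_assoc[OF u(2) S(4) \<beta>(1)] by simp
  qed
  then obtain h where h: "h \<in> Hom C S' a" "g \<cdot> h = \<beta> \<cdot> e" by blast
  have "g \<cdot> (h \<cdot> f) = Zero C S y"
    using Comp_assoc[OF S(3) h(1) g] h(2) Comp_assoc[OF S(3,4) \<beta>(1)] eD(2) cod Comp_Zero[OF \<beta>(1)] HomD[OF S(3)] by simp
  then have "h \<cdot> f = Zero C S a" using inj[OF _ Comp_Hom[OF S(3) h(1)]] Sum_of_Pres S(1) by blast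
  then obtain l where l: "l \<in> Hom C b a" "l \<cdot> e = h" using eD(4)[OF h(1)] cod by blast
  have "g \<cdot> l = \<beta>"
    using epi_arrD[OF eD(3) S(4) Comp_Hom[OF l(1) g] \<beta>(1)] Comp_assoc[OF S(4) l(1) g] l(2) h(2) by simp
  then show "\<exists>\<alpha> \<in> Hom C b a. g \<cdot> \<alpha> = \<beta>" using l(1) by blast
qed

section \<open>The canonical morphism and the trace\<close>

lemma can_mor:
  assumes a: "a \<in> Obj C"
  shows "can_mor C U a \<in> Hom C (Dom C (can_mor C U a)) a" "Dom C (can_mor C U a) \<in> Sum_of \<kappa> C U"
    "u \<in> U \<Longrightarrow> \<alpha> \<in> Hom C u a \<Longrightarrow> \<exists>\<beta> \<in> Hom C u (Dom C (can_mor C U a)). can_mor C U a \<cdot> \<beta> = \<alpha>"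
proof -
  let ?I = "SIGMA u:U. Hom C u a"
  have I: "small \<kappa> ?I" using small_Sigma[OF \<kappa> small_U small_Hom[OF _ a]] .
  have F: "fst \<in> ?I \<rightarrow> U" by auto
  obtain x \<iota> where x: "is_coproduct C ?I fst x \<iota>" using small_coproduct[OF I F] .
  have "snd i \<in> Hom C (fst i) a" if "i \<in> ?I" for i using that by auto
  then obtain e where e: "e \<in> Hom C x a" "\<And>i. i \<in> ?I \<Longrightarrow> e \<cdot> \<iota> i = snd i"
    using coproduct_hom_ex[OF x a] by metis
  have "is_can_mor C U a e"
    unfolding is_can_mor_def using e x HomD[OF e(1)] by auto
  then have can: "is_can_mor C U a (can_mor C U a)" unfolding can_mor_def by (rule someI)
  \<comment> \<open>\<open>SOME\<close> may pick another representative than \<open>e\<close>, so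
    the three claims are derived for the chosen one from \<open>is_can_mor\<close> alone.\<close>
  let ?e = "can_mor C U a"
  obtain \<iota>' where c: "is_coproduct C ?I fst (Dom C ?e) \<iota>'"
    and \<iota>': "\<And>u \<alpha>. u \<in> U \<Longrightarrow> \<alpha> \<in> Hom C u a \<Longrightarrow> ?e \<cdot> \<iota>' (u, \<alpha>) = \<alpha>"
    using can unfolding is_can_mor_def by blast
  show "?e \<in> Hom C (Dom C ?e) a" using can unfolding is_can_mor_def Hom_def by simp
  show "Dom C ?e \<in> Sum_of \<kappa> C U" using Sum_ofI[OF c I F] .
  show "\<exists>\<beta> \<in> Hom C u (Dom C ?e). ?e \<cdot> \<beta> = \<alpha>" if "u \<in> U" "\<alpha> \<in> Hom C u a" for u \<alpha>
  proof -
    have "\<iota>' (u, \<alpha>) \<in> Hom C u (Dom C ?e)" using c that unfolding is_coproduct_def by force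
    then show ?thesis using \<iota>'[OF that] by blast
  qed
qed

text \<open>Existence of the trace, with the image of the canonical morphism as witness. If
  \<open>r\<close> covers a generated subobject \<open>s\<close>, then \<open>s \<cdot> r\<close>
  lifts through \<open>can_mor\<close>, so the cokernel of \<open>can_mor\<close> kills it;
  cancelling the epi \<open>r\<close> places \<open>s\<close> inside the image.\<close>

lemma is_trace_tr:
  assumes a: "a \<in> Obj C"
  shows "is_trace \<kappa> C U a (tr \<kappa> C U a)"
proof -
  let ?e = "can_mor C U a"
  note eH = can_mor[OF a]
  let ?t = "Img C ?e"
  note tH = Img_arr[OF eH(1)]
  note CD = cokernelD[OF Coker_cokernel[OF eH(1)] eH(1)]
  note tD = kernelD[OF Img_kernel[OF eH(1)] CD(1)]
  obtain p where p: "p \<in> Hom C (Dom C ?e) (Dom C ?t)" "epi_arr C p"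
    using image_factorization[OF eH(1)] by metis
  have "is_trace \<kappa> C U a ?t"
    unfolding is_trace_def
  proof (intro conjI allI impI)
    show "mono_arr C ?t" "Cod C ?t = a" using tH HomD by auto
    show "generated \<kappa> C U (Dom C ?t)"
      unfolding generated_def using p eH(2) HomD[OF p(1)] by (intro exI[of _ p]) simp
    fix s assume s: "mono_arr C s \<and> Cod C s = a \<and> generated \<kappa> C U (Dom C s)"
    then have sH: "s \<in> Hom C (Dom C s) a" by (auto simp: mono_arr_def Hom_def)
    obtain r where r: "epi_arr C r" "Dom C r \<in> Sum_of \<kappa> C U" "Cod C r = Dom C s"
      using s unfolding generated_def by blast
    have rH: "r \<in> Hom C (Dom C r) (Dom C s)" using r by (auto simp: epi_arr_def Hom_def)
    have "\<exists>h \<in> Hom C (Dom C r) (Dom C ?e). ?e \<cdot> h = s \<cdot> r"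
    proof (rule Sum_of_lift[OF r(2) eH(1) Comp_Hom[OF rH sH]])
      fix u \<alpha> assume "u \<in> U" "\<alpha> \<in> Hom C u (Dom C r)"
      then show "\<exists>h \<in> Hom C u (Dom C ?e). ?e \<cdot> h = (s \<cdot> r) \<cdot> \<alpha>"
        using eH(3) Comp_Hom[OF _ Comp_Hom[OF rH sH]] by blast
    qed
    then obtain h where h: "h \<in> Hom C (Dom C r) (Dom C ?e)" "?e \<cdot> h = s \<cdot> r" by blast
    have "(Coker C ?e \<cdot> s) \<cdot> r = Zero C (Dom C r) (Cod C (Coker C ?e))"
      using Comp_assoc[OF rH sH CD(1)] h(2) Comp_assoc[OF h(1) eH(1) CD(1)] CD(2)
        Zero_Comp[OF h(1)] HomD[OF CD(1)] by simp
    then have "Coker C ?e \<cdot> s = Zero C (Dom C s) (Cod C (Coker C ?e))"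
      using epi_arr_ZeroD[OF r(1) rH Comp_Hom[OF sH CD(1)]] by blast
    then show "\<exists>h \<in> Hom C (Dom C s) (Dom C ?t). ?t \<cdot> h = s" using tD(4)[OF sH] by blast
  qed
  then show ?thesis unfolding tr_def by (rule someI)
qed

lemma tr_arr:
  assumes "a \<in> Obj C"
  shows "tr \<kappa> C U a \<in> Hom C (Dom C (tr \<kappa> C U a)) a" "mono_arr C (tr \<kappa> C U a)"
  using is_trace_tr[OF assms] by (auto simp: is_trace_def mono_arr_def Hom_def)

lemma tr_generated:
  assumes "a \<in> Obj C"
  obtains S e where "S \<in> Sum_of \<kappa> C U" "e \<in> Hom C S (Dom C (tr \<kappa> C U a))" "epi_arr C e"
proof -
  obtain e where e: "epi_arr C e" "Dom C e \<in> Sum_of \<kappa> C U" "Cod C e = Dom C (tr \<kappa> C U a)"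
    using is_trace_tr[OF assms] unfolding is_trace_def generated_def by blast
  then have "e \<in> Hom C (Dom C e) (Dom C (tr \<kappa> C U a))" by (auto simp: epi_arr_def Hom_def)
  then show ?thesis using that e by blast
qed

text \<open>The image of \<open>\<alpha>\<close> is a quotient of \<open>u\<close>, hence a
  generated subobject, hence contained in the trace.\<close>

lemma tr_lift:
  assumes a: "a \<in> Obj C" and u: "u \<in> U" and \<alpha>: "\<alpha> \<in> Hom C u a"
  shows "\<exists>h \<in> Hom C u (Dom C (tr \<kappa> C U a)). tr \<kappa> C U a \<cdot> h = \<alpha>"
proof -
  note iH = Img_arr[OF \<alpha>]
  obtain e where e: "e \<in> Hom C u (Dom C (Img C \<alpha>))" "epi_arr C e" "Img C \<alpha> \<cdot> e = \<alpha>"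
    using image_factorization[OF \<alpha>] by metis
  have "generated \<kappa> C U (Dom C (Img C \<alpha>))"
    unfolding generated_def using e U_Sum_of[OF u] HomD[OF e(1)] by (intro exI[of _ e]) simp
  then obtain h where h: "h \<in> Hom C (Dom C (Img C \<alpha>)) (Dom C (tr \<kappa> C U a))" "tr \<kappa> C U a \<cdot> h = Img C \<alpha>"
    using is_trace_tr[OF a] iH HomD[OF iH(1)] unfolding is_trace_def by blast
  have "tr \<kappa> C U a \<cdot> (h \<cdot> e) = \<alpha>" using Comp_assoc[OF e(1) h(1) tr_arr(1)[OF a]] h(2) e(3) by simp
  then show ?thesis using Comp_Hom[OF e(1) h(1)] by blast
qed

section \<open>The quotient by the trace of the kernel\<close>

abbreviation "qtk f \<equiv> quot_tr_ker \<kappa> C U f"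

text \<open>The induced morphism \<open>B / tr (Ker f) \<rightarrow> B'\<close>, which unlike \<open>fbar\<close> does not corestrict to the image.\<close>

definition induced :: "'m \<Rightarrow> 'm" where
  "induced f = Img C f \<cdot> fbar \<kappa> C U f"

text \<open>Composing the inclusion of the trace with an epi from \<open>Sum(\<U>)\<close> leaves
  the cokernel unchanged. Its source is then of a kind to which \<open>qtk_kills\<close> and the
  closure properties apply.\<close>

lemma qtk_cokernel:
  assumes f: "f \<in> Hom C a b"
  obtains S s where "S \<in> Sum_of \<kappa> C U" "s \<in> Hom C S a" "f \<cdot> s = Zero C S b" "is_cokernel C s (qtk f)"
proof -
  note KD = kernelD[OF Ker_kernel[OF f] f]
  let ?K = "Dom C (Ker C f)" and ?t = "tr \<kappa> C U (Dom C (Ker C f))"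
  have K: "?K \<in> Obj C" using HomD[OF KD(1)] by simp
  note tH = tr_arr[OF K]
  note kt = Comp_Hom[OF tH(1) KD(1)]
  have q: "is_cokernel C (Ker C f \<cdot> ?t) (qtk f)" unfolding quot_tr_ker_def using Coker_cokernel[OF kt] .
  note qD = cokernelD[OF q kt]
  obtain S e where S: "S \<in> Sum_of \<kappa> C U" "e \<in> Hom C S (Dom C ?t)" "epi_arr C e"
    using tr_generated[OF K] .
  let ?s = "(Ker C f \<cdot> ?t) \<cdot> e"
  have s: "?s \<in> Hom C S a" using Comp_Hom[OF S(2) kt] .
  have "f \<cdot> ?s = Zero C S b"
    using Comp_assoc[OF S(2) tH(1) KD(1)] Comp_assoc[OF Comp_Hom[OF S(2) tH(1)] KD(1) f] KD(2)
      Zero_Comp[OF Comp_Hom[OF S(2) tH(1)]] HomD[OF f] by simp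
  moreover have "is_cokernel C ?s (qtk f)"
  proof (rule cokernelI[OF s qD(1,3)])
    show "qtk f \<cdot> ?s = Zero C S (Cod C (qtk f))"
      using Comp_assoc[OF S(2) kt qD(1)] qD(2) Zero_Comp[OF S(2)] HomD[OF qD(1)] by simp
    fix y g assume g: "g \<in> Hom C a y" "g \<cdot> ?s = Zero C S y"
    have "g \<cdot> (Ker C f \<cdot> ?t) = Zero C (Dom C ?t) y"
      using epi_arr_ZeroD[OF S(3,2) Comp_Hom[OF kt g(1)]] Comp_assoc[OF S(2) kt g(1)] g(2) by simp
    then show "\<exists>h \<in> Hom C (Cod C (qtk f)) y. h \<cdot> qtk f = g" using qD(4)[OF g(1)] by blast
  qed
  ultimately show ?thesis using that S(1) s by blast
qed

lemma qtk_arr: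
  assumes f: "f \<in> Hom C a b"
  shows "qtk f \<in> Hom C a (Cod C (qtk f))" "epi_arr C (qtk f)"
proof -
  obtain S s where s: "s \<in> Hom C S a" "is_cokernel C s (qtk f)"
    using qtk_cokernel[OF f] by metis
  then show "qtk f \<in> Hom C a (Cod C (qtk f))" "epi_arr C (qtk f)"
    using cokernelD[OF s(2,1)] by auto
qed

text \<open>The lift of \<open>\<beta>\<close> to \<open>Ker C f\<close> lands in the trace on every
  arrow from a member of \<open>U\<close>, and \<open>U\<close> detects zero on \<open>x\<close>.
  Together with \<open>qtk_cokernel\<close> this is the means by which all later quotients are
  compared.\<close>

lemma qtk_kills:
  assumes f: "f \<in> Hom C a b" and x: "x \<in> Pres \<kappa> C U" and \<beta>: "\<beta> \<in> Hom C x a" "f \<cdot> \<beta> = Zero C x b"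
  shows "qtk f \<cdot> \<beta> = Zero C x (Cod C (qtk f))"
proof -
  note KD = kernelD[OF Ker_kernel[OF f] f]
  let ?K = "Dom C (Ker C f)" and ?t = "tr \<kappa> C U (Dom C (Ker C f))"
  have K: "?K \<in> Obj C" using HomD[OF KD(1)] by simp
  note tH = tr_arr[OF K]
  note kt = Comp_Hom[OF tH(1) KD(1)]
  have q: "is_cokernel C (Ker C f \<cdot> ?t) (qtk f)" unfolding quot_tr_ker_def using Coker_cokernel[OF kt] .
  note qD = cokernelD[OF q kt]
  obtain \<gamma> where \<gamma>: "\<gamma> \<in> Hom C x ?K" "Ker C f \<cdot> \<gamma> = \<beta>" using KD(4)[OF \<beta>] by blast
  show ?thesis
  proof (rule Pres_Zero_test[OF x Comp_Hom[OF \<beta>(1) qD(1)]])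
    fix u \<alpha> assume u: "u \<in> U" "\<alpha> \<in> Hom C u x"
    obtain h where h: "h \<in> Hom C u (Dom C ?t)" "?t \<cdot> h = \<gamma> \<cdot> \<alpha>"
      using tr_lift[OF K u(1) Comp_Hom[OF u(2) \<gamma>(1)]] by blast
    have "\<beta> \<cdot> \<alpha> = (Ker C f \<cdot> ?t) \<cdot> h"
      using Comp_assoc[OF u(2) \<gamma>(1) KD(1)] \<gamma>(2) h(2) Comp_assoc[OF h(1) tH(1) KD(1)] by simp
    then show "(qtk f \<cdot> \<beta>) \<cdot> \<alpha> = Zero C u (Cod C (qtk f))"
      using Comp_assoc[OF u(2) \<beta>(1) qD(1)] Comp_assoc[OF h(1) kt qD(1)] qD(2) Zero_Comp[OF h(1)] HomD[OF qD(1)] by simp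
  qed
qed

text \<open>Justifies the \<open>THE\<close> in the definition: the epi onto the image kills the
  trace because \<open>Img C f\<close> is mono, which gives existence; \<open>Img C f\<close> mono
  and \<open>qtk f\<close> epi give uniqueness.\<close>

lemma fbar:
  assumes f: "f \<in> Hom C a b"
  shows "fbar \<kappa> C U f \<in> Hom C (Cod C (qtk f)) (Dom C (Img C f))" "Img C f \<cdot> (fbar \<kappa> C U f \<cdot> qtk f) = f"
proof -
  note iH = Img_arr[OF f] and qH = qtk_arr[OF f]
  obtain e where e: "e \<in> Hom C a (Dom C (Img C f))" "Img C f \<cdot> e = f"
    using image_factorization[OF f] by metis
  obtain S s where s: "s \<in> Hom C S a" "f \<cdot> s = Zero C S b" "is_cokernel C s (qtk f)"
    using qtk_cokernel[OF f] by metis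
  have "e \<cdot> s = Zero C S (Dom C (Img C f))"
    using mono_arr_ZeroD[OF iH(2,1) Comp_Hom[OF s(1) e(1)]] Comp_assoc[OF s(1) e(1) iH(1)] e(2) s(2) by simp
  then obtain h where h: "h \<in> Hom C (Cod C (qtk f)) (Dom C (Img C f))" "h \<cdot> qtk f = e"
    using cokernelD(4)[OF s(3,1) e(1)] by blast
  have "\<exists>!h. h \<in> Hom C (Cod C (qtk f)) (Dom C (Img C f)) \<and> Img C f \<cdot> (h \<cdot> qtk f) = f"
  proof (rule ex1I[of _ h])
    show "h \<in> Hom C (Cod C (qtk f)) (Dom C (Img C f)) \<and> Img C f \<cdot> (h \<cdot> qtk f) = f" using h e(2) by simp
    fix h' assume h': "h' \<in> Hom C (Cod C (qtk f)) (Dom C (Img C f)) \<and> Img C f \<cdot> (h' \<cdot> qtk f) = f"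
    then have "h' \<cdot> qtk f = h \<cdot> qtk f"
      using mono_arrD[OF iH(2,1) Comp_Hom[OF qH(1)] Comp_Hom[OF qH(1) h(1)]] h(2) e(2) by simp
    then show "h' = h" using epi_arrD[OF qH(2,1) _ h(1)] h' by blast
  qed
  from theI'[OF this] show "fbar \<kappa> C U f \<in> Hom C (Cod C (qtk f)) (Dom C (Img C f))"
    "Img C f \<cdot> (fbar \<kappa> C U f \<cdot> qtk f) = f"
    unfolding fbar_def by auto
qed

lemma induced:
  assumes f: "f \<in> Hom C a b"
  shows "induced f \<in> Hom C (Cod C (qtk f)) b" "induced f \<cdot> qtk f = f"
    "Coker C f \<cdot> induced f = Zero C (Cod C (qtk f)) (Cod C (Coker C f))"
proof -
  note iH = Img_arr[OF f] and qH = qtk_arr[OF f] and fH = fbar[OF f]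
  note CD = cokernelD[OF Coker_cokernel[OF f] f]
  show i: "induced f \<in> Hom C (Cod C (qtk f)) b" unfolding induced_def using Comp_Hom[OF fH(1) iH(1)] .
  show iq: "induced f \<cdot> qtk f = f"
    unfolding induced_def using Comp_assoc[OF qH(1) fH(1) iH(1)] fH(2) by simp
  show "Coker C f \<cdot> induced f = Zero C (Cod C (qtk f)) (Cod C (Coker C f))"
    using epi_arr_ZeroD[OF qH(2,1) Comp_Hom[OF i CD(1)]] Comp_assoc[OF qH(1) i CD(1)] iq CD(2) by simp
qed

text \<open>\<open>Img C f\<close> is a kernel of \<open>Coker C f\<close>, so arrows into the image
  are the same as arrows into \<open>b\<close> killed by the cokernel.\<close>

lemma bij_fbar_iff:
  assumes f: "f \<in> Hom C a b" and x: "x \<in> Obj C"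
  shows "bij_betw (\<lambda>\<alpha>. fbar \<kappa> C U f \<cdot> \<alpha>) (Hom C x (Cod C (qtk f))) (Hom C x (Dom C (Img C f))) \<longleftrightarrow>
    kernel_at C x (Coker C f) (induced f)"
proof -
  note iH = Img_arr[OF f] and fH = fbar[OF f] and ind = induced[OF f]
  note CD = cokernelD[OF Coker_cokernel[OF f] f]
  note iD = kernelD[OF Img_kernel[OF f] CD(1)]
  let ?i = "Img C f"
  have io: "Dom C ?i \<in> Obj C" using HomD[OF iH(1)] by simp
  note z = Zero_Hom[OF io io]
  have "kernel_at C x (Zero C (Dom C ?i) (Dom C ?i)) (fbar \<kappa> C U f) \<longleftrightarrow> kernel_at C x (Coker C f) (induced f)"
  proof
    assume k: "kernel_at C x (Zero C (Dom C ?i) (Dom C ?i)) (fbar \<kappa> C U f)"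
    note kD = kernel_atD[OF k fH(1) z]
    show "kernel_at C x (Coker C f) (induced f)"
    proof (rule kernel_atI[OF ind(1) CD(1)])
      fix \<alpha> assume \<alpha>: "\<alpha> \<in> Hom C x (Cod C (qtk f))" "induced f \<cdot> \<alpha> = Zero C x b"
      have "fbar \<kappa> C U f \<cdot> \<alpha> = Zero C x (Dom C ?i)"
        using mono_arr_ZeroD[OF iH(2,1) Comp_Hom[OF \<alpha>(1) fH(1)]] Comp_assoc[OF \<alpha>(1) fH(1) iH(1)] \<alpha>(2)
        by (simp add: induced_def)
      then show "\<alpha> = Zero C x (Cod C (qtk f))" using kD(1)[OF \<alpha>(1)] by blast
    next
      fix \<beta> assume \<beta>: "\<beta> \<in> Hom C x b" "Coker C f \<cdot> \<beta> = Zero C x (Cod C (Coker C f))"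
      obtain \<gamma> where \<gamma>: "\<gamma> \<in> Hom C x (Dom C ?i)" "?i \<cdot> \<gamma> = \<beta>" using iD(4)[OF \<beta>] by blast
      obtain \<alpha> where \<alpha>: "\<alpha> \<in> Hom C x (Cod C (qtk f))" "fbar \<kappa> C U f \<cdot> \<alpha> = \<gamma>"
        using kD(2)[OF \<gamma>(1) Zero_Comp[OF \<gamma>(1) io]] by blast
      then show "\<exists>\<alpha> \<in> Hom C x (Cod C (qtk f)). induced f \<cdot> \<alpha> = \<beta>"
        using Comp_assoc[OF \<alpha>(1) fH(1) iH(1)] \<gamma>(2) by (intro bexI[of _ \<alpha>]) (auto simp: induced_def)
    qed
  next
    assume k: "kernel_at C x (Coker C f) (induced f)"
    note kD = kernel_atD[OF k ind(1) CD(1)]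
    show "kernel_at C x (Zero C (Dom C ?i) (Dom C ?i)) (fbar \<kappa> C U f)"
    proof (rule kernel_atI[OF fH(1) z])
      fix \<alpha> assume \<alpha>: "\<alpha> \<in> Hom C x (Cod C (qtk f))" "fbar \<kappa> C U f \<cdot> \<alpha> = Zero C x (Dom C ?i)"
      have "induced f \<cdot> \<alpha> = Zero C x b"
        unfolding induced_def using Comp_eq_ZeroI[OF \<alpha>(1) fH(1) iH(1) \<alpha>(2)] .
      then show "\<alpha> = Zero C x (Cod C (qtk f))" using kD(1)[OF \<alpha>(1)] by blast
    next
      fix \<beta> assume \<beta>: "\<beta> \<in> Hom C x (Dom C ?i)"
      note i\<beta> = Comp_Hom[OF \<beta> iH(1)]
      have "Coker C f \<cdot> (?i \<cdot> \<beta>) = Zero C x (Cod C (Coker C f))"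
        using Comp_assoc[OF \<beta> iH(1) CD(1)] iD(2) Zero_Comp[OF \<beta>] HomD[OF CD(1)] by simp
      then obtain \<alpha> where \<alpha>: "\<alpha> \<in> Hom C x (Cod C (qtk f))" "induced f \<cdot> \<alpha> = ?i \<cdot> \<beta>"
        using kD(2)[OF i\<beta>] by blast
      have "fbar \<kappa> C U f \<cdot> \<alpha> = \<beta>"
        using mono_arrD[OF iH(2,1) Comp_Hom[OF \<alpha>(1) fH(1)] \<beta>] Comp_assoc[OF \<alpha>(1) fH(1) iH(1)] \<alpha>(2)
        by (simp add: induced_def)
      then show "\<exists>\<alpha> \<in> Hom C x (Cod C (qtk f)). fbar \<kappa> C U f \<cdot> \<alpha> = \<beta>" using \<alpha>(1) by blast
    qed
  qed
  then show ?thesis using kernel_at_Zero_iff[OF fH(1) x] by simp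
qed


section \<open>The implications\<close>

abbreviation "B \<equiv> Pres \<kappa> C U"

section \<open>Membership in \<open>Pres\<close>, coreflections, and closure under cokernels\<close>

lemma closed_under_cokernelsD:
  assumes "closed_under_cokernels C X" "is_cokernel C f c" "f \<in> Hom C a b" "a \<in> X" "b \<in> X"
  shows "Cod C c \<in> X"
  using assms(1,2,4,5) HomD(1-3)[OF assms(3)] unfolding closed_under_cokernels_def by simp

lemma qtk_Pres:
  assumes f: "f \<in> Hom C a b" and a: "a \<in> B" and closed: "closed_under_cokernels C B"
  shows "Cod C (qtk f) \<in> B"
proof -
  obtain S s where S: "S \<in> Sum_of \<kappa> C U" "s \<in> Hom C S a" "is_cokernel C s (qtk f)"
    using qtk_cokernel[OF f] by metis
  then show ?thesis
    using closed_under_cokernelsD[OF closed S(3,2) _ a] Sum_of_Pres by blast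
qed

text \<open>Here \<open>qtk_cokernel\<close> is already a presentation. Through this the canonical
  quotient can serve as a coreflection before closure under cokernels is established.\<close>

lemma qtk_Sum_of_Pres:
  assumes f: "f \<in> Hom C a b" and a: "a \<in> Sum_of \<kappa> C U"
  shows "Cod C (qtk f) \<in> B"
proof -
  obtain S s where S: "S \<in> Sum_of \<kappa> C U" "s \<in> Hom C S a" "is_cokernel C s (qtk f)"
    using qtk_cokernel[OF f] by metis
  then show ?thesis using Pres_cokernel a by blast
qed

lemma is_coreflectionI:
  assumes g: "g \<in> Hom C a b" and a: "a \<in> B"
    and at: "\<And>u. u \<in> U \<Longrightarrow> bij_betw (\<lambda>\<alpha>. g \<cdot> \<alpha>) (Hom C u a) (Hom C u b)"
  shows "is_coreflection C B b g"
proof -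
  have o: "b \<in> Obj C" using HomD[OF g] by simp
  have "kernel_at C u (Zero C b b) g" if "u \<in> U" for u
    using at[OF that] kernel_at_Zero_iff[OF g] U_Obj that by blast
  from kernel_at_Pres[OF g Zero_Hom[OF o o] this]
  have "kernel_at C x (Zero C b b) g" if "x \<in> B" for x using that by blast
  then have "bij_betw (\<lambda>\<alpha>. g \<cdot> \<alpha>) (Hom C x a) (Hom C x b)" if "x \<in> B" for x
    using kernel_at_Zero_iff[OF g] that Pres_Obj by blast
  then show ?thesis unfolding is_coreflection_def using HomD[OF g] a by simp
qed

lemma coreflection_section_mem:
  assumes p: "is_coreflection C B a p" and s: "s \<in> Hom C a (Dom C p)" "p \<cdot> s = Ident C a"
  shows "a \<in> B"
proof -
  have "iso_arr C p" using coreflection_section_iso[OF p s] .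
  then obtain g where "g \<in> Hom C a (Dom C p)" "iso_arr C g"
    using iso_arrE[OF _ coreflectionD(1)[OF p]] by metis
  then show ?thesis using Pres_isomorphic[OF coreflectionD(2)[OF p]] by blast
qed

text \<open>The cokernel map lifts through the coreflection \<open>p\<close> of its target. By
  uniqueness of lifts the lift kills \<open>f\<close>, so it descends to a section of
  \<open>p\<close>, and \<open>p\<close> is invertible.\<close>

lemma coreflective_closed_under_cokernels:
  assumes "coreflective C B"
  shows "closed_under_cokernels C B"
  unfolding closed_under_cokernels_def
proof (intro ballI impI allI)
  fix f c assume f0: "f \<in> Arr C" and fB: "Dom C f \<in> B \<and> Cod C f \<in> B" and c: "is_cokernel C f c"
  have f: "f \<in> Hom C (Dom C f) (Cod C f)" using Arr_Hom[OF f0] .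
  note cD = cokernelD[OF c f]
  obtain p where p: "is_coreflection C B (Cod C c) p"
    using assms coreflective_iff[OF Pres_Obj] HomD(5)[OF cD(1)] by blast
  note pD = coreflectionD[OF p]
  have o: "Dom C f \<in> Obj C" "Dom C p \<in> Obj C" using HomD[OF f] HomD[OF pD(1)] by auto
  obtain c' where c': "c' \<in> Hom C (Cod C f) (Dom C p)" "p \<cdot> c' = c" using pD(3)[OF _ cD(1)] fB by blast
  have "p \<cdot> (c' \<cdot> f) = p \<cdot> Zero C (Dom C f) (Dom C p)"
    using Comp_assoc[OF f c'(1) pD(1)] c'(2) cD(2) Comp_Zero[OF pD(1) o(1)] by simp
  then have "c' \<cdot> f = Zero C (Dom C f) (Dom C p)"
    using pD(4)[OF _ Comp_Hom[OF f c'(1)] Zero_Hom[OF o]] fB by blast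
  then obtain s where s: "s \<in> Hom C (Cod C c) (Dom C p)" "s \<cdot> c = c'" using cD(4)[OF c'(1)] by blast
  have "(p \<cdot> s) \<cdot> c = Ident C (Cod C c) \<cdot> c"
    using Comp_assoc[OF cD(1) s(1) pD(1)] s(2) c'(2) Ident_Comp_Hom[OF cD(1)] by simp
  then have "p \<cdot> s = Ident C (Cod C c)"
    using epi_arrD[OF cD(3,1) Comp_Hom[OF s(1) pD(1)] Ident_Hom] HomD[OF s(1)] by blast
  then show "Cod C c \<in> B" using coreflection_section_mem[OF p s(1)] by blast
qed

lemma kernel_at_imp_coreflection:
  assumes closed: "closed_under_cokernels C B" and f: "f \<in> Hom C a b" and a: "a \<in> B"
    and at: "\<And>u. u \<in> U \<Longrightarrow> kernel_at C u (Coker C f) (induced f)"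
  shows "is_coreflection C B (Dom C (Img C f)) (fbar \<kappa> C U f)"
  using is_coreflectionI[OF fbar(1)[OF f] qtk_Pres[OF f a closed]] bij_fbar_iff[OF f] at U_Obj by blast

section \<open>The canonical morphism: condition (4a) and the explicit coreflections\<close>

lemma induced_can_mor_inj:
  assumes closed: "closed_under_cokernels C B"
    and at: "\<And>f a b u. f \<in> Hom C a b \<Longrightarrow> a \<in> B \<Longrightarrow> b \<in> B \<Longrightarrow> u \<in> U \<Longrightarrow> kernel_at C u (Coker C f) (induced f)"
    and x: "x \<in> Obj C" and u: "u \<in> U"
    and \<alpha>: "\<alpha> \<in> Hom C u (Cod C (qtk (can_mor C U x)))" "induced (can_mor C U x) \<cdot> \<alpha> = Zero C u x"
  shows "\<alpha> = Zero C u (Cod C (qtk (can_mor C U x)))"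
proof -
  let ?e = "can_mor C U x"
  let ?q = "qtk ?e" and ?p = "induced ?e"
  note eH = can_mor[OF x]
  note qH = qtk_arr[OF eH(1)] and pH = induced[OF eH(1)]
  have Q: "Cod C ?q \<in> B" using qtk_Sum_of_Pres[OF eH(1,2)] .
  define c where "c = Coker C \<alpha>"
  have c: "is_cokernel C \<alpha> c" unfolding c_def using Coker_cokernel[OF \<alpha>(1)] .
  note cD = cokernelD[OF c \<alpha>(1)]
  have cB: "Cod C c \<in> B"
    using closed_under_cokernelsD[OF closed c \<alpha>(1) U_Pres[OF u] Q] .
  obtain p2 where p2: "p2 \<in> Hom C (Cod C c) x" "p2 \<cdot> c = ?p" using cD(4)[OF pH(1) \<alpha>(2)] by blast
  define g where "g = c \<cdot> ?q"
  have g: "g \<in> Hom C (Dom C ?e) (Cod C c)" unfolding g_def using Comp_Hom[OF qH(1) cD(1)] .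
  let ?q' = "qtk g"
  note qH' = qtk_arr[OF g] and ind = induced[OF g]
  obtain S s where S: "S \<in> Sum_of \<kappa> C U" "s \<in> Hom C S (Dom C ?e)" "?e \<cdot> s = Zero C S x" "is_cokernel C s ?q"
    using qtk_cokernel[OF eH(1)] .
  obtain S' s' where S': "S' \<in> Sum_of \<kappa> C U" "s' \<in> Hom C S' (Dom C ?e)" "g \<cdot> s' = Zero C S' (Cod C c)" "is_cokernel C s' ?q'"
    using qtk_cokernel[OF g] .
  note qD = cokernelD[OF S(4,2)] and qD' = cokernelD[OF S'(4,2)]
  \<comment> \<open>Since \<open>?e = p2 \<cdot> g\<close>, what \<open>g\<close> kills is killed by
    \<open>?e\<close>; conversely \<open>?q\<close> kills \<open>s\<close>, hence so does
    \<open>g\<close>. Each of the two quotient maps therefore factors through the other.\<close>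
  have "?e \<cdot> s' = (p2 \<cdot> g) \<cdot> s'"
    using pH(2) p2(2) Comp_assoc[OF qH(1) cD(1) p2(1)] by (simp add: g_def)
  also have "\<dots> = Zero C S' x" using Comp_eq_ZeroI[OF S'(2) g p2(1) S'(3)] .
  finally have "?q \<cdot> s' = Zero C S' (Cod C ?q)" using qtk_kills[OF eH(1) _ S'(2)] S'(1) Sum_of_Pres by blast
  then obtain h where h: "h \<in> Hom C (Cod C ?q') (Cod C ?q)" "h \<cdot> ?q' = ?q" using qD'(4)[OF qH(1)] by blast
  have "g \<cdot> s = Zero C S (Cod C c)" unfolding g_def using Comp_eq_ZeroI[OF S(2) qH(1) cD(1) qD(2)] .
  then have "?q' \<cdot> s = Zero C S (Cod C ?q')" using qtk_kills[OF g _ S(2)] S(1) Sum_of_Pres by blast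
  then obtain h' where h': "h' \<in> Hom C (Cod C ?q) (Cod C ?q')" "h' \<cdot> ?q = ?q'" using qD(4)[OF qH'(1)] by blast
  have "(h \<cdot> h') \<cdot> ?q = Ident C (Cod C ?q) \<cdot> ?q"
    using Comp_assoc[OF qH(1) h'(1) h(1)] h'(2) h(2) Ident_Comp_Hom[OF qH(1)] by simp
  then have hh': "h \<cdot> h' = Ident C (Cod C ?q)"
    using epi_arrD[OF qH(2,1) Comp_Hom[OF h'(1) h(1)] Ident_Hom] HomD[OF h(1)] by blast
  have "induced g \<cdot> ?q' = (c \<cdot> h) \<cdot> ?q'"
    using ind(2) Comp_assoc[OF qH'(1) h(1) cD(1)] h(2) by (simp add: g_def)
  then have ig: "induced g = c \<cdot> h" using epi_arrD[OF qH'(2,1) ind(1) Comp_Hom[OF h(1) cD(1)]] by blast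
  note h\<alpha> = Comp_Hom[OF \<alpha>(1) h'(1)]
  have lift_\<alpha>: "h \<cdot> (h' \<cdot> \<alpha>) = \<alpha>" using cancel_left_inverse[OF h'(1) h(1) hh' \<alpha>(1)] .
  have "induced g \<cdot> (h' \<cdot> \<alpha>) = Zero C u (Cod C c)"
    unfolding ig using Comp_assoc[OF h\<alpha> h(1) cD(1)] lift_\<alpha> cD(2) by simp
  moreover have "kernel_at C u (Coker C g) (induced g)" using at[OF g _ cB u] eH(2) Sum_of_Pres by blast
  ultimately have "h' \<cdot> \<alpha> = Zero C u (Cod C ?q')"
    using kernel_atD(1)[OF _ ind(1) cokernelD(1)[OF Coker_cokernel[OF g] g] h\<alpha>] by blast
  then show ?thesis using lift_\<alpha> Comp_Zero[OF h(1)] HomD(4)[OF \<alpha>(1)] by simp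
qed

text \<open>By the third isomorphism theorem, \<open>Ker f\<close> modulo its trace is the kernel of
  \<open>induced f\<close>.\<close>

lemma Hom_Ker_quotient_zero_iff:
  assumes f: "f \<in> Hom C a b" and u: "u \<in> U"
  shows "Hom C u (Cod C (Coker C (tr \<kappa> C U (Dom C (Ker C f))))) =
      {Zero C u (Cod C (Coker C (tr \<kappa> C U (Dom C (Ker C f)))))} \<longleftrightarrow>
    (\<forall>\<alpha> \<in> Hom C u (Cod C (qtk f)). induced f \<cdot> \<alpha> = Zero C u b \<longrightarrow> \<alpha> = Zero C u (Cod C (qtk f)))"
    (is "Hom C u ?R = {Zero C u ?R} \<longleftrightarrow> ?inj")
proof -
  note K = Ker_kernel[OF f]
  note KD = kernelD[OF K f]
  let ?t = "tr \<kappa> C U (Dom C (Ker C f))"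
  have Ko: "Dom C (Ker C f) \<in> Obj C" and uo: "u \<in> Obj C" using HomD[OF KD(1)] U_Obj u by auto
  note tH = tr_arr[OF Ko] and ind = induced[OF f]
  note kt = Comp_Hom[OF tH(1) KD(1)]
  have q: "is_cokernel C (Ker C f \<cdot> ?t) (qtk f)" unfolding quot_tr_ker_def using Coker_cokernel[OF kt] .
  define n where "n = Ker C (induced f)"
  have n: "is_kernel C (induced f) n" unfolding n_def using Ker_kernel[OF ind(1)] .
  note nD = kernelD[OF n ind(1)]
  obtain w where w: "w \<in> Hom C (Dom C (Ker C f)) (Dom C n)" "is_cokernel C ?t w"
    using third_isomorphism[OF f K tH q ind(1,2) n] by metis
  have cw: "Cod C w = Dom C n" using HomD[OF w(1)] by simp
  obtain h where h: "h \<in> Hom C ?R (Dom C n)" "iso_arr C h"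
    using cokernel_unique[OF tH(1) Coker_cokernel[OF tH(1)] w(2)] cw by metis
  obtain g where g: "g \<in> Hom C (Dom C n) ?R" "h \<cdot> g = Ident C (Dom C n)" using iso_arrE[OF h(2,1)] by metis
  have Ro: "?R \<in> Obj C" using HomD[OF h(1)] by simp
  show ?thesis
  proof
    assume R: "Hom C u ?R = {Zero C u ?R}"
    show ?inj
    proof (intro ballI impI)
      fix \<alpha> assume \<alpha>: "\<alpha> \<in> Hom C u (Cod C (qtk f))" "induced f \<cdot> \<alpha> = Zero C u b"
      obtain \<beta> where \<beta>: "\<beta> \<in> Hom C u (Dom C n)" "n \<cdot> \<beta> = \<alpha>" using nD(4)[OF \<alpha>] by blast
      have "g \<cdot> \<beta> = Zero C u ?R" using Comp_Hom[OF \<beta>(1) g(1)] R by blast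
      then have "\<beta> = Zero C u (Dom C n)"
        using cancel_left_inverse[OF g(1) h(1) g(2) \<beta>(1)] Comp_Zero[OF h(1) uo] by simp
      then show "\<alpha> = Zero C u (Cod C (qtk f))" using \<beta>(2) Comp_Zero[OF nD(1) uo] by simp
    qed
  next
    assume inj: ?inj
    have "\<gamma> = Zero C u ?R" if \<gamma>: "\<gamma> \<in> Hom C u ?R" for \<gamma>
    proof -
      note h\<gamma> = Comp_Hom[OF \<gamma> h(1)]
      have "induced f \<cdot> (n \<cdot> (h \<cdot> \<gamma>)) = Zero C u b"
        using Comp_assoc[OF h\<gamma> nD(1) ind(1)] nD(2) Zero_Comp[OF h\<gamma>] HomD[OF f] by simp
      then have "n \<cdot> (h \<cdot> \<gamma>) = Zero C u (Cod C (qtk f))" using inj Comp_Hom[OF h\<gamma> nD(1)] by blast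
      then have "h \<cdot> \<gamma> = Zero C u (Dom C n)" using mono_arr_ZeroD[OF nD(3,1) h\<gamma>] by blast
      then show ?thesis using mono_arr_ZeroD[OF iso_arr_mono[OF h(2)] h(1) \<gamma>] by blast
    qed
    then show "Hom C u ?R = {Zero C u ?R}" using Zero_Hom[OF uo Ro] by blast
  qed
qed

text \<open>Surjectivity comes for free, as every arrow from a member of \<open>U\<close> to
  \<open>x\<close> already lifts through \<open>can_mor C U x\<close>; only injectivity has to be
  supplied.\<close>

lemma coreflection_can_mor:
  assumes x: "x \<in> Obj C"
    and inj: "\<And>u \<alpha>. u \<in> U \<Longrightarrow> \<alpha> \<in> Hom C u (Cod C (qtk (can_mor C U x))) \<Longrightarrow>
      induced (can_mor C U x) \<cdot> \<alpha> = Zero C u x \<Longrightarrow> \<alpha> = Zero C u (Cod C (qtk (can_mor C U x)))"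
  shows "is_coreflection C B x (induced (can_mor C U x))"
proof -
  let ?e = "can_mor C U x"
  note eH = can_mor[OF x]
  note qH = qtk_arr[OF eH(1)] and pH = induced[OF eH(1)]
  show ?thesis
  proof (rule is_coreflectionI[OF pH(1) qtk_Sum_of_Pres[OF eH(1,2)]])
    fix u assume u: "u \<in> U"
    have uo: "u \<in> Obj C" using u U_Obj by blast
    have "kernel_at C u (Zero C x x) (induced ?e)"
    proof (rule kernel_atI[OF pH(1) Zero_Hom[OF x x]])
      fix \<beta> assume "\<beta> \<in> Hom C u x"
      then obtain \<gamma> where \<gamma>: "\<gamma> \<in> Hom C u (Dom C ?e)" "?e \<cdot> \<gamma> = \<beta>" using eH(3)[OF u] by blast
      have "induced ?e \<cdot> (qtk ?e \<cdot> \<gamma>) = \<beta>" using Comp_assoc[OF \<gamma>(1) qH(1) pH(1)] pH(2) \<gamma>(2) by simp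
      then show "\<exists>\<alpha> \<in> Hom C u (Cod C (qtk ?e)). induced ?e \<cdot> \<alpha> = \<beta>" using Comp_Hom[OF \<gamma>(1) qH(1)] by blast
    qed (rule inj[OF u])
    then show "bij_betw (\<lambda>\<alpha>. induced ?e \<cdot> \<alpha>) (Hom C u (Cod C (qtk ?e))) (Hom C u x)"
      using kernel_at_Zero_iff[OF pH(1) uo] by blast
  qed
qed

text \<open>
  For a presentation \<open>e : S \<rightarrow> a\<close> the quotients of \<open>S\<close> and \<open>a\<close> by the traces of \<open>Ker (f \<cdot> e)\<close> and
  \<open>Ker f\<close> agree: injectivity on \<open>C(u, -)\<close> for \<open>f \<cdot> e\<close> forces every \<open>u \<rightarrow> Ker f\<close> to vanish in the former.
\<close>

lemma kernel_at_from_Sum_of: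
  assumes at: "\<And>S g u. S \<in> Sum_of \<kappa> C U \<Longrightarrow> g \<in> Hom C S b \<Longrightarrow> u \<in> U \<Longrightarrow> kernel_at C u (Coker C g) (induced g)"
    and f: "f \<in> Hom C a b" and a: "a \<in> B" and u: "u \<in> U"
  shows "kernel_at C u (Coker C f) (induced f)"
proof -
  obtain S1 S l e where S: "S1 \<in> Sum_of \<kappa> C U" "S \<in> Sum_of \<kappa> C U" and l: "l \<in> Hom C S1 S"
    and e: "e \<in> Hom C S a" "is_cokernel C l e"
    using Pres_presentation[OF a] .
  note eD = cokernelD[OF e(2) l]
  have ce: "Cod C e = a" using HomD[OF e(1)] by simp
  define g where "g = f \<cdot> e"
  have g: "g \<in> Hom C S b" unfolding g_def using Comp_Hom[OF e(1) f] .
  note atg = at[OF S(2) g]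
  note CgD = cokernelD[OF Coker_cokernel[OF g] g] and CfD = cokernelD[OF Coker_cokernel[OF f] f]
  let ?qf = "qtk f" and ?qg = "qtk g" and ?if = "induced f" and ?ig = "induced g"
  note qf = qtk_arr[OF f] and qg = qtk_arr[OF g] and If = induced[OF f] and Ig = induced[OF g]
  have ao: "a \<in> Obj C" and bo: "b \<in> Obj C" using HomD[OF f] by auto
  \<comment> \<open>The relations \<open>l\<close> of the presentation start in
    \<open>Sum(\<U>)\<close> and are killed by \<open>g\<close>, so \<open>?qg\<close> descends to a
    map \<open>r\<close> on \<open>a\<close>.\<close>
  have "g \<cdot> l = Zero C S1 b"
    unfolding g_def using Comp_eq_ZeroI[OF l e(1) f] eD(2) ce by simp
  then have "?qg \<cdot> l = Zero C S1 (Cod C ?qg)" using qtk_kills[OF g _ l] S(1) Sum_of_Pres by blast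
  then obtain r where r: "r \<in> Hom C a (Cod C ?qg)" "r \<cdot> e = ?qg" using eD(4)[OF qg(1)] ce by blast
  have "(?ig \<cdot> r) \<cdot> e = f \<cdot> e" using Comp_assoc[OF e(1) r(1) Ig(1)] r(2) Ig(2) by (simp add: g_def)
  then have igr: "?ig \<cdot> r = f" using epi_arrD[OF eD(3) e(1) Comp_Hom[OF r(1) Ig(1)] f] by blast
  obtain S' s where S': "S' \<in> Sum_of \<kappa> C U" and s: "s \<in> Hom C S' a" "f \<cdot> s = Zero C S' b" "is_cokernel C s ?qf"
    using qtk_cokernel[OF f] .
  have "r \<cdot> s = Zero C S' (Cod C ?qg)"
  proof (rule Sum_of_Zero_test[OF S' Comp_Hom[OF s(1) r(1)]])
    fix u \<alpha> assume u: "u \<in> U" "\<alpha> \<in> Hom C u S'"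
    note s\<alpha> = Comp_Hom[OF u(2) s(1)]
    have "?ig \<cdot> (r \<cdot> (s \<cdot> \<alpha>)) = Zero C u b"
      using Comp_assoc[OF s\<alpha> r(1) Ig(1)] igr Comp_assoc[OF u(2) s(1) f] s(2) Zero_Comp[OF u(2) bo] by simp
    then have "r \<cdot> (s \<cdot> \<alpha>) = Zero C u (Cod C ?qg)"
      using kernel_atD(1)[OF atg[OF u(1)] Ig(1) CgD(1) Comp_Hom[OF s\<alpha> r(1)]] by blast
    then show "(r \<cdot> s) \<cdot> \<alpha> = Zero C u (Cod C ?qg)" using Comp_assoc[OF u(2) s(1) r(1)] by simp
  qed
  then obtain t where t: "t \<in> Hom C (Cod C ?qf) (Cod C ?qg)" "t \<cdot> ?qf = r"
    using cokernelD(4)[OF s(3,1) r(1)] by blast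
  obtain S'' s' where S'': "S'' \<in> Sum_of \<kappa> C U"
    and s': "s' \<in> Hom C S'' S" "g \<cdot> s' = Zero C S'' b" "is_cokernel C s' ?qg"
    using qtk_cokernel[OF g] .
  note es = Comp_Hom[OF s'(1) e(1)]
  have "f \<cdot> (e \<cdot> s') = Zero C S'' b" using Comp_assoc[OF s'(1) e(1) f] s'(2) by (simp add: g_def)
  then have "?qf \<cdot> (e \<cdot> s') = Zero C S'' (Cod C ?qf)" using qtk_kills[OF f _ es] S'' Sum_of_Pres by blast
  then have "(?qf \<cdot> e) \<cdot> s' = Zero C S'' (Cod C ?qf)" using Comp_assoc[OF s'(1) e(1) qf(1)] by simp
  then obtain v where v: "v \<in> Hom C (Cod C ?qg) (Cod C ?qf)" "v \<cdot> ?qg = ?qf \<cdot> e"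
    using cokernelD(4)[OF s'(3,1) Comp_Hom[OF e(1) qf(1)]] by blast
  \<comment> \<open>\<open>v \<cdot> t\<close> is an identity, so injectivity of \<open>?ig\<close>
    passes to \<open>?if\<close> along \<open>t\<close>; solutions for \<open>?ig\<close> are
    carried to solutions for \<open>?if\<close> along \<open>v\<close>.\<close>
  have "((v \<cdot> t) \<cdot> ?qf) \<cdot> e = ?qf \<cdot> e"
    using Comp_assoc[OF qf(1) t(1) v(1)] t(2) Comp_assoc[OF e(1) r(1) v(1)] r(2) v(2) by simp
  then have "(v \<cdot> t) \<cdot> ?qf = Ident C (Cod C ?qf) \<cdot> ?qf"
    using epi_arrD[OF eD(3) e(1) Comp_Hom[OF qf(1) Comp_Hom[OF t(1) v(1)]] qf(1)] Ident_Comp_Hom[OF qf(1)] by simp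
  then have vt: "v \<cdot> t = Ident C (Cod C ?qf)"
    using epi_arrD[OF qf(2,1) Comp_Hom[OF t(1) v(1)] Ident_Hom] HomD[OF t(1)] by blast
  have "(?if \<cdot> v) \<cdot> ?qg = ?ig \<cdot> ?qg"
    using Comp_assoc[OF qg(1) v(1) If(1)] v(2) Comp_assoc[OF e(1) qf(1) If(1)] If(2) Ig(2) by (simp add: g_def)
  then have ifv: "?if \<cdot> v = ?ig" using epi_arrD[OF qg(2,1) Comp_Hom[OF v(1) If(1)] Ig(1)] by blast
  have igt: "?ig \<cdot> t = ?if"
    using ifv Comp_assoc[OF t(1) v(1) If(1)] vt Comp_Ident_Hom[OF If(1)] by simp
  note kD = kernel_atD[OF atg[OF u] Ig(1) CgD(1)]
  show ?thesis
  proof (rule kernel_atI[OF If(1) CfD(1)])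
    fix \<alpha> assume \<alpha>: "\<alpha> \<in> Hom C u (Cod C ?qf)" "?if \<cdot> \<alpha> = Zero C u b"
    have "?ig \<cdot> (t \<cdot> \<alpha>) = Zero C u b" using Comp_assoc[OF \<alpha>(1) t(1) Ig(1)] igt \<alpha>(2) by simp
    then have "t \<cdot> \<alpha> = Zero C u (Cod C ?qg)" using kD(1)[OF Comp_Hom[OF \<alpha>(1) t(1)]] by blast
    then show "\<alpha> = Zero C u (Cod C ?qf)"
      using cancel_left_inverse[OF t(1) v(1) vt \<alpha>(1)] Comp_Zero[OF v(1)] HomD[OF \<alpha>(1)] by simp
  next
    fix \<beta> assume \<beta>: "\<beta> \<in> Hom C u b" "Coker C f \<cdot> \<beta> = Zero C u (Cod C (Coker C f))"
    \<comment> \<open>Since \<open>e\<close> is epi, the cokernel of \<open>g = f \<cdot> e\<close>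
      also kills \<open>f\<close>; so an arrow killed by \<open>Coker C f\<close> is killed by
      \<open>Coker C g\<close>.\<close>
    have "(Coker C g \<cdot> f) \<cdot> e = Zero C S (Cod C (Coker C g))"
      using Comp_assoc[OF e(1) f CgD(1)] CgD(2) by (simp add: g_def)
    then have "Coker C g \<cdot> f = Zero C a (Cod C (Coker C g))"
      using epi_arr_ZeroD[OF eD(3) e(1) Comp_Hom[OF f CgD(1)]] by blast
    then obtain y where y: "y \<in> Hom C (Cod C (Coker C f)) (Cod C (Coker C g))" "y \<cdot> Coker C f = Coker C g"
      using CfD(4)[OF CgD(1)] by blast
    have "Coker C g \<cdot> \<beta> = Zero C u (Cod C (Coker C g))"
      using Comp_eq_ZeroI[OF \<beta>(1) CfD(1) y(1) \<beta>(2)] y(2) by simp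
    then obtain \<gamma> where \<gamma>: "\<gamma> \<in> Hom C u (Cod C ?qg)" "?ig \<cdot> \<gamma> = \<beta>" using kD(2)[OF \<beta>(1)] by blast
    have "?if \<cdot> (v \<cdot> \<gamma>) = \<beta>" using Comp_assoc[OF \<gamma>(1) v(1) If(1)] ifv \<gamma>(2) by simp
    then show "\<exists>\<alpha> \<in> Hom C u (Cod C ?qf). ?if \<cdot> \<alpha> = \<beta>" using Comp_Hom[OF \<gamma>(1) v(1)] by blast
  qed
qed

section \<open>The subcategory \<open>Pres\<close> as an abelian category\<close>

lemma additive_full_sub:
  assumes cor: "coreflective C B"
  shows "additive_category (full_sub C B)"
proof (intro additive_category.intro additive_category_axioms.intro preadditive_full_sub)
  obtain z where z: "z \<in> Sum_of \<kappa> C U" "\<forall>a \<in> Obj C. (\<exists>!f. f \<in> Hom C z a) \<and> (\<exists>!f. f \<in> Hom C a z)"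
    by (rule zero_object_Sum_of)
  then have zB: "z \<in> Obj C" "z \<in> B" using Sum_of_Obj Sum_of_Pres by auto
  show "\<exists>z \<in> Obj (full_sub C B). \<forall>a \<in> Obj (full_sub C B).
      (\<exists>!f. f \<in> Hom (full_sub C B) z a) \<and> (\<exists>!f. f \<in> Hom (full_sub C B) a z)"
    by (rule bexI[of _ z]) (use z(2) zB in \<open>simp_all add: Hom_full_sub\<close>)
next
  fix a b assume "a \<in> Obj (full_sub C B)" "b \<in> Obj (full_sub C B)"
  then have ab: "a \<in> Obj C" "b \<in> Obj C" "a \<in> B" "b \<in> B" by auto
  obtain x i j p q where x: "x \<in> Obj C" and i: "i \<in> Hom C a x" and j: "j \<in> Hom C b x"
    and p: "p \<in> Hom C x a" and q: "q \<in> Hom C x b"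
    and eq: "p \<cdot> i = Ident C a" "q \<cdot> j = Ident C b" "q \<cdot> i = Zero C a b" "p \<cdot> j = Zero C b a"
      "Add C (i \<cdot> p) (j \<cdot> q) = Ident C x"
    using ex_biproduct[OF ab(1,2)] by blast
  obtain r where r: "is_coreflection C B x r" using cor coreflective_iff[OF Pres_Obj] x by blast
  note rD = coreflectionD[OF r]
  \<comment> \<open>Lifting the two injections through the coreflection \<open>r\<close> of the
    biproduct produces the section \<open>i' \<cdot> p + j' \<cdot> q\<close> of \<open>r\<close>,
    which forces the biproduct into \<open>B\<close>.\<close>
  obtain i' where i': "i' \<in> Hom C a (Dom C r)" "r \<cdot> i' = i" using rD(3)[OF ab(3) i] by blast
  obtain j' where j': "j' \<in> Hom C b (Dom C r)" "r \<cdot> j' = j" using rD(3)[OF ab(4) j] by blast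
  note ip = Comp_Hom[OF p i'(1)] and jq = Comp_Hom[OF q j'(1)]
  have "r \<cdot> Add C (i' \<cdot> p) (j' \<cdot> q) = Ident C x"
    using Comp_Add[OF ip jq rD(1)] Comp_assoc[OF p i'(1) rD(1)] Comp_assoc[OF q j'(1) rD(1)] i'(2) j'(2) eq(5) by simp
  then have xB: "x \<in> B" using coreflection_section_mem[OF r Add_Hom[OF ip jq]] by blast
  show "\<exists>x \<in> Obj (full_sub C B). \<exists>i \<in> Hom (full_sub C B) a x. \<exists>j \<in> Hom (full_sub C B) b x.
      \<exists>p \<in> Hom (full_sub C B) x a. \<exists>q \<in> Hom (full_sub C B) x b.
        p \<cdot>\<^bsub>full_sub C B\<^esub> i = Ident (full_sub C B) a \<and> q \<cdot>\<^bsub>full_sub C B\<^esub> j = Ident (full_sub C B) b \<and>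
        q \<cdot>\<^bsub>full_sub C B\<^esub> i = Zero (full_sub C B) a b \<and> p \<cdot>\<^bsub>full_sub C B\<^esub> j = Zero (full_sub C B) b a \<and>
        Add (full_sub C B) (i \<cdot>\<^bsub>full_sub C B\<^esub> p) (j \<cdot>\<^bsub>full_sub C B\<^esub> q) = Ident (full_sub C B) x"
    by (rule bexI[of _ x], rule bexI[of _ i], rule bexI[of _ j], rule bexI[of _ p], rule bexI[of _ q])
      (use x xB ab i j p q eq in \<open>simp_all add: Hom_full_sub\<close>)
qed

lemma cokernel_full_sub:
  assumes c: "is_cokernel C f c" and f: "f \<in> Hom C a b" and B: "a \<in> B" "b \<in> B" "Cod C c \<in> B"
  shows "is_cokernel (full_sub C B) f c"
proof -
  note cD = cokernelD[OF c f]
  show ?thesis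
    using c B HomD[OF f] HomD[OF cD(1)] unfolding is_cokernel_def by (simp add: Hom_full_sub)
qed

text \<open>Cokernels are inherited from \<open>C\<close>, but kernels must be corrected by a
  coreflection, so coimages may change as well; \<open>qtk f\<close> turns out to be the cokernel of
  the corrected kernel.\<close>

lemma abelian_full_sub:
  assumes cor: "coreflective C B"
    and at: "\<And>f a b u. f \<in> Hom C a b \<Longrightarrow> a \<in> B \<Longrightarrow> b \<in> B \<Longrightarrow> u \<in> U \<Longrightarrow> kernel_at C u (Coker C f) (induced f)"
  shows "abelian_category (full_sub C B)"
proof -
  let ?D = "full_sub C B"
  interpret S: additive_category ?D by (rule additive_full_sub[OF cor])
  note closed = coreflective_closed_under_cokernels[OF cor]
  \<comment> \<open>A right adjoint preserves kernels: inside the subcategory the kernel is the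
    coreflection \<open>p\<close> of the kernel object, followed by \<open>Ker C f\<close>.\<close>
  have ker: "\<exists>p. is_coreflection C B (Dom C (Ker C f)) p \<and> is_kernel ?D f (Ker C f \<cdot> p)"
    if f: "f \<in> Hom C a b" and ab: "a \<in> B" "b \<in> B" for f a b
  proof -
    note KD = kernelD[OF Ker_kernel[OF f] f]
    obtain p where p: "is_coreflection C B (Dom C (Ker C f)) p"
      using cor coreflective_iff[OF Pres_Obj] HomD(4)[OF KD(1)] by blast
    note pD = coreflectionD[OF p]
    note kp = Comp_Hom[OF pD(1) KD(1)]
    have po: "Dom C p \<in> Obj C" using HomD[OF pD(1)] by simp
    have fD: "f \<in> Hom ?D a b" and kpD: "Ker C f \<cdot> p \<in> Hom ?D (Dom C p) a"
      using f ab kp pD(2) by (simp_all add: Hom_full_sub)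
    have "is_kernel ?D f (Ker C f \<cdot> p)"
    proof (rule S.kernelI[OF fD kpD])
      show "mono_arr ?D (Ker C f \<cdot> p)"
      proof (rule S.mono_arrI_Zero[OF kpD])
        fix x d assume "d \<in> Hom ?D x (Dom C p)" and 0: "(Ker C f \<cdot> p) \<cdot>\<^bsub>?D\<^esub> d = Zero ?D x a"
        then have d: "d \<in> Hom C x (Dom C p)" "x \<in> B" by (auto simp: Hom_full_sub split: if_splits)
        have xo: "x \<in> Obj C" using HomD[OF d(1)] by simp
        have "Ker C f \<cdot> (p \<cdot> d) = Zero C x a" using 0 Comp_assoc[OF d(1) pD(1) KD(1)] by simp
        then have "p \<cdot> d = Zero C x (Dom C (Ker C f))"
          using mono_arr_ZeroD[OF KD(3,1) Comp_Hom[OF d(1) pD(1)]] by blast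
        then have "p \<cdot> d = p \<cdot> Zero C x (Dom C p)" using Comp_Zero[OF pD(1) xo] by simp
        then show "d = Zero ?D x (Dom C p)" using pD(4)[OF d(2,1) Zero_Hom[OF xo po]] by simp
      qed
      show "f \<cdot>\<^bsub>?D\<^esub> (Ker C f \<cdot> p) = Zero ?D (Dom C p) b"
        using Comp_assoc[OF pD(1) KD(1) f] KD(2) Zero_Comp[OF pD(1)] HomD[OF f] by simp
      fix y g assume "g \<in> Hom ?D y a" and 0: "f \<cdot>\<^bsub>?D\<^esub> g = Zero ?D y b"
      then have g: "g \<in> Hom C y a" "y \<in> B" by (auto simp: Hom_full_sub split: if_splits)
      obtain h where h: "h \<in> Hom C y (Dom C (Ker C f))" "Ker C f \<cdot> h = g" using KD(4)[OF g(1)] 0 by auto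
      obtain l where l: "l \<in> Hom C y (Dom C p)" "p \<cdot> l = h" using pD(3)[OF g(2) h(1)] by blast
      have "(Ker C f \<cdot> p) \<cdot> l = g" using Comp_assoc[OF l(1) pD(1) KD(1)] l(2) h(2) by simp
      then show "\<exists>h \<in> Hom ?D y (Dom C p). (Ker C f \<cdot> p) \<cdot>\<^bsub>?D\<^esub> h = g"
        using l(1) g(2) pD(2) by (intro bexI[of _ l]) (simp_all add: Hom_full_sub)
    qed
    then show ?thesis using p by blast
  qed
  have arr: "f \<in> Hom C (Dom C f) (Cod C f)" "Dom C f \<in> B" "Cod C f \<in> B" if "f \<in> Arr ?D" for f
    using that Arr_Hom by auto
  have coker: "is_cokernel ?D f (Coker C f)" "Cod C (Coker C f) \<in> B" if f: "f \<in> Arr ?D" for f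
  proof -
    note fH = arr[OF f]
    show "Cod C (Coker C f) \<in> B"
      using closed_under_cokernelsD[OF closed Coker_cokernel[OF fH(1)] fH] .
    then show "is_cokernel ?D f (Coker C f)" using cokernel_full_sub[OF Coker_cokernel[OF fH(1)] fH] by blast
  qed
  show ?thesis
  proof (intro abelian_category.intro abelian_category_axioms.intro)
    show "additive_category ?D" by (rule S.additive_category_axioms)
    show "\<exists>k. is_kernel ?D f k" if "f \<in> Arr ?D" for f using ker[OF arr[OF that]] by blast
    show "\<exists>c. is_cokernel ?D f c" if "f \<in> Arr ?D" for f using coker[OF that] by blast
    fix f assume f0: "f \<in> Arr ?D"
    let ?a = "Dom C f" and ?b = "Cod C f"
    note f = arr[OF f0]
    note q = qtk_arr[OF f(1)] and ind = induced[OF f(1)]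
    have QB: "Cod C (qtk f) \<in> B" using qtk_Pres[OF f(1,2) closed] .
    note CD = cokernelD[OF Coker_cokernel[OF f(1)] f(1)]
    obtain p where p: "is_coreflection C B (Dom C (Ker C f)) p" and k: "is_kernel ?D f (Ker C f \<cdot> p)"
      using ker[OF f] by blast
    let ?k = "Ker C f \<cdot> p"
    have fD: "f \<in> Hom ?D ?a ?b" using f by (simp add: Hom_full_sub)
    note kD = S.kernelD[OF k fD]
    have kH: "?k \<in> Hom C (Dom C ?k) ?a" and kB: "Dom C ?k \<in> B"
      using kD(1) by (auto simp: Hom_full_sub split: if_splits)
    obtain Z s where s: "Z \<in> Sum_of \<kappa> C U" "s \<in> Hom C Z ?a" "f \<cdot> s = Zero C Z ?b" "is_cokernel C s (qtk f)"
      using qtk_cokernel[OF f(1)] .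
    have ZB: "Z \<in> B" using s(1) Sum_of_Pres by blast
    \<comment> \<open>\<open>s\<close> starts in \<open>B\<close> and is killed by \<open>f\<close>,
      so it factors through \<open>?k\<close>; as \<open>qtk f\<close> kills all of
      \<open>?k\<close>, the cokernel of \<open>s\<close> is also that of \<open>?k\<close>.\<close>
    obtain h where h: "h \<in> Hom C Z (Dom C ?k)" "?k \<cdot> h = s"
      using kD(4)[of s Z] s(2,3) ZB f(2) by (auto simp: Hom_full_sub split: if_splits)
    have "qtk f \<cdot> ?k = Zero C (Dom C ?k) (Cod C (qtk f))"
      using qtk_kills[OF f(1) kB kH] kD(2) by simp
    then have "is_cokernel C ?k (qtk f)" by (rule cokernel_cong[OF s(2) kH s(4) h])
    then have c: "is_cokernel ?D ?k (qtk f)" using cokernel_full_sub[OF _ kH kB f(2) QB] by blast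
    note d = coker[OF f0]
    have dD: "Coker C f \<in> Hom ?D ?b (Cod C (Coker C f))" and iD: "induced f \<in> Hom ?D (Cod C (qtk f)) ?b"
      using CD(1) d(2) f(3) ind(1) QB by (simp_all add: Hom_full_sub)
    \<comment> \<open>The hypothesis concerns members of \<open>U\<close>, whereas a kernel in the
      subcategory is tested against every object of \<open>B\<close>.\<close>
    have atB: "kernel_at C x (Coker C f) (induced f)" if "x \<in> B" for x
      using kernel_at_Pres[OF ind(1) CD(1) at[OF f] that] .
    note atD = kernel_atD[OF atB ind(1) CD(1)]
    have m: "is_kernel ?D (Coker C f) (induced f)"
    proof (rule S.kernelI[OF dD iD])
      show "mono_arr ?D (induced f)"
        by (rule S.mono_arrI_Zero[OF iD]) (use atD(1) in \<open>auto simp: Hom_full_sub split: if_splits\<close>)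
      show "Coker C f \<cdot>\<^bsub>?D\<^esub> induced f = Zero ?D (Cod C (qtk f)) (Cod C (Coker C f))" using ind(3) by simp
      fix y g assume "g \<in> Hom ?D y ?b" and 0: "Coker C f \<cdot>\<^bsub>?D\<^esub> g = Zero ?D y (Cod C (Coker C f))"
      then have g: "g \<in> Hom C y ?b" "y \<in> B" by (auto simp: Hom_full_sub split: if_splits)
      then show "\<exists>h \<in> Hom ?D y (Cod C (qtk f)). induced f \<cdot>\<^bsub>?D\<^esub> h = g"
        using atD(2)[OF g(2,1)] 0 QB by (simp add: Hom_full_sub)
    qed
    show "\<exists>h \<in> Hom ?D (Cod ?D (Coimg ?D f)) (Dom ?D (Img ?D f)).
        iso_arr ?D h \<and> Img ?D f \<cdot>\<^bsub>?D\<^esub> (h \<cdot>\<^bsub>?D\<^esub> Coimg ?D f) = f"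
      by (rule S.coimage_iso_imageI[OF fD k c d(1) m]) (use HomD[OF ind(1)] ind(2) in auto)
  qed
qed

text \<open>The subcategory factors \<open>f\<close> as \<open>e\<close>, a cokernel of its kernel,
  followed by \<open>m\<close>, a kernel of its cokernel. \<open>qtk f\<close> and \<open>e\<close>
  factor through each other, so \<open>induced f\<close> agrees with \<open>m\<close> up to an
  isomorphism and inherits its kernel property.\<close>

lemma abelian_imp_kernel_at:
  assumes cor: "coreflective C B" and ab: "abelian_category (full_sub C B)"
    and f: "f \<in> Hom C a b" and B: "a \<in> B" "b \<in> B" and u: "u \<in> U"
  shows "kernel_at C u (Coker C f) (induced f)"
proof -
  let ?D = "full_sub C B"
  interpret S: abelian_category ?D by (rule ab)
  note closed = coreflective_closed_under_cokernels[OF cor]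
  note q = qtk_arr[OF f] and ind = induced[OF f]
  have QB: "Cod C (qtk f) \<in> B" using qtk_Pres[OF f B(1) closed] .
  note CD = cokernelD[OF Coker_cokernel[OF f] f]
  have fD: "f \<in> Hom ?D a b" using f B by (simp add: Hom_full_sub)
  note k = S.Ker_kernel[OF fD]
  note kD = S.kernelD[OF k fD]
  have uB: "u \<in> B" using U_Pres[OF u] .
  define m where "m = Img ?D f"
  have md: "is_kernel ?D (Coker ?D f) m" unfolding m_def using S.Img_kernel[OF fD] .
  obtain e where e: "e \<in> Hom ?D a (Dom C m)" "is_cokernel ?D (Ker ?D f) e" "epi_arr ?D e" "m \<cdot> e = f"
    using S.image_factorization[OF fD] unfolding m_def by auto
  note dD = S.cokernelD[OF S.Coker_cokernel[OF fD] fD]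
  note mD = S.kernelD[OF md dD(1)]
  have mB: "Dom C m \<in> B" and mH: "m \<in> Hom C (Dom C m) b" and eH: "e \<in> Hom C a (Dom C m)"
    and kH: "Ker ?D f \<in> Hom C (Dom C (Ker ?D f)) a" and kB: "Dom C (Ker ?D f) \<in> B"
    and dH: "Coker ?D f \<in> Hom C b (Cod C (Coker ?D f))"
    using mD(1) e(1) kD(1) dD(1) by (auto simp: Hom_full_sub split: if_splits)
  \<comment> \<open>\<open>m\<close> is known to be mono in the subcategory only, so it is cancelled
    on sources in \<open>B\<close>.\<close>
  have mono: "\<alpha> = Zero C x (Dom C m)" if "x \<in> B" "\<alpha> \<in> Hom C x (Dom C m)" "m \<cdot> \<alpha> = Zero C x b" for x \<alpha>
    using S.mono_arr_ZeroD[OF mD(3), of "Dom C m" b \<alpha> x] mH mB B that by (simp add: Hom_full_sub)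
  have "qtk f \<cdot> Ker ?D f = Zero C (Dom C (Ker ?D f)) (Cod C (qtk f))"
    using qtk_kills[OF f kB kH] kD(2) by simp
  then obtain g where g: "g \<in> Hom C (Dom C m) (Cod C (qtk f))" "g \<cdot> e = qtk f"
    using S.cokernelD(4)[OF e(2) kD(1), of "qtk f" "Cod C (qtk f)"] q(1) QB B(1) HomD[OF eH]
    by (auto simp: Hom_full_sub split: if_splits)
  obtain Z s where s: "Z \<in> Sum_of \<kappa> C U" "s \<in> Hom C Z a" "f \<cdot> s = Zero C Z b" "is_cokernel C s (qtk f)"
    using qtk_cokernel[OF f] .
  have "m \<cdot> (e \<cdot> s) = Zero C Z b" using Comp_assoc[OF s(2) eH mH] e(4) s(3) by simp
  then have "e \<cdot> s = Zero C Z (Dom C m)" using mono[OF _ Comp_Hom[OF s(2) eH]] s(1) Sum_of_Pres by blast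
  then obtain g' where g': "g' \<in> Hom C (Cod C (qtk f)) (Dom C m)" "g' \<cdot> qtk f = e"
    using cokernelD(4)[OF s(4,2) eH] by blast
  have "(g \<cdot> g') \<cdot> qtk f = Ident C (Cod C (qtk f)) \<cdot> qtk f"
    using Comp_assoc[OF q(1) g'(1) g(1)] g'(2) g(2) Ident_Comp_Hom[OF q(1)] by simp
  then have gg': "g \<cdot> g' = Ident C (Cod C (qtk f))"
    using epi_arrD[OF q(2,1) Comp_Hom[OF g'(1) g(1)] Ident_Hom] HomD[OF g(1)] by blast
  have "(m \<cdot> g') \<cdot> qtk f = induced f \<cdot> qtk f"
    using Comp_assoc[OF q(1) g'(1) mH] g'(2) e(4) ind(2) by simp
  then have mg': "m \<cdot> g' = induced f" using epi_arrD[OF q(2,1) Comp_Hom[OF g'(1) mH] ind(1)] by blast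
  have e_epi: "x = y" if "x \<in> Hom C (Dom C m) (Dom C m)" "y \<in> Hom C (Dom C m) (Dom C m)" "x \<cdot> e = y \<cdot> e" for x y
    using S.epi_arrD[OF e(3,1), of x "Dom C m" y] that mB by (simp add: Hom_full_sub)
  have "(g' \<cdot> g) \<cdot> e = Ident C (Dom C m) \<cdot> e"
    using Comp_assoc[OF eH g(1) g'(1)] g'(2) g(2) Ident_Comp_Hom[OF eH] by simp
  then have g'g: "g' \<cdot> g = Ident C (Dom C m)"
    using e_epi[OF Comp_Hom[OF g(1) g'(1)] Ident_Hom] HomD[OF g(1)] by blast
  show ?thesis
  proof (rule kernel_atI[OF ind(1) CD(1)])
    fix \<alpha> assume \<alpha>: "\<alpha> \<in> Hom C u (Cod C (qtk f))" "induced f \<cdot> \<alpha> = Zero C u b"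
    have "m \<cdot> (g' \<cdot> \<alpha>) = Zero C u b" using Comp_assoc[OF \<alpha>(1) g'(1) mH] mg' \<alpha>(2) by simp
    then have "g' \<cdot> \<alpha> = Zero C u (Dom C m)" using mono[OF uB Comp_Hom[OF \<alpha>(1) g'(1)]] by blast
    then show "\<alpha> = Zero C u (Cod C (qtk f))"
      using cancel_left_inverse[OF g'(1) g(1) gg' \<alpha>(1)] Comp_Zero[OF g(1)] HomD[OF \<alpha>(1)] by simp
  next
    fix \<beta> assume \<beta>: "\<beta> \<in> Hom C u b" "Coker C f \<cdot> \<beta> = Zero C u (Cod C (Coker C f))"
    \<comment> \<open>\<open>Coker ?D f\<close> is picked independently of \<open>Coker C f\<close>,
      so the hypothesis on \<open>\<beta>\<close> is first carried over along a comparison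
      \<open>y\<close>.\<close>
    have "Coker ?D f \<cdot> f = Zero C a (Cod C (Coker ?D f))" using dD(2) by simp
    then obtain y where y: "y \<in> Hom C (Cod C (Coker C f)) (Cod C (Coker ?D f))" "y \<cdot> Coker C f = Coker ?D f"
      using CD(4)[OF dH] by blast
    have "Coker ?D f \<cdot> \<beta> = Zero C u (Cod C (Coker ?D f))"
      using Comp_eq_ZeroI[OF \<beta>(1) CD(1) y(1) \<beta>(2)] y(2) by simp
    then obtain \<gamma> where \<gamma>: "\<gamma> \<in> Hom C u (Dom C m)" "m \<cdot> \<gamma> = \<beta>"
      using mD(4)[of \<beta> u] \<beta>(1) uB B(2) by (auto simp: Hom_full_sub split: if_splits)
    have "induced f \<cdot> (g \<cdot> \<gamma>) = \<beta>"
      using mg' Comp_assoc[OF Comp_Hom[OF \<gamma>(1) g(1)] g'(1) mH] cancel_left_inverse[OF g(1) g'(1) g'g \<gamma>(1)] \<gamma>(2) by simp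
    then show "\<exists>\<alpha> \<in> Hom C u (Cod C (qtk f)). induced f \<cdot> \<alpha> = \<beta>" using Comp_Hom[OF \<gamma>(1) g(1)] by blast
  qed
qed


section \<open>Translation into the wording of the theorem\<close>

lemma iso_fbar_iff:
  assumes f: "f \<in> Hom C a b" and u: "u \<in> U"
  shows "(\<lambda>\<alpha>. fbar \<kappa> C U f \<cdot> \<alpha>) \<in> iso (hom_group C u (Cod C (qtk f))) (hom_group C u (Dom C (Img C f))) \<longleftrightarrow>
    kernel_at C u (Coker C f) (induced f)"
  using hom_group_iso_iff[OF fbar(1)[OF f]] bij_fbar_iff[OF f] u U_Obj by blast

lemma iso_fbar_imp_can_mor_inj:
  assumes closed: "closed_under_cokernels C B"
    and at: "\<And>f a b u. f \<in> Hom C a b \<Longrightarrow> a \<in> B \<Longrightarrow> b \<in> B \<Longrightarrow> u \<in> U \<Longrightarrow> kernel_at C u (Coker C f) (induced f)"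
    and x: "x \<in> Obj C" and u: "u \<in> U"
  shows "Hom C u (Cod C (Coker C (tr \<kappa> C U (Dom C (Ker C (can_mor C U x)))))) =
      {Zero C u (Cod C (Coker C (tr \<kappa> C U (Dom C (Ker C (can_mor C U x))))))}"
  unfolding Hom_Ker_quotient_zero_iff[OF can_mor(1)[OF x] u]
  by (intro ballI impI, rule induced_can_mor_inj[OF closed _ x u]) (rule at)

lemma Hom_Ker_quotient_zero_imp_coreflection:
  assumes "\<And>u. u \<in> U \<Longrightarrow> Hom C u (Cod C (Coker C (tr \<kappa> C U (Dom C (Ker C (can_mor C U x)))))) =
      {Zero C u (Cod C (Coker C (tr \<kappa> C U (Dom C (Ker C (can_mor C U x))))))}"
    and x: "x \<in> Obj C"
  shows "is_coreflection C B x (induced (can_mor C U x))"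
  using coreflection_can_mor[OF x] Hom_Ker_quotient_zero_iff[OF can_mor(1)[OF x]] assms(1) by blast

text \<open>Any right adjoint is compared with the one assembled from the maps
  \<open>induced (can_mor C U x)\<close>, whose sources are the quotients in question.\<close>

lemma right_adjoint_formula:
  assumes p: "\<And>x. x \<in> Obj C \<Longrightarrow> is_coreflection C B x (induced (can_mor C U x))"
    and R: "right_adjoint (full_sub C B) C inclusion R"
  shows "\<exists>q. cat_functor C (full_sub C B) q \<and> naturally_isomorphic C (full_sub C B) R q \<and>
    (\<forall>x \<in> Obj C. FObj q x = Cod C (qtk (can_mor C U x)))"
proof (intro exI conjI ballI)
  let ?p = "\<lambda>x. induced (can_mor C U x)"
  show "cat_functor C (full_sub C B) (coreflection_functor C ?p)"
    using coreflection_functor[OF p] .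
  show "naturally_isomorphic C (full_sub C B) R (coreflection_functor C ?p)"
    using right_adjoint_naturally_isomorphic[OF R Pres_Obj p] .
  show "FObj (coreflection_functor C ?p) x = Cod C (qtk (can_mor C U x))" if "x \<in> Obj C" for x
    using HomD(2)[OF induced(1)[OF can_mor(1)[OF that]]] by (simp add: coreflection_functor_def)
qed

end

theorem theorem8p6:
  fixes A :: "('o, 'm, 'z) preadd_cat_scheme"
    and \<kappa> :: "'k rel"
    and \<U> \<B> :: "'o set"
  assumes "Card_order \<kappa>" and "infinite (Field \<kappa>)" and "regularCard \<kappa>"
    and "abelian_category A" and "cocomplete \<kappa> A"
    and "\<U> \<subseteq> Obj A" and "small \<kappa> \<U>"
    and "\<And>U X. U \<in> \<U> \<Longrightarrow> X \<in> Obj A \<Longrightarrow> small \<kappa> (Hom A U X)"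
    and "\<B> = Pres \<kappa> A \<U>"
  shows
    "let
       P1 = coreflective A \<B> \<and> abelian_category (full_sub A \<B>);
       P2 = closed_under_cokernels A \<B> \<and>
            (\<forall>f \<in> Arr A. Dom A f \<in> \<B> \<and> Cod A f \<in> \<B> \<longrightarrow>
              (\<forall>U \<in> \<U>. (\<lambda>\<alpha>. fbar \<kappa> A \<U> f \<cdot>\<^bsub>A\<^esub> \<alpha>) \<in>
                 iso (hom_group A U (Cod A (quot_tr_ker \<kappa> A \<U> f)))
                     (hom_group A U (Dom A (Img A f)))));
       P3 = closed_under_cokernels A \<B> \<and>
            (\<forall>f \<in> Arr A. Dom A f \<in> \<B> \<and> Cod A f \<in> \<B> \<longrightarrow>
              is_coreflection A \<B> (Dom A (Img A f)) (fbar \<kappa> A \<U> f));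
       P4 = (\<forall>X \<in> Obj A. \<forall>U \<in> \<U>.
              let K = Dom A (Ker A (can_mor A \<U> X));
                  Q = Cod A (Coker A (tr \<kappa> A \<U> K))
              in Hom A U Q = {Zero A U Q}) \<and>
            (\<forall>g \<in> Arr A. Dom A g \<in> Sum_of \<kappa> A \<U> \<and> Cod A g \<in> \<B> \<longrightarrow>
              (\<forall>U \<in> \<U>. (\<lambda>\<alpha>. fbar \<kappa> A \<U> g \<cdot>\<^bsub>A\<^esub> \<alpha>) \<in>
                 iso (hom_group A U (Cod A (quot_tr_ker \<kappa> A \<U> g)))
                     (hom_group A U (Dom A (Img A g)))))
     in (P1 \<longleftrightarrow> P2) \<and> (P2 \<longleftrightarrow> P3) \<and> (P3 \<longleftrightarrow> P4) \<and>
        (P1 \<longrightarrow>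
          (\<forall>R. right_adjoint (full_sub A \<B>) A inclusion R \<longrightarrow>
            (\<exists>q. cat_functor A (full_sub A \<B>) q \<and>
                 naturally_isomorphic A (full_sub A \<B>) R q \<and>
                 (\<forall>X \<in> Obj A. FObj q X = Cod A (quot_tr_ker \<kappa> A \<U> (can_mor A \<U> X))))))"
proof -
  interpret small_family A \<kappa> \<U>
    by (intro small_family.intro small_family_axioms.intro) (fact assms(1-8))+
  let ?B = "Pres \<kappa> A \<U>"
  let ?iso = "\<lambda>f. \<forall>U \<in> \<U>. (\<lambda>\<alpha>. fbar \<kappa> A \<U> f \<cdot>\<^bsub>A\<^esub> \<alpha>) \<in>
    iso (hom_group A U (Cod A (quot_tr_ker \<kappa> A \<U> f))) (hom_group A U (Dom A (Img A f)))"
  let ?K = "\<lambda>X. Dom A (Ker A (can_mor A \<U> X))"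
  let ?Q = "\<lambda>X. Cod A (Coker A (tr \<kappa> A \<U> (?K X)))"
  let ?P1 = "coreflective A ?B \<and> abelian_category (full_sub A ?B)"
  let ?P2 = "closed_under_cokernels A ?B \<and> (\<forall>f \<in> Arr A. Dom A f \<in> ?B \<and> Cod A f \<in> ?B \<longrightarrow> ?iso f)"
  let ?P3 = "closed_under_cokernels A ?B \<and> (\<forall>f \<in> Arr A. Dom A f \<in> ?B \<and> Cod A f \<in> ?B \<longrightarrow>
    is_coreflection A ?B (Dom A (Img A f)) (fbar \<kappa> A \<U> f))"
  let ?P4 = "(\<forall>X \<in> Obj A. \<forall>U \<in> \<U>. Hom A U (?Q X) = {Zero A U (?Q X)}) \<and>
    (\<forall>g \<in> Arr A. Dom A g \<in> Sum_of \<kappa> A \<U> \<and> Cod A g \<in> ?B \<longrightarrow> ?iso g)"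
  have iso_iff: "?iso f \<longleftrightarrow> (\<forall>u \<in> \<U>. kernel_at A u (Coker A f) (induced f))" if "f \<in> Arr A" for f
    using iso_fbar_iff[OF Arr_Hom[OF that]] by simp
  have P2_kernel_at: "kernel_at A u (Coker A f) (induced f)"
    if "?P2" "f \<in> Hom A a b" "a \<in> ?B" "b \<in> ?B" "u \<in> \<U>" for f a b u
    using that(1,3-5) HomD(1-3)[OF that(2)] iso_iff[OF HomD(1)[OF that(2)]] by simp
  have 12: "?P2" if "?P1"
  proof (intro conjI ballI[of "Arr A"] impI)
    show "closed_under_cokernels A ?B" using coreflective_closed_under_cokernels that by blast
    fix f assume f: "f \<in> Arr A" "Dom A f \<in> ?B \<and> Cod A f \<in> ?B"
    show "?iso f" unfolding iso_iff[OF f(1)]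
      using abelian_imp_kernel_at[OF _ _ Arr_Hom[OF f(1)]] that f(2) by blast
  qed
  have 23: "?P3" if "?P2"
  proof (intro conjI ballI[of "Arr A"] impI)
    show closed: "closed_under_cokernels A ?B" using that by blast
    fix f assume f: "f \<in> Arr A" "Dom A f \<in> ?B \<and> Cod A f \<in> ?B"
    show "is_coreflection A ?B (Dom A (Img A f)) (fbar \<kappa> A \<U> f)"
      using kernel_at_imp_coreflection[OF closed Arr_Hom[OF f(1)]] P2_kernel_at[OF that Arr_Hom[OF f(1)]] f(2)
      by blast
  qed
  have 32: "?P2" if "?P3"
  proof (intro conjI ballI[of "Arr A"] impI)
    show "closed_under_cokernels A ?B" using that by blast
    fix f assume f: "f \<in> Arr A" "Dom A f \<in> ?B \<and> Cod A f \<in> ?B"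
    note fH = Arr_Hom[OF f(1)]
    have c: "is_coreflection A ?B (Dom A (Img A f)) (fbar \<kappa> A \<U> f)" using that f by blast
    have "bij_betw (\<lambda>\<alpha>. fbar \<kappa> A \<U> f \<cdot>\<^bsub>A\<^esub> \<alpha>) (Hom A u (Cod A (qtk f))) (Hom A u (Dom A (Img A f)))"
      if "u \<in> \<U>" for u
      using c U_Pres[OF that] HomD(2)[OF fbar(1)[OF fH]] unfolding is_coreflection_def by simp
    then show "?iso f" unfolding iso_iff[OF f(1)] using bij_fbar_iff[OF fH] U_Obj by blast
  qed
  have 24: "?P4" if "?P2"
  proof (rule conjI)
    show "\<forall>X \<in> Obj A. \<forall>U \<in> \<U>. Hom A U (?Q X) = {Zero A U (?Q X)}"
      by (intro ballI iso_fbar_imp_can_mor_inj[OF conjunct1[OF that]] P2_kernel_at[OF that])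
    show "\<forall>g \<in> Arr A. Dom A g \<in> Sum_of \<kappa> A \<U> \<and> Cod A g \<in> ?B \<longrightarrow> ?iso g"
      using conjunct2[OF that] Sum_of_Pres by blast
  qed
  have p4: "is_coreflection A ?B X (induced (can_mor A \<U> X))" if "?P4" "X \<in> Obj A" for X
    by (rule Hom_Ker_quotient_zero_imp_coreflection[OF _ that(2)]) (use that in blast)
  have cor4: "coreflective A ?B" if "?P4"
    using p4[OF that] coreflective_iff[OF Pres_Obj] by blast
  have 42: "?P2" if "?P4"
  proof (intro conjI ballI[of "Arr A"] impI)
    show "closed_under_cokernels A ?B" by (rule coreflective_closed_under_cokernels[OF cor4[OF that]])
    fix f assume f: "f \<in> Arr A" "Dom A f \<in> ?B \<and> Cod A f \<in> ?B"
    have "kernel_at A u (Coker A g) (induced g)"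
      if "S \<in> Sum_of \<kappa> A \<U>" "g \<in> Hom A S (Cod A f)" "u \<in> \<U>" for S g u
      using conjunct2[OF \<open>?P4\<close>] that(1,3) f(2) HomD(1-3)[OF that(2)] iso_iff[OF HomD(1)[OF that(2)]] by simp
    then show "?iso f" unfolding iso_iff[OF f(1)]
      using kernel_at_from_Sum_of[OF _ Arr_Hom[OF f(1)]] f(2) by blast
  qed
  have 41: "?P1" if "?P4"
    by (intro conjI cor4[OF that] abelian_full_sub) (rule P2_kernel_at[OF 42[OF that]])
  \<comment> \<open>The cycle runs from (1) to (2) to (4) and back to (1), and (3) is attached to
    (2).\<close>
  have P12: "?P1 \<longleftrightarrow> ?P2" using 12 24 41 by argo
  have P23: "?P2 \<longleftrightarrow> ?P3" using 23 32 by argo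
  have P34: "?P3 \<longleftrightarrow> ?P4" using 24 42 P23 by argo
  \<comment> \<open>(1) reaches (4) through (2), so the explicit coreflections exist and a given
    \<open>R\<close> can be compared with them.\<close>
  have formula: "?P1 \<longrightarrow> (\<forall>R. right_adjoint (full_sub A ?B) A inclusion R \<longrightarrow>
      (\<exists>q. cat_functor A (full_sub A ?B) q \<and> naturally_isomorphic A (full_sub A ?B) R q \<and>
           (\<forall>X \<in> Obj A. FObj q X = Cod A (quot_tr_ker \<kappa> A \<U> (can_mor A \<U> X)))))"
    using right_adjoint_formula[OF p4[OF 24[OF 12]]] by (intro impI allI)
  show ?thesis
    unfolding Let_def assms(9) by (intro conjI P12 P23 P34 formula)
qed

end
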